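(* Let $a$ and $H$ be as in the context. Let $\lambda\in\mathbb R$ and let $f_1,f_2\in\mathcal S_\lambda$ be such that, almost surely, $f_1(\cdot,\omega)<f_2(\cdot,\omega)$ on $\mathbb R$. Set $\theta_i:=\mathbb E[f_i(0,\omega)]$ for $i\in\{1,2\}$. For $\mu\in\mathbb R$ let $\mathfrak S(\mu;f_1,f_2)$ denote the family of bounded stationary functions $f:\mathbb R\times\Omega\to\mathbb R$ such that, almost surely, $f(\cdot,\omega)$ is of class $C^1$, solves $a(x,\omega)f'+H(x,f,\omega)=\mu$ in $\mathbb R$, and satisfies $f_1(\cdot,\omega)<f(\cdot,\omega)<f_2(\cdot,\omega)$ in $\mathbb R$. (i) If $\mathfrak S(\mu;f_1,f_2)=\emptyset$ for every $\mu<\lambda$, then $\mathcal H^L(H)(\theta)\ge\lambda$ for all $\theta\in(\theta_1,\theta_2)$. (ii) If $\mathfrak S(\mu;f_1,f_2)=\emptyset$ for every $\mu>\lambda$, then $\mathcal H^U(H)(\theta)\le\lambda$ for all $\theta\in(\theta_1,\theta_2)$.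
   Context: Probabilistic setting. $\Omega$ is a Polish space, $\mathcal F$ is its Borel $\sigma$-algebra completed with respect to the probability measure $\mathbb P$. $(\tau_x)_{x\in\mathbb R}$ is a family of maps $\tau_x:\Omega\to\Omega$ with $\tau_0=\mathrm{id}$, $\tau_{x+y}=\tau_x\circ\tau_y$, the map $(x,\omega)\mapsto\tau_x\omega$ from $\mathbb R\times\Omega$ (with the product of the Borel $\sigma$-algebra $\mathcal B$ of $\mathbb R$ and $\mathcal F$) to $\Omega$ (with its Borel sets) is measurable, and $\mathbb P(\tau_x(E))=\mathbb P(E)$ for all $E\in\mathcal F$, $x\in\mathbb R$. The action is ergodic: any measurable $\varphi:\Omega\to\mathbb R$ with $\mathbb P(\varphi(\tau_x\omega)=\varphi(\omega))=1$ for every fixed $x$ is almost surely constant. A $\mathcal B\otimes\mathcal F$-measurable $f:\mathbb R\times\Omega\to\mathbb R$ is stationary if $f(x+y,\omega)=f(x,\tau_y\omega)$ for all $x,y\in\mathbb R$, $\omega\in\Omega$. Coefficients. $a:\mathbb R\times\Omega\to[0,1]$ is stationary and, for some $\kappa>0$: (A1) $a(\cdot,\omega)>0$ on $\mathbb R$ for $\mathbb P$-a.e. $\omega$; (A2) $\sqrt{a(\cdot,\omega)}$ is $\kappa$-Lipschitz on $\mathbb R$ for all $\omega$. $H:\mathbb R\times\mathbb R\times\Omega\to\mathbb R$ is measurable, satisfies $H(x+y,p,\omega)=H(x,p,\tau_y\omega)$ for all $x,y,p,\omega$, and, for some constants $\alpha_0,\alpha_1>0$, $\gamma>2$ and all $x,y,p,q\in\mathbb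 R$, $\omega\in\Omega$: (H1) $\alpha_0|p|^\gamma-1/\alpha_0\le H(x,p,\omega)\le\alpha_1(|p|^\gamma+1)$; (H2) $|H(x,p,\omega)-H(x,q,\omega)|\le\alpha_1(|p|+|q|+1)^{\gamma-1}|p-q|$; (H3) $|H(x,p,\omega)-H(y,p,\omega)|\le\alpha_1(|p|^\gamma+1)|x-y|$. $\mathcal S_\lambda$ is the family of essentially bounded, jointly measurable, stationary functions $f:\mathbb R\times\Omega\to\mathbb R$ such that, almost surely, $f(\cdot,\omega)$ is a bounded $C^1$ solution of $a(x,\omega)f'+H(x,f,\omega)=\lambda$ in $\mathbb R$. For $\theta\in\mathbb R$, $u_\theta(\cdot,\cdot,\omega)$ denotes the unique uniformly continuous viscosity solution (it is Lipschitz) on $[0,+\infty)\times\mathbb R$ of $\partial_tu=a(x,\omega)\partial^2_{xx}u+H(x,\partial_xu,\omega)$ in $(0,+\infty)\times\mathbb R$ with $u_\theta(0,x,\omega)=\theta x$, and $$\mathcal H^L(H)(\theta):=\liminf_{t\to+\infty}\frac{u_\theta(t,0,\omega)}{t},\qquad \mathcal H^U(H)(\theta):=\limsup_{t\to+\infty}\frac{u_\theta(t,0,\omega)}{t},$$ which are almost surely equal to deterministic constants. *)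

theory Defs
  imports "HOL-Probability.Probability"
begin

section \<open>Probabilistic setting\<close>

text \<open>\<open>P\<close> is the completed probability measure, so \<open>sets P\<close> is the completed Borel
  \<open>\<sigma>\<close>-algebra. The maps \<open>\<tau> x\<close> are measurable from \<open>sets P\<close> to the Borel sets only, as is
  appropriate for a completed measure.\<close>

locale ergodic_flow =
  fixes P :: "'w::polish_space measure"
    and \<tau> :: "real \<Rightarrow> 'w \<Rightarrow> 'w"
  assumes completed_borel:
      "\<exists>P0. prob_space P0 \<and> sets P0 = sets borel \<and> P = completion P0"
    and flow_zero: "\<tau> 0 = id"
    and flow_add: "\<And>x y. \<tau> (x + y) = \<tau> x \<circ> \<tau> y"
    and flow_measurable: "(\<lambda>(x, \<omega>). \<tau> x \<omega>) \<in> borel \<Otimes>\<^sub>M P \<rightarrow>\<^sub>M borel"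
    and flow_preserving: "\<And>x E. E \<in> sets P \<Longrightarrow> emeasure P (\<tau> x ` E) = emeasure P E"
    and flow_ergodic:
      "\<And>\<phi> :: 'w \<Rightarrow> real. \<phi> \<in> borel_measurable P \<Longrightarrow>
         (\<And>x. AE \<omega> in P. \<phi> (\<tau> x \<omega>) = \<phi> \<omega>) \<Longrightarrow> (\<exists>c. AE \<omega> in P. \<phi> \<omega> = c)"

definition stationary ::
  "'w measure \<Rightarrow> (real \<Rightarrow> 'w \<Rightarrow> 'w) \<Rightarrow> (real \<Rightarrow> 'w \<Rightarrow> real) \<Rightarrow> bool" where
  "stationary P \<tau> f \<longleftrightarrow>
     (\<lambda>(x, \<omega>). f x \<omega>) \<in> borel_measurable (borel \<Otimes>\<^sub>M P) \<and>
     (\<forall>x y \<omega>. f (x + y) \<omega> = f x (\<tau> y \<omega>))"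


section \<open>Coefficients\<close>

locale hj_coefficients = ergodic_flow P \<tau>
  for P :: "'w::polish_space measure" and \<tau> :: "real \<Rightarrow> 'w \<Rightarrow> 'w" +
  fixes a :: "real \<Rightarrow> 'w \<Rightarrow> real"
    and H :: "real \<Rightarrow> real \<Rightarrow> 'w \<Rightarrow> real"
    and \<kappa> \<alpha>\<^sub>0 \<alpha>\<^sub>1 \<gamma> :: real
  assumes a_stationary: "stationary P \<tau> a"
    and a_range: "\<And>x \<omega>. a x \<omega> \<in> {0..1}"
    and kappa_pos: "\<kappa> > 0"
    and A1: "AE \<omega> in P. \<forall>x. a x \<omega> > 0"
    and A2: "\<And>\<omega>. \<kappa>-lipschitz_on UNIV (\<lambda>x. sqrt (a x \<omega>))"
    and H_measurable:
      "(\<lambda>(x, p, \<omega>). H x p \<omega>) \<in> borel_measurable (borel \<Otimes>\<^sub>M borel \<Otimes>\<^sub>M P)"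
    and H_stationary: "\<And>x y p \<omega>. H (x + y) p \<omega> = H x p (\<tau> y \<omega>)"
    and constants: "\<alpha>\<^sub>0 > 0" "\<alpha>\<^sub>1 > 0" "\<gamma> > 2"
    and H1: "\<And>x p \<omega>. \<alpha>\<^sub>0 * \<bar>p\<bar> powr \<gamma> - 1 / \<alpha>\<^sub>0 \<le> H x p \<omega>"
            "\<And>x p \<omega>. H x p \<omega> \<le> \<alpha>\<^sub>1 * (\<bar>p\<bar> powr \<gamma> + 1)"
    and H2: "\<And>x p q \<omega>. \<bar>H x p \<omega> - H x q \<omega>\<bar>
                        \<le> \<alpha>\<^sub>1 * (\<bar>p\<bar> + \<bar>q\<bar> + 1) powr (\<gamma> - 1) * \<bar>p - q\<bar>"
    and H3: "\<And>x y p \<omega>. \<bar>H x p \<omega> - H y p \<omega>\<bar> \<le> \<alpha>\<^sub>1 * (\<bar>p\<bar> powr \<gamma> + 1) * \<bar>x - y\<bar>"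


section \<open>Stationary solutions of the corrector equation\<close>

text \<open>\<open>C\<^sup>1\<close> solutions on the real line of \<open>A(x) g' + G(x, g) = \<mu>\<close>.\<close>

definition C1_solution ::
  "(real \<Rightarrow> real) \<Rightarrow> (real \<Rightarrow> real \<Rightarrow> real) \<Rightarrow> real \<Rightarrow> (real \<Rightarrow> real) \<Rightarrow> bool" where
  "C1_solution A G \<mu> g \<longleftrightarrow>
     g C1_differentiable_on UNIV \<and> (\<forall>x. A x * deriv g x + G x (g x) = \<mu>)"

definition essentially_bounded :: "'w measure \<Rightarrow> (real \<Rightarrow> 'w \<Rightarrow> real) \<Rightarrow> bool" where
  "essentially_bounded P f \<longleftrightarrow> (\<exists>C. AE (x, \<omega>) in lborel \<Otimes>\<^sub>M P. \<bar>f x \<omega>\<bar> \<le> C)"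

text \<open>The class \<open>S\<^sub>\<mu>\<close>.\<close>

definition stationary_solutions ::
  "'w measure \<Rightarrow> (real \<Rightarrow> 'w \<Rightarrow> 'w) \<Rightarrow> (real \<Rightarrow> 'w \<Rightarrow> real) \<Rightarrow>
   (real \<Rightarrow> real \<Rightarrow> 'w \<Rightarrow> real) \<Rightarrow> real \<Rightarrow> (real \<Rightarrow> 'w \<Rightarrow> real) set" where
  "stationary_solutions P \<tau> a H \<mu> =
     {f. stationary P \<tau> f \<and> essentially_bounded P f \<and>
         (AE \<omega> in P. bounded (range (\<lambda>x. f x \<omega>)) \<and>
            C1_solution (\<lambda>x. a x \<omega>) (\<lambda>x p. H x p \<omega>) \<mu> (\<lambda>x. f x \<omega>))}"

text \<open>The class \<open>\<SS>(\<mu>; f\<^sub>1, f\<^sub>2)\<close>; here boundedness is uniform over all \<open>x\<close> and \<open>\<omega>\<close>.\<close>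

definition stationary_solutions_between ::
  "'w measure \<Rightarrow> (real \<Rightarrow> 'w \<Rightarrow> 'w) \<Rightarrow> (real \<Rightarrow> 'w \<Rightarrow> real) \<Rightarrow>
   (real \<Rightarrow> real \<Rightarrow> 'w \<Rightarrow> real) \<Rightarrow> real \<Rightarrow> (real \<Rightarrow> 'w \<Rightarrow> real) \<Rightarrow> (real \<Rightarrow> 'w \<Rightarrow> real) \<Rightarrow>
   (real \<Rightarrow> 'w \<Rightarrow> real) set" where
  "stationary_solutions_between P \<tau> a H \<mu> f\<^sub>1 f\<^sub>2 =
     {f. stationary P \<tau> f \<and> bounded (range (\<lambda>(x, \<omega>). f x \<omega>)) \<and>
         (AE \<omega> in P. C1_solution (\<lambda>x. a x \<omega>) (\<lambda>x p. H x p \<omega>) \<mu> (\<lambda>x. f x \<omega>) \<and>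
            (\<forall>x. f\<^sub>1 x \<omega> < f x \<omega> \<and> f x \<omega> < f\<^sub>2 x \<omega>))}"


section \<open>Viscosity solutions\<close>

text \<open>Test functions of class \<open>C\<^sup>1\<close> in time and \<open>C\<^sup>2\<close> in space on \<open>(0, \<infinity>) \<times> \<real>\<close>, given together
  with their derivatives \<open>\<phi>\<^sub>t\<close>, \<open>\<phi>\<^sub>x\<close>, \<open>\<phi>\<^sub>x\<^sub>x\<close>.\<close>

definition parabolic_test ::
  "(real \<Rightarrow> real \<Rightarrow> real) \<Rightarrow> (real \<Rightarrow> real \<Rightarrow> real) \<Rightarrow> (real \<Rightarrow> real \<Rightarrow> real) \<Rightarrow>
   (real \<Rightarrow> real \<Rightarrow> real) \<Rightarrow> bool" where
  "parabolic_test \<phi> \<phi>t \<phi>x \<phi>xx \<longleftrightarrow>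
     (\<forall>t>0. \<forall>x.
        ((\<lambda>s. \<phi> s x) has_real_derivative \<phi>t t x) (at t) \<and>
        ((\<lambda>y. \<phi> t y) has_real_derivative \<phi>x t x) (at x) \<and>
        ((\<lambda>y. \<phi>x t y) has_real_derivative \<phi>xx t x) (at x)) \<and>
     continuous_on ({0<..} \<times> UNIV) (\<lambda>(t, x). \<phi> t x) \<and>
     continuous_on ({0<..} \<times> UNIV) (\<lambda>(t, x). \<phi>t t x) \<and>
     continuous_on ({0<..} \<times> UNIV) (\<lambda>(t, x). \<phi>x t x) \<and>
     continuous_on ({0<..} \<times> UNIV) (\<lambda>(t, x). \<phi>xx t x)"

text \<open>Sub- and supersolutions of \<open>\<partial>\<^sub>t u = A(x) \<partial>\<^sup>2\<^sub>x\<^sub>x u + G(x, \<partial>\<^sub>x u)\<close> in \<open>(0, \<infinity>) \<times> \<real>\<close>.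
  Semicontinuity is not required here: the definitions are only applied to continuous \<open>u\<close>.\<close>

definition viscosity_subsolution ::
  "(real \<Rightarrow> real) \<Rightarrow> (real \<Rightarrow> real \<Rightarrow> real) \<Rightarrow> (real \<Rightarrow> real \<Rightarrow> real) \<Rightarrow> bool" where
  "viscosity_subsolution A G u \<longleftrightarrow>
     (\<forall>\<phi> \<phi>t \<phi>x \<phi>xx t x.
        parabolic_test \<phi> \<phi>t \<phi>x \<phi>xx \<longrightarrow> t > 0 \<longrightarrow>
        (\<forall>\<^sub>F (s, y) in nhds (t, x). u s y - \<phi> s y \<le> u t x - \<phi> t x) \<longrightarrow>
        \<phi>t t x \<le> A x * \<phi>xx t x + G x (\<phi>x t x))"

definition viscosity_supersolution ::
  "(real \<Rightarrow> real) \<Rightarrow> (real \<Rightarrow> real \<Rightarrow> real) \<Rightarrow> (real \<Rightarrow> real \<Rightarrow> real) \<Rightarrow> bool" where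
  "viscosity_supersolution A G u \<longleftrightarrow>
     (\<forall>\<phi> \<phi>t \<phi>x \<phi>xx t x.
        parabolic_test \<phi> \<phi>t \<phi>x \<phi>xx \<longrightarrow> t > 0 \<longrightarrow>
        (\<forall>\<^sub>F (s, y) in nhds (t, x). u s y - \<phi> s y \<ge> u t x - \<phi> t x) \<longrightarrow>
        \<phi>t t x \<ge> A x * \<phi>xx t x + G x (\<phi>x t x))"

text \<open>Uniformly continuous viscosity solutions on \<open>[0, \<infinity>) \<times> \<real>\<close> with initial datum \<open>\<theta> x\<close>.
  The values \<open>u t x\<close> for \<open>t < 0\<close> are irrelevant.\<close>

definition uc_viscosity_solution ::
  "(real \<Rightarrow> real) \<Rightarrow> (real \<Rightarrow> real \<Rightarrow> real) \<Rightarrow> real \<Rightarrow> (real \<Rightarrow> real \<Rightarrow> real) \<Rightarrow> bool" where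
  "uc_viscosity_solution A G \<theta> u \<longleftrightarrow>
     uniformly_continuous_on ({0..} \<times> UNIV) (\<lambda>(t, x). u t x) \<and>
     viscosity_subsolution A G u \<and> viscosity_supersolution A G u \<and>
     (\<forall>x. u 0 x = \<theta> * x)"


section \<open>Effective growth rates\<close>

text \<open>Here \<open>u \<theta> t x \<omega>\<close> stands for \<open>u\<^sub>\<theta>(t, x, \<omega>)\<close>. The lower and upper limits are kept as
  functions of \<open>\<omega>\<close>; a bound on the deterministic constant that one of them almost surely
  equals is the same as an almost sure bound on it.\<close>

definition lower_growth ::
  "(real \<Rightarrow> real \<Rightarrow> real \<Rightarrow> 'w \<Rightarrow> real) \<Rightarrow> real \<Rightarrow> 'w \<Rightarrow> ereal" where
  "lower_growth u \<theta> \<omega> = Liminf at_top (\<lambda>t. ereal (u \<theta> t 0 \<omega> / t))"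

definition upper_growth ::
  "(real \<Rightarrow> real \<Rightarrow> real \<Rightarrow> 'w \<Rightarrow> real) \<Rightarrow> real \<Rightarrow> 'w \<Rightarrow> ereal" where
  "upper_growth u \<theta> \<omega> = Limsup at_top (\<lambda>t. ereal (u \<theta> t 0 \<omega> / t))"

end

theory Submission
  imports Defs
begin

text \<open>A solution of the equation at level \<open>\<mu> < lam\<close> can cross \<open>f\<^sub>1\<close> and \<open>f\<^sub>2\<close> only downwards. Start from
  \<open>f\<^sub>2\<close> and iterate the monotone map that sends \<open>h\<close> to the bounded solution \<open>g\<close> of
  \<open>a g' + L g = \<mu> + L h - H(x, h)\<close>, with \<open>h\<close> truncated on the right to the range of \<open>f\<^sub>1\<close> and \<open>f\<^sub>2\<close>;
  the iterates decrease to a stationary \<open>F < f\<^sub>2\<close> solving the truncated equation at level \<open>\<mu>\<close>. By ergodicity either \<open>F \<ge> f\<^sub>1\<close> almost surely, and then \<open>F\<close> is a stationary solution strictly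
  between \<open>f\<^sub>1\<close> and \<open>f\<^sub>2\<close>, or almost surely some iterate goes below \<open>f\<^sub>1\<close>. In the second case, descending
  slowly along the iterates yields a strict subsolution \<open>v\<close> of the stationary problem, at a level as
  close to \<open>\<mu>\<close> as desired, whose slope is \<open>f\<^sub>2\<close> near \<open>-\<infinity>\<close> and \<open>f\<^sub>1\<close> near \<open>\<infinity>\<close>. The ergodic theorem
  gives \<open>v(x) \<le> \<theta> x + C\<close> for \<open>\<theta>\<^sub>1 < \<theta> < \<theta>\<^sub>2\<close>, and comparison with \<open>v + \<mu>' t - C\<close> bounds \<open>u\<^sub>\<theta>\<close> from
  below. The upper bound is the lower bound for \<open>- H(x, - p)\<close>.\<close>

section \<open>Comparison with subsolutions of travelling type\<close>

text \<open>Two solutions at level \<open>lam\<close> with \<open>f\<^sub>1 < f\<^sub>2\<close>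
  never meet, so nothing at that level leads from one to the other; only a lower level makes
  crossings one-directional. The term \<open>L g\<close> does two jobs. With \<open>L\<close> above
  the Lipschitz constant of \<open>H\<close> in \<open>p\<close>, the source
  \<open>L h - H(x, h)\<close> is nondecreasing in \<open>h\<close>, whence the monotone iteration.
  Moreover, since \<open>1 / a\<close> has infinite integral near -infinity, the linear equation has
  exactly one bounded solution, an explicit integral over the past; it is jointly measurable and
  commutes with the flow, so stationarity costs no selection. The limit \<open>F\<close> lies below
  \<open>f\<^sub>2\<close> by a fixed gap and so cannot be joined to \<open>f\<^sub>2\<close>
  directly: the iterates are the intermediate rungs. They may drop below the range where the
  truncation is inactive, but the connection is the maximum with \<open>f\<^sub>1\<close>, which
  discards that part. A maximum has kinks only of convex type; \<open>slope_subsolution\<close>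
  therefore asks at each point for one slope \<open>m\<close> of a line that is below
  \<open>g\<close> to the right and above \<open>g\<close> to the left.\<close>

definition slope_subsolution ::
  "(real \<Rightarrow> real) \<Rightarrow> (real \<Rightarrow> real \<Rightarrow> real) \<Rightarrow> real \<Rightarrow> (real \<Rightarrow> real) \<Rightarrow> bool" where
  "slope_subsolution A G \<mu> g \<longleftrightarrow>
     (\<forall>x. \<exists>m. \<mu> \<le> A x * m + G x (g x) \<and>
        (\<forall>\<^sub>F y in nhds x. 0 \<le> (g y - g x - m * (y - x)) * (y - x)))"

lemma uniformly_continuous_linear_growth_in_time:
  fixes u :: "real \<Rightarrow> real \<Rightarrow> real"
  assumes "uniformly_continuous_on ({0..} \<times> UNIV) (\<lambda>(t, x). u t x)"
  obtains B where "B \<ge> 0" "\<And>t x. t \<ge> 0 \<Longrightarrow> \<bar>u t x - u 0 x\<bar> \<le> B * (1 + t)"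
proof -
  obtain d where d: "d > 0" and
    close: "\<And>z z'. z \<in> {0..} \<times> (UNIV :: real set) \<Longrightarrow> z' \<in> {0..} \<times> UNIV \<Longrightarrow> dist z' z < d \<Longrightarrow>
        dist ((\<lambda>(t, x). u t x) z') ((\<lambda>(t, x). u t x) z) < 1"
    using assms unfolding uniformly_continuous_on_def by (metis zero_less_one)
  have steps: "\<bar>u (real n * h) x - u 0 x\<bar> \<le> real n" if "0 \<le> h" "h < d" for n h x
  proof (induction n)
    case (Suc n)
    have "dist (real (Suc n) * h, x) (real n * h, x) = h"
      using that by (simp add: dist_Pair_Pair dist_real_def algebra_simps)
    then have "\<bar>u (real (Suc n) * h) x - u (real n * h) x\<bar> < 1"
      using close[of "(real n * h, x)" "(real (Suc n) * h, x)"] that by (auto simp: dist_real_def)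
    with Suc show ?case by auto
  qed simp
  show thesis
  proof (rule that[of "2 / d + 2"])
    show "0 \<le> 2 / d + 2" using d by simp
    fix t x :: real assume t: "t \<ge> 0"
    \<comment> \<open>The factor 2 and the summand 1 make \<open>t / real n\<close> strictly less
      than \<open>d\<close>, also for \<open>t = 0\<close>.\<close>
    define n where "n = nat \<lceil>2 * t / d\<rceil> + 1"
    have n: "real n \<ge> 2 * t / d" "real n \<le> 2 * t / d + 2" "real n \<ge> 1"
    proof -
      have "2 * t / d \<ge> 0" using t d by simp
      then show "real n \<ge> 2 * t / d" "real n \<le> 2 * t / d + 2" "real n \<ge> 1"
        unfolding n_def by linarith+
    qed
    then have "t \<le> real n * d / 2" using d by (simp add: field_simps)
    moreover have "real n * d > 0" using n d by simp
    ultimately have "t < d * real n" by (simp add: field_simps)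
    then have "t / real n < d" using n d by (simp add: field_simps)
    then have "\<bar>u (real n * (t / real n)) x - u 0 x\<bar> \<le> real n"
      using steps[of "t / real n" n x] t by simp
    then have "\<bar>u t x - u 0 x\<bar> \<le> 2 * t / d + 2" using n by auto
    also have "\<dots> \<le> (2 / d + 2) * (1 + t)" using d t by (auto simp: field_simps)
    finally show "\<bar>u t x - u 0 x\<bar> \<le> (2 / d + 2) * (1 + t)" .
  qed
qed


lemma ln_one_plus_square_derivs:
  fixes y :: real
  shows "((\<lambda>y. ln (1 + y\<^sup>2)) has_real_derivative 2 * y / (1 + y\<^sup>2)) (at y)"
    and "((\<lambda>y. 2 * y / (1 + y\<^sup>2)) has_real_derivative 2 * (1 - y\<^sup>2) / (1 + y\<^sup>2)\<^sup>2) (at y)"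
    and "\<bar>2 * y / (1 + y\<^sup>2)\<bar> \<le> 1"
    and "\<bar>2 * (1 - y\<^sup>2) / (1 + y\<^sup>2)\<^sup>2\<bar> \<le> 2"
proof -
  have pos: "1 + y\<^sup>2 > 0" by (simp add: add_pos_nonneg)
  show "((\<lambda>y. ln (1 + y\<^sup>2)) has_real_derivative 2 * y / (1 + y\<^sup>2)) (at y)"
    by (auto intro!: derivative_eq_intros simp: pos)
  show "((\<lambda>y. 2 * y / (1 + y\<^sup>2)) has_real_derivative 2 * (1 - y\<^sup>2) / (1 + y\<^sup>2)\<^sup>2) (at y)"
    using pos by (auto intro!: derivative_eq_intros simp: field_simps power2_eq_square)
  have "0 \<le> (1 - \<bar>y\<bar>)\<^sup>2" by simp
  then have "2 * \<bar>y\<bar> \<le> 1 + y\<^sup>2" by (simp add: power2_diff)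
  then show "\<bar>2 * y / (1 + y\<^sup>2)\<bar> \<le> 1" using pos by (simp add: abs_mult)
  have "\<bar>1 - y\<^sup>2\<bar> \<le> 1 + y\<^sup>2" by (smt (verit) zero_le_power2)
  also have "\<dots> \<le> (1 + y\<^sup>2)\<^sup>2" by (rule self_le_power) auto
  finally have "\<bar>1 - y\<^sup>2\<bar> / (1 + y\<^sup>2)\<^sup>2 \<le> 1" using pos by simp
  moreover have "\<bar>2 * (1 - y\<^sup>2) / (1 + y\<^sup>2)\<^sup>2\<bar> = 2 * (\<bar>1 - y\<^sup>2\<bar> / (1 + y\<^sup>2)\<^sup>2)"
    by (simp only: abs_mult abs_divide) simp
  ultimately show "\<bar>2 * (1 - y\<^sup>2) / (1 + y\<^sup>2)\<^sup>2\<bar> \<le> 2" by linarith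
qed

text \<open>By hypothesis \<open>g\<close> minus its line has the sign of \<open>y - x\<close>, so
  \<open>v\<close> minus the parabola decreases up to \<open>x\<close> and increases afterwards. The
  parabola, with second derivative \<open>m\<close>, can then replace the merely
  \<open>C\<^sup>1\<close> function \<open>v\<close> in a test function, and comparison works
  without doubling of variables.\<close>

lemma antiderivative_above_parabola:
  fixes v g :: "real \<Rightarrow> real"
  assumes v: "\<And>y. (v has_real_derivative g y) (at y)"
    and ev: "\<forall>\<^sub>F y in nhds x. 0 \<le> (g y - g x - m * (y - x)) * (y - x)"
  shows "\<forall>\<^sub>F y in nhds x. v x + g x * (y - x) + m / 2 * (y - x)\<^sup>2 \<le> v y"
proof -
  obtain d where d: "d > 0" "\<And>y. dist y x < d \<Longrightarrow> 0 \<le> (g y - g x - m * (y - x)) * (y - x)"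
    using ev unfolding eventually_nhds_metric by auto
  define k where "k y = v y - g x * (y - x) - m / 2 * (y - x)\<^sup>2" for y
  have k: "(k has_real_derivative g y - g x - m * (y - x)) (at y)" for y
    unfolding k_def by (auto intro!: derivative_eq_intros v)
  have "k x \<le> k y" if "dist y x < d" for y
  proof (cases "x \<le> y")
    case True
    show ?thesis
    proof (rule DERIV_nonneg_imp_nondecreasing[OF True])
      fix z assume z: "x \<le> z" "z \<le> y"
      then have "0 \<le> (g z - g x - m * (z - x)) * (z - x)" using d(2)[of z] that by (auto simp: dist_real_def)
      then have "0 \<le> g z - g x - m * (z - x)"
        using z by (cases "z = x") (auto simp: zero_le_mult_iff)
      then show "\<exists>c. (k has_real_derivative c) (at z) \<and> 0 \<le> c" using k by blast
    qed
  next
    case False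
    show ?thesis
    proof (rule DERIV_nonpos_imp_nonincreasing[of y x])
      show "y \<le> x" using False by simp
      fix z assume z: "y \<le> z" "z \<le> x"
      then have "0 \<le> (g z - g x - m * (z - x)) * (z - x)" using d(2)[of z] that by (auto simp: dist_real_def)
      then have "g z - g x - m * (z - x) \<le> 0"
        using z by (cases "z = x") (auto simp: zero_le_mult_iff)
      then show "\<exists>c. (k has_real_derivative c) (at z) \<and> c \<le> 0" using k by blast
    qed
  qed
  then have "v x + g x * (y - x) + m / 2 * (y - x)\<^sup>2 \<le> v y" if "dist y x < d" for y
    using that by (force simp: k_def)
  with d(1) show ?thesis unfolding eventually_nhds_metric by blast
qed

text \<open>The penalty \<open>\<epsilon> ln (1 + x\<^sup>2) + \<delta> t\<^sup>2\<close> makes \<open>u - (v - C + \<mu>' t)\<close> attain its minimum; its time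
  derivative has the favourable sign, and its space derivatives are of order \<open>\<epsilon>\<close>.\<close>

lemma supersolution_above_travelling_subsolution:
  fixes u :: "real \<Rightarrow> real \<Rightarrow> real" and v g A :: "real \<Rightarrow> real"
  assumes uc: "uniformly_continuous_on ({0..} \<times> UNIV) (\<lambda>(t, x). u t x)"
    and super: "viscosity_supersolution A G u"
    and init: "\<And>x. u 0 x = \<theta> * x"
    and A: "\<And>x. 0 \<le> A x" "\<And>x. A x \<le> 1"
    and G: "\<And>x p q. \<bar>p\<bar> \<le> R + 1 \<Longrightarrow> \<bar>q\<bar> \<le> R + 1 \<Longrightarrow> \<bar>G x p - G x q\<bar> \<le> K * \<bar>p - q\<bar>"
    and v: "\<And>x. (v has_real_derivative g x) (at x)"
    and g: "\<And>x. \<bar>g x\<bar> \<le> R" "slope_subsolution A G \<mu> g"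
    and below: "\<And>x. v x \<le> \<theta> * x + C"
    and "\<mu>' < \<mu>" "t\<^sub>0 \<ge> 0"
  shows "v x\<^sub>0 - C + \<mu>' * t\<^sub>0 \<le> u t\<^sub>0 x\<^sub>0"
proof (rule ccontr)
  assume neg: "\<not> ?thesis"
  have K: "K \<ge> 0"
  proof -
    have "R \<ge> 0" using g(1)[of 0] abs_ge_zero[of "g 0"] by linarith
    then show ?thesis using G[of 1 0 0] abs_ge_zero[of "G 0 1 - G 0 0"] by simp
  qed
  define D where "D t x = u t x - (v x - C + \<mu>' * t)" for t x
  obtain B where B: "B \<ge> 0" "\<And>t x. t \<ge> 0 \<Longrightarrow> \<bar>u t x - u 0 x\<bar> \<le> B * (1 + t)"
    using uniformly_continuous_linear_growth_in_time[OF uc] by blast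
  define B' where "B' = B + \<bar>\<mu>'\<bar>"
  have D0: "D 0 x \<ge> 0" for x using below[of x] init by (simp add: D_def)
  \<comment> \<open>Both \<open>u\<close> and \<open>v\<close> may grow linearly in
    \<open>x\<close>; the terms \<open>\<theta> * x\<close> cancel because
    \<open>u 0 x = \<theta> * x\<close> and \<open>v x \<le> \<theta> * x + C\<close>, which leaves
    a bound uniform in \<open>x\<close>.\<close>
  have D_low: "D t x \<ge> - B' * (1 + t)" if "t \<ge> 0" for t x
  proof -
    have "\<mu>' * t \<le> \<bar>\<mu>'\<bar> * t" using that by (intro mult_right_mono) auto
    also have "\<dots> \<le> \<bar>\<mu>'\<bar> * (1 + t)" by (intro mult_left_mono) auto
    finally have "\<mu>' * t \<le> \<bar>\<mu>'\<bar> * (1 + t)" .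
    then show ?thesis using B(2)[OF that, of x] below[of x] init[of x]
      by (auto simp: D_def B'_def algebra_simps abs_le_iff)
  qed
  have Dneg: "D t\<^sub>0 x\<^sub>0 < 0" using neg by (simp add: D_def)
  \<comment> \<open>The cap 1/2 keeps the test gradient within \<open>R + 1\<close>, where the
    Lipschitz bound for \<open>G\<close> holds; the second term makes the total error
    \<open>\<epsilon> * (2 + K)\<close> smaller than \<open>\<mu> - \<mu>'\<close>; the third, like
    \<delta>, limits a penalty at \<open>(t\<^sub>0, x\<^sub>0)\<close> to a quarter of
    \<open>- D t\<^sub>0 x\<^sub>0\<close>.\<close>
  define \<epsilon> where "\<epsilon> = min (1/2) (min ((\<mu> - \<mu>') / (2 * (3 + K))) (- D t\<^sub>0 x\<^sub>0 / (4 * (1 + ln (1 + x\<^sub>0\<^sup>2)))))"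
  define \<delta> where "\<delta> = - D t\<^sub>0 x\<^sub>0 / (4 * (1 + t\<^sub>0\<^sup>2))"
  have ln0: "ln (1 + x\<^sup>2) \<ge> 0" for x :: real by simp
  have "0 < (\<mu> - \<mu>') / (2 * (3 + K))" using K \<open>\<mu>' < \<mu>\<close> by (intro divide_pos_pos) auto
  moreover have "0 < - D t\<^sub>0 x\<^sub>0 / (4 * (1 + ln (1 + x\<^sub>0\<^sup>2)))"
    using Dneg ln0[of x\<^sub>0] by (intro divide_pos_pos mult_pos_pos add_pos_nonneg) auto
  ultimately have eps: "\<epsilon> > 0" "\<epsilon> \<le> 1/2" by (simp_all only: \<epsilon>_def min_less_iff_conj) simp_all
  have eps\<mu>: "\<epsilon> * (2 + K) < \<mu> - \<mu>'"
  proof -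
    have "\<epsilon> \<le> (\<mu> - \<mu>') / (2 * (3 + K))" by (simp add: \<epsilon>_def)
    then have "\<epsilon> * (2 * (3 + K)) \<le> \<mu> - \<mu>'" using K by (simp add: field_simps)
    moreover have "\<epsilon> * (2 + K) < \<epsilon> * (2 * (3 + K))" using eps K by simp
    ultimately show ?thesis by linarith
  qed
  have epsx: "\<epsilon> * ln (1 + x\<^sub>0\<^sup>2) \<le> - D t\<^sub>0 x\<^sub>0 / 4"
  proof -
    have "\<epsilon> \<le> - D t\<^sub>0 x\<^sub>0 / (4 * (1 + ln (1 + x\<^sub>0\<^sup>2)))" by (simp add: \<epsilon>_def)
    then have "\<epsilon> * (4 * (1 + ln (1 + x\<^sub>0\<^sup>2))) \<le> - D t\<^sub>0 x\<^sub>0" using ln0[of x\<^sub>0] by (simp add: field_simps)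
    then show ?thesis using eps by (simp add: algebra_simps)
  qed
  have delta: "\<delta> > 0" using Dneg unfolding \<delta>_def by (intro divide_pos_pos) (auto intro: add_pos_nonneg)
  have deltat: "\<delta> * t\<^sub>0\<^sup>2 \<le> - D t\<^sub>0 x\<^sub>0 / 4"
  proof -
    have "0 < 4 * (1 + t\<^sub>0\<^sup>2)" by (intro mult_pos_pos add_pos_nonneg) auto
    then have "4 * (1 + t\<^sub>0\<^sup>2) \<noteq> 0" by (rule less_imp_neq[symmetric])
    then have "\<delta> * (4 * (1 + t\<^sub>0\<^sup>2)) = - D t\<^sub>0 x\<^sub>0" unfolding \<delta>_def by (rule nonzero_eq_divide_eq[THEN iffD1, OF _ refl])
    then show ?thesis using delta by (simp add: algebra_simps)
  qed
  define Q where "Q z = (case z of (t, x) \<Rightarrow> D t x + \<epsilon> * ln (1 + x\<^sup>2) + \<delta> * t\<^sup>2)" for z :: "real \<times> real"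
  have Q0: "Q (t\<^sub>0, x\<^sub>0) < 0" using epsx deltat Dneg by (simp add: Q_def)
  \<comment> \<open>Beyond \<open>T\<close> the quadratic time penalty beats the linear lower bound
    of \<open>D\<close>; for \<open>t \<le> T\<close> the logarithm does so beyond \<open>X\<close>.
    So the minimum over the compact box \<open>S\<close> is a minimum over the whole
    half-plane.\<close>
  define T where "T = max t\<^sub>0 (max 1 (2 * B' / \<delta>))"
  define X where "X = max \<bar>x\<^sub>0\<bar> (exp (B' * (1 + T) / \<epsilon>))"
  have B': "B' \<ge> 0" using B by (simp add: B'_def)
  have outside: "Q (t, x) \<ge> 0" if "t \<ge> 0" "t \<ge> T \<or> \<bar>x\<bar> \<ge> X" for t x
  proof (cases "t \<ge> T")
    case True
    have t: "t \<ge> 1" "t \<ge> 2 * B' / \<delta>" using True by (auto simp: T_def)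
    then have "\<delta> * t \<ge> 2 * B'" using delta by (simp add: field_simps)
    then have "\<delta> * t * t \<ge> 2 * B' * t" using t by (intro mult_right_mono) auto
    moreover have "B' * (1 + t) \<le> 2 * B' * t" using mult_left_mono[OF t(1) B'] by (simp add: algebra_simps)
    ultimately have "\<delta> * t\<^sup>2 \<ge> B' * (1 + t)" by (simp add: power2_eq_square algebra_simps)
    moreover have "\<epsilon> * ln (1 + x\<^sup>2) \<ge> 0" using eps ln0 by simp
    ultimately show ?thesis using D_low[OF that(1), of x] by (simp add: Q_def)
  next
    case False
    then have t: "t \<le> T" and "\<bar>x\<bar> \<ge> exp (B' * (1 + T) / \<epsilon>)" using that by (auto simp: X_def)
    moreover have "exp (B' * (1 + T) / \<epsilon>) \<ge> 1" using B' eps \<open>t\<^sub>0 \<ge> 0\<close> by (simp add: T_def)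
    ultimately have "exp (B' * (1 + T) / \<epsilon>) \<le> \<bar>x\<bar>" "\<bar>x\<bar> \<ge> 1" by linarith+
    moreover have "\<bar>x\<bar> \<le> 1 + x\<^sup>2" using self_le_power[OF calculation(2), of 2] by simp
    ultimately have "exp (B' * (1 + T) / \<epsilon>) \<le> 1 + x\<^sup>2" by linarith
    moreover have "0 < 1 + x\<^sup>2" by (intro add_pos_nonneg) auto
    ultimately have "B' * (1 + T) / \<epsilon> \<le> ln (1 + x\<^sup>2)" by (simp only: ln_ge_iff)
    then have "B' * (1 + T) \<le> \<epsilon> * ln (1 + x\<^sup>2)" using eps by (simp add: field_simps)
    moreover have "B' * (1 + t) \<le> B' * (1 + T)" using t B' by (intro mult_left_mono) auto
    moreover have "\<delta> * t\<^sup>2 \<ge> 0" using delta by simp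
    ultimately show ?thesis using D_low[OF that(1), of x] by (simp add: Q_def)
  qed
  define S where "S = {0..T} \<times> {-X..X}"
  have nz: "1 + y\<^sup>2 \<noteq> 0" for y :: real
    using zero_le_power2[of y] by linarith
  have v_cont: "continuous_on UNIV v" using v by (auto simp: continuous_on_eq_continuous_at intro: DERIV_isCont)
  have "continuous_on S (\<lambda>z. u (fst z) (snd z))"
    using continuous_on_subset[OF uniformly_continuous_imp_continuous[OF uc], of S]
    unfolding S_def case_prod_beta by fastforce
  moreover have "continuous_on S (\<lambda>z. v (snd z))"
    by (rule continuous_on_compose2[OF v_cont]) (auto intro: continuous_intros)
  ultimately have "continuous_on S Q"
    unfolding Q_def D_def case_prod_beta
    using nz by (intro continuous_intros | simp)+
  moreover have "compact S" unfolding S_def by (intro compact_Times compact_Icc)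
  moreover have in_S: "(t\<^sub>0, x\<^sub>0) \<in> S" using \<open>t\<^sub>0 \<ge> 0\<close> by (auto simp: S_def T_def X_def)
  ultimately obtain z where z: "z \<in> S" "\<And>w. w \<in> S \<Longrightarrow> Q z \<le> Q w"
    using continuous_attains_inf[of S Q] by blast
  obtain t x where tx: "z = (t, x)" by (cases z)
  have Qz: "Q (t, x) < 0" using z(2)[OF in_S] Q0 tx by simp
  have min: "Q (t, x) \<le> Q (s, y)" if "s \<ge> 0" for s y
  proof (cases "(s, y) \<in> S")
    case False
    then have "s \<ge> T \<or> \<bar>y\<bar> \<ge> X" using that by (auto simp: S_def)
    then show ?thesis using outside[OF that] Qz by (meson less_le_trans less_imp_le)
  qed (use z tx in auto)
  have "t \<ge> 0" using z(1) tx by (auto simp: S_def)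
  moreover have "t \<noteq> 0"
  proof
    assume "t = 0"
    moreover have "\<epsilon> * ln (1 + x\<^sup>2) \<ge> 0" using eps ln0 by (intro mult_nonneg_nonneg) auto
    ultimately show False using Qz D0[of x] by (simp add: Q_def)
  qed
  ultimately have t: "t > 0" by simp
  obtain m where m: "\<mu> \<le> A x * m + G x (g x)"
    "\<forall>\<^sub>F y in nhds x. 0 \<le> (g y - g x - m * (y - x)) * (y - x)"
    using g(2) unfolding slope_subsolution_def by blast
  \<comment> \<open>The touching parabola in place of \<open>v\<close>, with the drift
    \<open>\<mu>' * s\<close> added and both penalties subtracted; additive constants do not
    matter.\<close>
  define \<phi> where "\<phi> s y = \<mu>' * s - \<delta> * s\<^sup>2 + g x * (y - x) + m / 2 * (y - x)\<^sup>2 - \<epsilon> * ln (1 + y\<^sup>2)" for s y :: real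
  define \<phi>t where "\<phi>t s y = \<mu>' - 2 * \<delta> * s" for s y :: real
  define \<phi>x where "\<phi>x s y = g x + m * (y - x) - \<epsilon> * (2 * y / (1 + y\<^sup>2))" for s y :: real
  define \<phi>xx where "\<phi>xx s y = m - \<epsilon> * (2 * (1 - y\<^sup>2) / (1 + y\<^sup>2)\<^sup>2)" for s y :: real
  have "parabolic_test \<phi> \<phi>t \<phi>x \<phi>xx"
    unfolding parabolic_test_def
  proof (intro conjI allI impI)
    fix s y :: real
    show "((\<lambda>s. \<phi> s y) has_real_derivative \<phi>t s y) (at s)"
      unfolding \<phi>_def \<phi>t_def by (auto intro!: derivative_eq_intros)
    show "(\<phi> s has_real_derivative \<phi>x s y) (at y)"
      unfolding \<phi>_def \<phi>x_def
      by (rule DERIV_diff[OF _ DERIV_cmult[OF ln_one_plus_square_derivs(1)]])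
         (auto intro!: derivative_eq_intros)
    show "(\<phi>x s has_real_derivative \<phi>xx s y) (at y)"
      unfolding \<phi>x_def \<phi>xx_def
      by (rule DERIV_diff[OF _ DERIV_cmult[OF ln_one_plus_square_derivs(2)]])
         (auto intro!: derivative_eq_intros)
  qed (auto simp: \<phi>_def \<phi>t_def \<phi>x_def \<phi>xx_def case_prod_beta nz intro!: continuous_intros)
  moreover have "\<forall>\<^sub>F (s, y) in nhds (t, x). u s y - \<phi> s y \<ge> u t x - \<phi> t x"
  proof -
    have "\<forall>\<^sub>F y in nhds x. v x + g x * (y - x) + m / 2 * (y - x)\<^sup>2 \<le> v y"
      by (rule antiderivative_above_parabola[OF v m(2)])
    moreover have "\<forall>\<^sub>F s in nhds t. s > 0"
      using t by (simp add: order_tendstoD(1)[OF filterlim_ident])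
    ultimately have "\<forall>\<^sub>F (s, y) in nhds t \<times>\<^sub>F nhds x.
        s > 0 \<and> v x + g x * (y - x) + m / 2 * (y - x)\<^sup>2 \<le> v y"
      unfolding case_prod_beta by (intro eventually_prodI)
    then show ?thesis unfolding nhds_prod
    proof (rule eventually_mono, clarify)
      fix s y :: real assume "0 < s" "v x + g x * (y - x) + m / 2 * (y - x)\<^sup>2 \<le> v y"
      then show "u t x - \<phi> t x \<le> u s y - \<phi> s y"
        using min[of s y] by (simp add: Q_def D_def \<phi>_def)
    qed
  qed
  ultimately have "\<phi>t t x \<ge> A x * \<phi>xx t x + G x (\<phi>x t x)"
    using super t unfolding viscosity_supersolution_def by blast
  moreover have "G x (\<phi>x t x) \<ge> G x (g x) - K * \<epsilon>"
  proof -
    have e: "\<bar>\<epsilon> * (2 * x / (1 + x\<^sup>2))\<bar> \<le> \<epsilon>"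
      using mult_left_mono[OF ln_one_plus_square_derivs(3), of \<epsilon> x] eps by (simp only: abs_mult) simp
    have "\<bar>G x (\<phi>x t x) - G x (g x)\<bar> \<le> K * \<bar>\<phi>x t x - g x\<bar>"
    proof (rule G)
      have "g x + m * (x - x) = g x" by simp
      then show "\<bar>\<phi>x t x\<bar> \<le> R + 1"
        unfolding \<phi>x_def using e g(1)[of x] eps by (simp only:)
    qed (use g(1)[of x] in linarith)
    also have "\<phi>x t x - g x = - (\<epsilon> * (2 * x / (1 + x\<^sup>2)))" unfolding \<phi>x_def by (simp add: algebra_simps)
    also have "K * \<bar>- (\<epsilon> * (2 * x / (1 + x\<^sup>2)))\<bar> \<le> K * \<epsilon>"
      unfolding abs_minus_cancel by (rule mult_left_mono[OF e K])
    finally show ?thesis by linarith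
  qed
  moreover have "A x * \<phi>xx t x \<ge> A x * m - 2 * \<epsilon>"
  proof -
    have "\<epsilon> * (2 * (1 - x\<^sup>2) / (1 + x\<^sup>2)\<^sup>2) \<le> \<epsilon> * 2"
      using ln_one_plus_square_derivs(4)[of x] eps by (intro mult_left_mono) linarith+
    then have "A x * (\<epsilon> * (2 * (1 - x\<^sup>2) / (1 + x\<^sup>2)\<^sup>2)) \<le> A x * (\<epsilon> * 2)"
      by (rule mult_left_mono) (rule A)
    also have "\<dots> \<le> 1 * (\<epsilon> * 2)" using A eps by (intro mult_right_mono) auto
    finally show ?thesis unfolding \<phi>xx_def right_diff_distrib by linarith
  qed
  ultimately have "\<mu>' - 2 * \<delta> * t \<ge> \<mu> - \<epsilon> * (2 + K)" using m(1) unfolding \<phi>t_def by (simp add: algebra_simps)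
  moreover have "\<delta> * t > 0" using delta t by simp
  ultimately show False using eps\<mu> by linarith
qed


section \<open>The resolvent of \<open>a g' + L g\<close>\<close>

text \<open>With \<open>y = x - r\<close> this is the Duhamel integral over \<open>y \<le> x\<close>
  of \<open>\<psi> y / A y\<close> times the exponential of \<open>- L\<close> times the integral of
  \<open>1 / A\<close> over [y, x], that is, the bounded solution of
  \<open>A g' + L g = \<psi>\<close>. Integrating over the whole line in \<open>r\<close>, with
  cut-offs inside, makes translation covariance formal and joint measurability a matter of
  parametrised integrals.\<close>

definition relax :: "(real \<Rightarrow> real) \<Rightarrow> real \<Rightarrow> (real \<Rightarrow> real) \<Rightarrow> real \<Rightarrow> real" where
  "relax A L \<psi> x =
     (LBINT r. if 0 \<le> r
        then exp (- L * (LBINT z. if 0 \<le> z \<and> z \<le> r then 1 / A (x - z) else 0)) / A (x - r) * \<psi> (x - r)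
        else 0)"

lemma relax_shift: "relax (\<lambda>x. A (x + y)) L (\<lambda>x. \<psi> (x + y)) x = relax A L \<psi> (x + y)"
proof -
  have "x - r + y = x + y - r" for r :: real by simp
  then show ?thesis unfolding relax_def by (simp only:)
qed

lemma relax_measurable [measurable (raw)]:
  fixes a \<psi> :: "real \<Rightarrow> 'w \<Rightarrow> real"
  assumes [measurable]: "(\<lambda>(x, \<omega>). a x \<omega>) \<in> borel_measurable (borel \<Otimes>\<^sub>M M)"
    "(\<lambda>(x, \<omega>). \<psi> x \<omega>) \<in> borel_measurable (borel \<Otimes>\<^sub>M M)"
  shows "(\<lambda>(x, \<omega>). relax (\<lambda>x. a x \<omega>) L (\<lambda>x. \<psi> x \<omega>) x) \<in> borel_measurable (borel \<Otimes>\<^sub>M M)"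
proof -
  have m: "(\<lambda>p. f (g p) (h p)) \<in> borel_measurable N"
    if "(\<lambda>(x, \<omega>). f x \<omega>) \<in> borel_measurable (borel \<Otimes>\<^sub>M M)" "g \<in> borel_measurable N" "h \<in> N \<rightarrow>\<^sub>M M"
    for f :: "real \<Rightarrow> 'w \<Rightarrow> real" and g :: "'x \<Rightarrow> real" and h N
    using measurable_compose[OF measurable_Pair[OF that(2,3)] that(1)] by simp
  have [measurable]: "(\<lambda>((p, r), z). a (fst p - z) (snd p)) \<in> borel_measurable (((borel \<Otimes>\<^sub>M M) \<Otimes>\<^sub>M borel) \<Otimes>\<^sub>M lborel)"
    unfolding case_prod_beta by (rule m[OF assms(1)]) measurable
  have [measurable]: "(\<lambda>(p, r). LBINT z. if 0 \<le> z \<and> z \<le> r then 1 / a (fst p - z) (snd p) else 0)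
      \<in> borel_measurable ((borel \<Otimes>\<^sub>M M) \<Otimes>\<^sub>M borel)"
    unfolding case_prod_beta
    by (rule lborel.borel_measurable_lebesgue_integral) (use m[OF assms(1)] in measurable)
  have [measurable]: "(\<lambda>(p, r). a (fst p - r) (snd p)) \<in> borel_measurable ((borel \<Otimes>\<^sub>M M) \<Otimes>\<^sub>M borel)"
    unfolding case_prod_beta by (rule m[OF assms(1)]) measurable
  have [measurable]: "(\<lambda>(p, r). \<psi> (fst p - r) (snd p)) \<in> borel_measurable ((borel \<Otimes>\<^sub>M M) \<Otimes>\<^sub>M borel)"
    unfolding case_prod_beta by (rule m[OF assms(2)]) measurable
  show ?thesis
    unfolding relax_def case_prod_beta
    by (rule lborel.borel_measurable_lebesgue_integral) measurable
qed

lemma antiderivative_exists: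
  fixes f :: "real \<Rightarrow> real"
  assumes "continuous_on UNIV f"
  shows "\<exists>F. \<forall>x. (F has_real_derivative f x) (at x)"
  using einterval_antiderivative[of "-\<infinity>" \<infinity> f] assms
  by (auto simp: continuous_on_eq_continuous_at has_real_derivative_iff_has_vector_derivative)

locale relaxation =
  fixes A :: "real \<Rightarrow> real" and L :: real
  assumes A_cont: "continuous_on UNIV A"
    and A_pos: "\<And>x. 0 < A x"
    and A_le: "\<And>x. A x \<le> 1"
    and L_pos: "L > 0"
begin

text \<open>The time change \<open>dE = dx / A\<close>, in which \<open>exp (L * E x)\<close> is the
  integrating factor. The additive constant cancels in \<open>kern\<close>, so any antiderivative
  serves.\<close>

definition "E = (SOME E. \<forall>x. (E has_real_derivative 1 / A x) (at x))"

lemma E: "(E has_real_derivative 1 / A x) (at x)"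
proof -
  have "\<exists>E. \<forall>x. (E has_real_derivative 1 / A x) (at x)"
    using A_pos by (intro antiderivative_exists continuous_intros A_cont) (auto simp: less_imp_neq[symmetric])
  from someI_ex[OF this] show ?thesis unfolding E_def by blast
qed

lemma E_isCont: "isCont E x"
  using E by (rule DERIV_isCont)

lemma E_cont: "continuous_on S E"
  using E_isCont by (simp add: continuous_at_imp_continuous_on)

text \<open>\<open>A \<le> 1\<close> makes \<open>E\<close> increase at least at unit speed; hence
  \<open>E\<close> tends to -infinity on the left and the influence of the far past decays.\<close>

lemma E_growth: "x \<le> y \<Longrightarrow> y - x \<le> E y - E x"
proof -
  assume "x \<le> y"
  then have "E x - x \<le> E y - y"
  proof (rule DERIV_nonneg_imp_nondecreasing)
    fix z
    have "((\<lambda>z. E z - z) has_real_derivative 1 / A z - 1) (at z)"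
      by (auto intro!: derivative_eq_intros E)
    moreover have "1 / A z - 1 \<ge> 0" using A_pos[of z] A_le[of z] by simp
    ultimately show "\<exists>c. ((\<lambda>z. E z - z) has_real_derivative c) (at z) \<and> 0 \<le> c" by blast
  qed
  then show ?thesis by simp
qed

lemma exp_E_tendsto: "((\<lambda>x. exp (L * E x)) \<longlongrightarrow> 0) at_bot"
proof (rule tendsto_sandwich[where f = "\<lambda>_. 0" and h = "\<lambda>x. exp (L * (E 0 + x))"])
  show "\<forall>\<^sub>F x in at_bot. exp (L * E x) \<le> exp (L * (E 0 + x))"
  proof (rule eventually_at_bot_linorderI[of 0])
    fix x :: real assume "x \<le> 0"
    then have "L * E x \<le> L * (E 0 + x)" using E_growth[of x 0] L_pos by (intro mult_left_mono) auto
    then show "exp (L * E x) \<le> exp (L * (E 0 + x))" by simp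
  qed
  have "filterlim (\<lambda>x. L * (E 0 + x)) at_bot at_bot"
    unfolding filterlim_at_bot eventually_at_bot_linorder
  proof
    fix Z
    have "L * (E 0 + x) \<le> Z" if "x \<le> Z / L - E 0" for x
      using mult_left_mono[of "E 0 + x" "Z / L" L] that L_pos by simp
    then show "\<exists>N. \<forall>n\<le>N. L * (E 0 + n) \<le> Z" by blast
  qed
  then show "((\<lambda>x. exp (L * (E 0 + x))) \<longlongrightarrow> 0) at_bot"
    by (rule filterlim_compose[OF exp_at_bot])
qed auto

text \<open>Multiplied by the integrating factor, \<open>d\<close> becomes nondecreasing, and
  boundedness of \<open>d\<close> forces the product to vanish at -infinity. Boundedness thus
  replaces an initial condition.\<close>

lemma nonneg_of_differential_inequality:
  assumes d: "\<And>x. (d has_real_derivative d' x) (at x)"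
    and ge: "\<And>x. 0 \<le> A x * d' x + L * d x"
    and bd: "\<And>x. \<bar>d x\<bar> \<le> B"
  shows "0 \<le> d x"
proof -
  have mono: "d y * exp (L * E y) \<le> d x * exp (L * E x)" if "y \<le> x" for x y
    using that
  proof (rule DERIV_nonneg_imp_nondecreasing)
    fix z
    have "((\<lambda>z. d z * exp (L * E z)) has_real_derivative
        exp (L * E z) * ((A z * d' z + L * d z) / A z)) (at z)"
      using A_pos[of z] by (auto intro!: derivative_eq_intros E d simp: field_simps)
    moreover have "0 \<le> exp (L * E z) * ((A z * d' z + L * d z) / A z)"
      using ge[of z] A_pos[of z] by simp
    ultimately show "\<exists>c. ((\<lambda>z. d z * exp (L * E z)) has_real_derivative c) (at z) \<and> 0 \<le> c" by blast
  qed
  have "0 \<le> d x * exp (L * E x)"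
  proof (rule tendsto_upperbound)
    have "((\<lambda>y. - B * exp (L * E y)) \<longlongrightarrow> - B * 0) at_bot"
      by (intro tendsto_intros exp_E_tendsto)
    then show "((\<lambda>y. - B * exp (L * E y)) \<longlongrightarrow> 0) at_bot" by simp
    show "\<forall>\<^sub>F y in at_bot. - B * exp (L * E y) \<le> d x * exp (L * E x)"
    proof (rule eventually_at_bot_linorderI[of x])
      fix y assume "y \<le> x"
      have "- B * exp (L * E y) \<le> d y * exp (L * E y)"
        using bd[of y] by (intro mult_right_mono) auto
      with mono[OF \<open>y \<le> x\<close>] show "- B * exp (L * E y) \<le> d x * exp (L * E x)" by linarith
    qed
  qed simp
  then show ?thesis by (simp add: zero_le_mult_iff)
qed

definition "kern x r = (if 0 \<le> r then exp (- L * (E x - E (x - r))) / A (x - r) else 0)"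

lemma kern_nonneg: "kern x r \<ge> 0"
  using A_pos[of "x - r"] by (simp add: kern_def)

lemma A_measurable [measurable]: "A \<in> borel_measurable borel"
  using A_cont by (rule borel_measurable_continuous_onI)

lemma E_measurable [measurable]: "E \<in> borel_measurable borel"
  using E_cont by (rule borel_measurable_continuous_onI)

lemma kern_measurable [measurable]: "kern x \<in> borel_measurable borel"
  unfolding kern_def by measurable

lemma relax_kern: "relax A L \<psi> x = (LBINT r. kern x r * \<psi> (x - r))"
  unfolding relax_def
proof (rule Bochner_Integration.integral_cong[OF refl])
  fix r :: real
  show "(if 0 \<le> r then exp (- L * (LBINT z. if 0 \<le> z \<and> z \<le> r then 1 / A (x - z) else 0)) / A (x - r) * \<psi> (x - r) else 0)
      = kern x r * \<psi> (x - r)"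
  proof (cases "0 \<le> r")
    case True
    have "has_bochner_integral lborel (\<lambda>z. 1 / A (x - z) * indicator {0..r} z) (- E (x - r) - - E (x - 0))"
    proof (rule has_bochner_integral_FTC_Icc_real[OF True])
      show "((\<lambda>z. - E (x - z)) has_real_derivative 1 / A (x - z)) (at z)" for z
        by (auto intro!: derivative_eq_intros DERIV_chain'[OF _ E])
      show "isCont (\<lambda>z. 1 / A (x - z)) z" for z
        using A_cont A_pos[of "x - z"]
        by (intro continuous_intros isCont_o2[where f = "\<lambda>z. x - z" and g = A])
           (auto simp: continuous_on_eq_continuous_at)
    qed
    then have "(LBINT z. 1 / A (x - z) * indicator {0..r} z) = E x - E (x - r)"
      by (simp add: has_bochner_integral_integral_eq)
    moreover have "(LBINT z. if 0 \<le> z \<and> z \<le> r then 1 / A (x - z) else 0) = (LBINT z. 1 / A (x - z) * indicator {0..r} z)"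
      by (intro Bochner_Integration.integral_cong) (auto simp: indicator_def)
    ultimately show ?thesis using True by (simp add: kern_def)
  qed (simp add: kern_def)
qed

text \<open>\<open>kern x\<close> is the \<open>r\<close>-derivative of
  \<open>- (1 / L) * exp (- L * (E x - E (x - r)))\<close>, which rises from \<open>- 1 / L\<close>
  to 0. The mass does not depend on \<open>A\<close>, so the bounds on \<open>relax\<close> hold
  however small \<open>A\<close> becomes.\<close>

lemma kern_integral: "has_bochner_integral lborel (kern x) (1 / L)"
proof -
  have "(\<integral>\<^sup>+r. ennreal (kern x r) * indicator {0..} r \<partial>lborel) = 0 - (- (1 / L) * exp (- L * (E x - E (x - 0))))"
  proof (rule nn_integral_FTC_atLeast)
    show "((\<lambda>r. - (1 / L) * exp (- L * (E x - E (x - r)))) has_real_derivative kern x r) (at r)"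
      if "0 \<le> r" for r
      using L_pos that A_pos[of "x - r"]
      by (auto intro!: derivative_eq_intros DERIV_chain'[OF _ E] simp: kern_def)
    have "((\<lambda>r. exp (- L * E x) * exp (L * E (x - r))) \<longlongrightarrow> exp (- L * E x) * 0) at_top"
    proof (intro tendsto_mult tendsto_const filterlim_compose[OF exp_E_tendsto])
      show "filterlim (\<lambda>r. x - r) at_bot at_top"
        unfolding filterlim_at_bot eventually_at_top_linorder
      proof
        fix Z
        show "\<exists>N. \<forall>n\<ge>N. x - n \<le> Z" by (rule exI[of _ "x - Z"]) auto
      qed
    qed
    then have "((\<lambda>r. - (1 / L) * (exp (- L * E x) * exp (L * E (x - r)))) \<longlongrightarrow> - (1 / L) * 0) at_top"
      by (intro tendsto_mult tendsto_const) simp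
    then show "((\<lambda>r. - (1 / L) * exp (- L * (E x - E (x - r)))) \<longlongrightarrow> 0) at_top"
      by (simp add: exp_add[symmetric] algebra_simps)
  qed (auto simp: kern_nonneg)
  also have "(\<integral>\<^sup>+r. ennreal (kern x r) * indicator {0..} r \<partial>lborel) = (\<integral>\<^sup>+r. ennreal (kern x r) \<partial>lborel)"
    by (intro nn_integral_cong) (auto simp: indicator_def kern_def)
  finally show ?thesis
    using L_pos by (intro has_bochner_integral_nn_integral) (auto simp: kern_nonneg)
qed

lemma kern_mult_integrable:
  assumes [measurable]: "\<psi> \<in> borel_measurable borel" and bd: "\<And>y. \<bar>\<psi> y\<bar> \<le> B"
  shows "integrable lborel (\<lambda>r. kern x r * \<psi> (x - r))"
proof (rule Bochner_Integration.integrable_bound)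
  show "integrable lborel (\<lambda>r. B * kern x r)"
    using kern_integral by (auto simp: has_bochner_integral_iff)
  show "AE r in lborel. norm (kern x r * \<psi> (x - r)) \<le> norm (B * kern x r)"
  proof (rule AE_I2)
    fix r
    have "\<bar>\<psi> (x - r)\<bar> \<le> \<bar>B\<bar>" using bd[of "x - r"] by linarith
    then show "norm (kern x r * \<psi> (x - r)) \<le> norm (B * kern x r)"
      using kern_nonneg[of x r] mult_right_mono[of "\<bar>\<psi> (x - r)\<bar>" "\<bar>B\<bar>" "kern x r"]
      by (simp add: abs_mult mult.commute)
  qed
qed measurable

lemma relax_mono:
  assumes "\<psi> \<in> borel_measurable borel" "\<And>y. \<bar>\<psi> y\<bar> \<le> B"
    "\<psi>' \<in> borel_measurable borel" "\<And>y. \<bar>\<psi>' y\<bar> \<le> B'" "\<And>y. \<psi> y \<le> \<psi>' y"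
  shows "relax A L \<psi> x \<le> relax A L \<psi>' x"
  unfolding relax_kern
  by (intro integral_mono kern_mult_integrable[OF assms(1,2)] kern_mult_integrable[OF assms(3,4)]
      mult_left_mono assms kern_nonneg)

lemma relax_bound:
  assumes "\<psi> \<in> borel_measurable borel" "\<And>y. \<bar>\<psi> y\<bar> \<le> B"
  shows "\<bar>relax A L \<psi> x\<bar> \<le> B / L"
proof -
  have "\<bar>relax A L \<psi> x\<bar> \<le> (LBINT r. \<bar>kern x r * \<psi> (x - r)\<bar>)"
    unfolding relax_kern by (rule integral_abs_bound)
  also have "\<dots> \<le> (LBINT r. kern x r * B)"
    using kern_integral[of x] kern_mult_integrable[OF assms, of x] assms(2)
    by (intro integral_mono integrable_abs)
       (auto simp: has_bochner_integral_iff abs_mult kern_nonneg intro!: mult_left_mono)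
  also have "\<dots> = B / L"
    using kern_integral[of x] by (simp add: has_bochner_integral_iff)
  finally show ?thesis .
qed

lemma relax_tendsto:
  assumes "\<And>k. \<psi> k \<in> borel_measurable borel" "\<And>k y. \<bar>\<psi> k y\<bar> \<le> B"
    and lim: "\<And>y. (\<lambda>k. \<psi> k y) \<longlonglongrightarrow> \<psi>' y"
  shows "(\<lambda>k. relax A L (\<psi> k) x) \<longlonglongrightarrow> relax A L \<psi>' x"
  unfolding relax_kern
proof (rule integral_dominated_convergence[where w = "\<lambda>r. B * kern x r"])
  note [measurable] = assms(1)
  have [measurable]: "\<psi>' \<in> borel_measurable borel"
    by (rule borel_measurable_LIMSEQ_real[OF lim]) (rule assms(1))
  show "(\<lambda>r. kern x r * \<psi>' (x - r)) \<in> borel_measurable lborel" by measurable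
  show "(\<lambda>r. kern x r * \<psi> k (x - r)) \<in> borel_measurable lborel" for k by measurable
  show "integrable lborel (\<lambda>r. B * kern x r)"
    using kern_integral by (auto simp: has_bochner_integral_iff)
  show "AE r in lborel. (\<lambda>k. kern x r * \<psi> k (x - r)) \<longlonglongrightarrow> kern x r * \<psi>' (x - r)"
    by (intro AE_I2 tendsto_intros lim)
  show "AE r in lborel. norm (kern x r * \<psi> k (x - r)) \<le> B * kern x r" for k
    using assms(2) by (intro AE_I2) (auto simp: abs_mult kern_nonneg mult.commute[of B] intro!: mult_left_mono)
qed

text \<open>After the substitution \<open>y = x - r\<close> the factor
  \<open>exp (- L * E x)\<close> comes out, and what remains is the integral of the continuous
  function \<open>q\<close> over a half-line, to which the fundamental theorem applies.\<close>

lemma relax_deriv: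
  assumes cont: "continuous_on UNIV \<psi>" and bd: "\<And>y. \<bar>\<psi> y\<bar> \<le> B"
  shows "(relax A L \<psi> has_real_derivative (\<psi> x - L * relax A L \<psi> x) / A x) (at x)"
proof -
  have [measurable]: "\<psi> \<in> borel_measurable borel" using cont by (rule borel_measurable_continuous_onI)
  define q where "q y = exp (L * E y) / A y * \<psi> y" for y
  have q_cont: "continuous_on UNIV q"
    unfolding q_def using A_pos
    by (intro continuous_intros A_cont E_cont cont) (auto simp: less_imp_neq[symmetric])
  have [measurable]: "q \<in> borel_measurable borel" using q_cont by (rule borel_measurable_continuous_onI)
  obtain Q where Q: "\<And>y. (Q has_real_derivative q y) (at y)"
    using antiderivative_exists[OF q_cont] by blast
  define I where "I x = (LBINT y. q y * indicator {..x} y)" for x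
  have eq: "exp (L * E x) * (kern x r * \<psi> (x - r)) = q (x + (-1) * r) * indicator {..x} (x + (-1) * r)" for x r
    by (auto simp: kern_def q_def indicator_def exp_diff exp_minus field_simps)
  have int: "integrable lborel (\<lambda>y. q y * indicator {..x} y)" for x
  proof -
    have "integrable lborel (\<lambda>r. exp (L * E x) * (kern x r * \<psi> (x - r)))"
      by (intro integrable_mult_right kern_mult_integrable[where B = B] bd) measurable
    then show ?thesis
      unfolding eq
      by (rule lborel_integrable_real_affine_iff[where f = "\<lambda>y. q y * indicator {..x} y", THEN iffD1, rotated]) simp
  qed
  have I: "relax A L \<psi> x = exp (- L * E x) * I x" for x
  proof -
    have "I x = (LBINT r. exp (L * E x) * (kern x r * \<psi> (x - r)))"
      unfolding I_def eq
      by (subst lborel_integral_real_affine[where c = "-1" and t = x]) simp_all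
    also have "\<dots> = exp (L * E x) * relax A L \<psi> x" by (simp add: relax_kern)
    finally show ?thesis by (simp add: exp_minus)
  qed
  have inc: "I y - I x = Q y - Q x" if "x \<le> y" for x y
  proof -
    have "I y - I x = (LBINT z. q z * indicator {..y} z - q z * indicator {..x} z)"
      unfolding I_def by (intro Bochner_Integration.integral_diff[symmetric] int)
    also have "\<dots> = (LBINT z. q z * indicator {x..y} z)"
    proof (rule integral_cong_AE)
      show "AE z in lborel. q z * indicator {..y} z - q z * indicator {..x} z = q z * indicator {x..y} z"
        using AE_lborel_singleton[of x] by eventually_elim (use that in \<open>auto simp: indicator_def\<close>)
    qed measurable
    also have "\<dots> = Q y - Q x"
      using has_bochner_integral_FTC_Icc_real[OF that, of Q q] Q q_cont
      by (auto simp: continuous_on_eq_continuous_at has_bochner_integral_iff)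
    finally show ?thesis .
  qed
  have "I y = Q y + (I 0 - Q 0)" for y
    using inc[of 0 y] inc[of y 0] by (cases "0 \<le> y") auto
  then obtain c where c: "I = (\<lambda>y. Q y + c)" by blast
  have "(I has_real_derivative q x) (at x)" for x
    unfolding c by (auto intro!: derivative_eq_intros Q)
  then have "((\<lambda>x. exp (- L * E x) * I x) has_real_derivative (\<psi> x - L * (exp (- L * E x) * I x)) / A x) (at x)"
    using A_pos[of x]
    by (auto intro!: derivative_eq_intros E simp: q_def field_simps exp_minus)
  moreover have "relax A L \<psi> = (\<lambda>x. exp (- L * E x) * I x)" using I by blast
  ultimately show ?thesis by metis
qed

end


section \<open>Monotone iteration and slow descent\<close>

primrec relax_iter ::
  "(real \<Rightarrow> real) \<Rightarrow> real \<Rightarrow> (real \<Rightarrow> real \<Rightarrow> real) \<Rightarrow> real \<Rightarrow> (real \<Rightarrow> real) \<Rightarrow> nat \<Rightarrow> real \<Rightarrow> real" where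
  "relax_iter A L N \<mu> f 0 = f"
| "relax_iter A L N \<mu> f (Suc k) = relax A L (\<lambda>x. \<mu> + N x (relax_iter A L N \<mu> f k x))"

lemma relax_iter_shift:
  "relax_iter (\<lambda>x. A (x + y)) L (\<lambda>x. N (x + y)) \<mu> (\<lambda>x. f (x + y)) k x = relax_iter A L N \<mu> f k (x + y)"
proof (induction k arbitrary: x)
  case (Suc k)
  then show ?case
    using relax_shift[of A y L "\<lambda>x. \<mu> + N x (relax_iter A L N \<mu> f k x)" x] by simp
qed simp

text \<open>A quadratic spline from 0 to 1 whose derivative is the tent of height 2 on
  [0, 1].\<close>

definition smooth_step :: "real \<Rightarrow> real" where
  "smooth_step r = 2 * (max 0 r)\<^sup>2 - 4 * (max 0 (r - 1/2))\<^sup>2 + 2 * (max 0 (r - 1))\<^sup>2"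

definition smooth_step' :: "real \<Rightarrow> real" where
  "smooth_step' r = 4 * max 0 r - 8 * max 0 (r - 1/2) + 4 * max 0 (r - 1)"

lemma pos_part_square_deriv: "((\<lambda>r. (max 0 r)\<^sup>2) has_real_derivative 2 * max 0 r) (at (r::real))"
proof -
  consider "r > 0" | "r < 0" | "r = 0" by linarith
  then show ?thesis
  proof cases
    case 1
    have "((\<lambda>r. r\<^sup>2) has_real_derivative 2 * max 0 r) (at r)"
      using 1 by (auto intro!: derivative_eq_intros)
    then show ?thesis
      by (rule has_field_derivative_transform_within_open[of _ _ _ "{0<..}"]) (use 1 in auto)
  next
    case 2
    have "((\<lambda>r. 0) has_real_derivative 2 * max 0 r) (at r)"
      using 2 by (auto intro!: derivative_eq_intros)
    then show ?thesis
      by (rule has_field_derivative_transform_within_open[of _ _ _ "{..<0}"]) (use 2 in auto)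
  next
    case 3
    have "((\<lambda>h. (max 0 h)\<^sup>2 / h) \<longlongrightarrow> 0) (at (0::real))"
    proof (rule Lim_null_comparison[where g = "\<lambda>h. \<bar>h\<bar>"])
      show "\<forall>\<^sub>F h in at 0. norm ((max 0 h)\<^sup>2 / h) \<le> \<bar>h::real\<bar>"
        by (intro always_eventually) (auto simp: max_def power2_eq_square)
    qed (auto intro!: tendsto_eq_intros)
    then show ?thesis using 3 by (simp add: DERIV_def)
  qed
qed

lemma smooth_step_deriv: "(smooth_step has_real_derivative smooth_step' r) (at r)"
proof -
  have "((\<lambda>r. (max 0 (r - c))\<^sup>2) has_real_derivative 2 * max 0 (r - c)) (at r)" for c r :: real
  proof -
    have "((\<lambda>r. r - c) has_real_derivative 1) (at r)" by (auto intro!: derivative_eq_intros)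
    from DERIV_chain2[OF pos_part_square_deriv this] show ?thesis by simp
  qed
  note d = this[of 0, simplified] this
  show ?thesis unfolding smooth_step_def[abs_def] smooth_step'_def
    by (rule DERIV_cong[OF DERIV_add[OF DERIV_diff[OF DERIV_cmult[OF d(1)] DERIV_cmult[OF d(2)]]
              DERIV_cmult[OF d(2)]]]) simp
qed

lemma smooth_step_simps:
  "r \<le> 0 \<Longrightarrow> smooth_step r = 0" "r \<le> 0 \<Longrightarrow> smooth_step' r = 0" "r \<ge> 1 \<Longrightarrow> smooth_step r = 1"
  by (auto simp: smooth_step_def smooth_step'_def power2_eq_square algebra_simps max_def)

lemma smooth_step'_bounds: "0 \<le> smooth_step' r" "smooth_step' r \<le> 2"
  by (auto simp: smooth_step'_def max_def)

lemma smooth_step_bounds: "0 \<le> smooth_step r" "smooth_step r \<le> 1"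
proof -
  have mono: "smooth_step x \<le> smooth_step y" if "x \<le> y" for x y
    using that smooth_step_deriv smooth_step'_bounds(1) by (blast intro: DERIV_nonneg_imp_nondecreasing)
  show "0 \<le> smooth_step r" "smooth_step r \<le> 1"
    using mono[of "min 0 r" r] mono[of r "max 1 r"] smooth_step_simps(1)[of "min 0 r"] smooth_step_simps(3)[of "max 1 r"]
    by auto
qed

text \<open>One realisation is fixed here: \<open>f\<close> is \<open>f\<^sub>2\<close> at level
  \<open>lam\<close>, and \<open>N x p\<close> stands for \<open>L * p - H(x, p)\<close> with
  \<open>p\<close> truncated, which is why \<open>N\<close> is bounded and monotone on the whole
  line.\<close>

locale corrector_iteration = relaxation A L for A L +
  fixes N :: "real \<Rightarrow> real \<Rightarrow> real" and M \<mu> lam R :: real and f f' :: "real \<Rightarrow> real"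
  assumes N_cont: "continuous_on UNIV (\<lambda>(x, p). N x p)"
    and N_mono: "\<And>x p q. p \<le> q \<Longrightarrow> N x p \<le> N x q"
    and N_bound: "\<And>x p. \<bar>N x p\<bar> \<le> M"
    and f_deriv: "\<And>x. (f has_real_derivative f' x) (at x)"
    and f_eq: "\<And>x. A x * f' x + L * f x = lam + N x (f x)"
    and f_bound: "\<And>x. \<bar>f x\<bar> \<le> R"
    and mu_less: "\<mu> < lam"
begin

abbreviation "h \<equiv> relax_iter A L N \<mu> f"

definition "\<psi> k x = \<mu> + N x (h k x)"

lemma h_Suc: "h (Suc k) = relax A L (\<psi> k)"
  by (simp add: \<psi>_def[abs_def])

primrec h' :: "nat \<Rightarrow> real \<Rightarrow> real" where
  "h' 0 = f'"
| "h' (Suc k) = (\<lambda>x. (\<psi> k x - L * h (Suc k) x) / A x)"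

lemma \<psi>_bound: "\<bar>\<psi> k x\<bar> \<le> \<bar>\<mu>\<bar> + M"
  using N_bound[of x "h k x"] unfolding \<psi>_def by linarith

lemma N_comp_cont: "continuous_on UNIV g \<Longrightarrow> continuous_on UNIV (\<lambda>x. N x (g x))"
  using continuous_on_compose2[OF N_cont, of UNIV "\<lambda>x. (x, g x)"]
    continuous_on_Pair[OF continuous_on_id] by auto

lemma h_deriv: "(h k has_real_derivative h' k x) (at x)"
proof (induction k arbitrary: x)
  case (Suc k)
  then have "continuous_on UNIV (h k)"
    by (auto simp: continuous_on_eq_continuous_at intro: DERIV_isCont)
  then have "continuous_on UNIV (\<psi> k)"
    unfolding \<psi>_def[abs_def] by (intro continuous_intros N_comp_cont)
  from relax_deriv[OF this \<psi>_bound, of x] show ?case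
    by (simp only: h_Suc h'.simps)
qed (simp add: f_deriv)

lemma h_cont: "continuous_on UNIV (h k)"
  using h_deriv by (auto simp: continuous_on_eq_continuous_at intro: DERIV_isCont)

lemma \<psi>_cont: "continuous_on UNIV (\<psi> k)"
  unfolding \<psi>_def[abs_def] by (intro continuous_intros N_comp_cont h_cont)

lemma \<psi>_measurable [measurable]: "\<psi> k \<in> borel_measurable borel"
  using \<psi>_cont by (rule borel_measurable_continuous_onI)

lemma h_Suc_bound: "\<bar>h (Suc k) x\<bar> \<le> (\<bar>\<mu>\<bar> + M) / L"
  unfolding h_Suc by (rule relax_bound[OF \<psi>_measurable \<psi>_bound])

lemma h_bound: "\<bar>h k x\<bar> \<le> max R ((\<bar>\<mu>\<bar> + M) / L)"
  using h_Suc_bound[of "k - 1" x] f_bound[of x] by (cases k) (auto simp del: relax_iter.simps(2))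

text \<open>\<open>f\<close> and \<open>h (Suc 0)\<close> have the same source
  \<open>N x (f x)\<close>, so \<open>f - (lam - \<mu>) / L - h (Suc 0)\<close> solves the
  homogeneous equation. The uniform gap starts the decreasing induction and keeps the limit strictly
  below \<open>f\<close>.\<close>

lemma h_one_le: "h (Suc 0) x \<le> f x - (lam - \<mu>) / L"
proof -
  have "0 \<le> f x - (lam - \<mu>) / L - h (Suc 0) x"
  proof (rule nonneg_of_differential_inequality[where d = "\<lambda>x. f x - (lam - \<mu>) / L - h (Suc 0) x"])
    show "((\<lambda>x. f x - (lam - \<mu>) / L - h (Suc 0) x) has_real_derivative f' x - h' (Suc 0) x) (at x)" for x
      by (auto intro!: derivative_eq_intros f_deriv h_deriv simp del: relax_iter.simps h'.simps)
    fix x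
    have "A x * (f' x - h' (Suc 0) x) + L * (f x - (lam - \<mu>) / L - h (Suc 0) x)
        = A x * f' x + L * f x - (lam - \<mu>) - (A x * h' (Suc 0) x + L * h (Suc 0) x)"
    proof -
      have "L * ((lam - \<mu>) / L) = lam - \<mu>" using L_pos by simp
      then show ?thesis
        unfolding right_diff_distrib by linarith
    qed
    also have "A x * h' (Suc 0) x + L * h (Suc 0) x = \<psi> 0 x"
      using A_pos[of x] by (simp del: relax_iter.simps(2))
    finally show "0 \<le> A x * (f' x - h' (Suc 0) x) + L * (f x - (lam - \<mu>) / L - h (Suc 0) x)"
      by (simp add: f_eq \<psi>_def)
    have "\<bar>f x\<bar> \<le> R" "\<bar>h (Suc 0) x\<bar> \<le> (\<bar>\<mu>\<bar> + M) / L" by (rule f_bound h_Suc_bound)+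
    then show "\<bar>f x - (lam - \<mu>) / L - h (Suc 0) x\<bar> \<le> R + \<bar>(lam - \<mu>) / L\<bar> + (\<bar>\<mu>\<bar> + M) / L"
      by linarith
  qed
  then show ?thesis by simp
qed

lemma h_decreasing: "h (Suc k) x \<le> h k x"
proof (induction k arbitrary: x)
  case 0
  have "(lam - \<mu>) / L > 0" using mu_less L_pos by simp
  with h_one_le[of x] show ?case by (simp only: relax_iter.simps(1))
next
  case (Suc k)
  have "\<psi> (Suc k) y \<le> \<psi> k y" for y unfolding \<psi>_def using N_mono[OF Suc] by simp
  then show ?case
    unfolding h_Suc by (intro relax_mono[OF \<psi>_measurable \<psi>_bound \<psi>_measurable \<psi>_bound])
qed

lemma h'_Suc_eq: "A x * h' (Suc k) x + L * h (Suc k) x = \<mu> + N x (h k x)"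
  using A_pos[of x] by (simp add: \<psi>_def del: relax_iter.simps(2))

text \<open>The source of iterate \<open>Suc j\<close> is \<open>N x (h j x)\<close>, which
  dominates \<open>N x (h (Suc j) x)\<close> as the iterates decrease. Where the truncation is
  inactive this reads \<open>A h' + H(x, h) \<ge> \<mu>\<close>: a supersolution of the first-order
  equation is the slope of a subsolution of the second-order one.\<close>

lemma h_supersolution: "\<mu> + N x (h k x) \<le> A x * h' k x + L * h k x"
proof (cases k)
  case 0
  then show ?thesis using f_eq[of x] mu_less by simp
next
  case (Suc j)
  then show ?thesis using h'_Suc_eq[of x j] N_mono[OF h_decreasing[of j x], of x] by simp
qed

text \<open>Passing slowly from \<open>h k\<close> to \<open>h (Suc k)\<close> costs an error proportional to the speed only,
  because the equation for \<open>h (Suc k)\<close> has \<open>N x (h k x)\<close> as its source term.\<close>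

lemma slow_descent:
  assumes "\<epsilon> > 0"
  shows "\<exists>g g' x\<^sub>1. (\<forall>x. (g has_real_derivative g' x) (at x)) \<and>
      (\<forall>x. \<mu> - \<epsilon> + N x (g x) \<le> A x * g' x + L * g x) \<and> (\<forall>x. g x \<le> f x) \<and>
      (\<forall>x\<le>x\<^sub>1. g x = f x) \<and> (\<forall>x\<ge>x\<^sub>0. g x = h k x)"
proof (induction k arbitrary: x\<^sub>0)
  case 0
  have "\<mu> - \<epsilon> + N x (f x) \<le> A x * f' x + L * f x" for x
    using f_eq[of x] mu_less \<open>\<epsilon> > 0\<close> by simp
  then show ?case using f_deriv by (intro exI[of _ f] exI[of _ f']) auto
next
  case (Suc k)
  define B where "B = max R ((\<bar>\<mu>\<bar> + M) / L)"
  have "B \<ge> 0" using h_bound[of 0 0] unfolding B_def by linarith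
  \<comment> \<open>The transition error is \<open>A x * (c' x * d x)\<close>, with
    \<open>c' x \<le> 2 / l\<close> and \<open>d x \<le> 2 * B\<close>; the summand 1 keeps
    \<open>l\<close> positive when \<open>B = 0\<close>.\<close>
  define l where "l = 4 * B / \<epsilon> + 1"
  have l: "l > 0" "4 * B / l \<le> \<epsilon>"
    using \<open>B \<ge> 0\<close> \<open>\<epsilon> > 0\<close> by (auto simp: l_def field_simps intro: add_nonneg_pos)
  define z where "z = x\<^sub>0 - l"
  \<comment> \<open>The induction hypothesis completes all earlier transitions before
    \<open>z\<close>. Transitions never overlap, so \<epsilon> is lost once and not once per
    iterate.\<close>
  obtain g g' x\<^sub>1 where g: "\<And>x. (g has_real_derivative g' x) (at x)"
    "\<And>x. \<mu> - \<epsilon> + N x (g x) \<le> A x * g' x + L * g x" "\<And>x. g x \<le> f x"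
    "\<And>x. x \<le> x\<^sub>1 \<Longrightarrow> g x = f x" "\<And>x. x \<ge> z \<Longrightarrow> g x = h k x"
    using Suc[of z] by blast
  define c where "c x = smooth_step ((x - z) / l)" for x
  define c' where "c' x = smooth_step' ((x - z) / l) / l" for x
  have c: "(c has_real_derivative c' x) (at x)" for x
  proof -
    have "((\<lambda>x. (x - z) / l) has_real_derivative 1 / l) (at x)"
      using l by (auto intro!: derivative_eq_intros)
    from DERIV_chain2[OF smooth_step_deriv this] show ?thesis
      unfolding c_def[abs_def] c'_def by simp
  qed
  have c_z: "c x = 0" "c' x = 0" if "x \<le> z" for x
    using that l by (auto simp: c_def c'_def divide_nonpos_pos smooth_step_simps)
  have c_x0: "c x = 1" if "x \<ge> x\<^sub>0" for x
    using that l by (auto simp: c_def z_def smooth_step_simps)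
  have c_bd: "0 \<le> c x" "c x \<le> 1" "0 \<le> c' x" "c' x \<le> 2 / l" for x
    using l by (auto simp: c_def c'_def smooth_step_bounds smooth_step'_bounds divide_right_mono)
  define d where "d x = h k x - h (Suc k) x" for x
  define d' where "d' x = h' k x - h' (Suc k) x" for x
  have d_bd: "0 \<le> d x" "d x \<le> 2 * B" for x
  proof -
    have "\<bar>h k x\<bar> \<le> B" "\<bar>h (Suc k) x\<bar> \<le> B" "h (Suc k) x \<le> h k x"
      unfolding B_def by (rule h_bound h_decreasing)+
    then show "0 \<le> d x" "d x \<le> 2 * B" unfolding d_def by linarith+
  qed
  have d: "(d has_real_derivative d' x) (at x)" for x
    unfolding d_def[abs_def] d'_def by (intro DERIV_diff h_deriv)
  define G where "G x = g x - c x * d x" for x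
  define G' where "G' x = g' x - (c' x * d x + c x * d' x)" for x
  have G: "(G has_real_derivative G' x) (at x)" for x
    unfolding G_def[abs_def] G'_def
    by (auto intro!: derivative_eq_intros g c d)
  have "\<mu> - \<epsilon> + N x (G x) \<le> A x * G' x + L * G x" for x
  proof (cases "x \<le> z")
    case True
    then show ?thesis using g(2)[of x] by (simp add: G_def G'_def c_z)
  next
    case False
    have "(g has_real_derivative h' k x) (at x)"
      by (rule has_field_derivative_transform_within_open[OF h_deriv, of "{z<..}"]) (use False g(5) in auto)
    then have g': "g' x = h' k x" using g(1) by (rule DERIV_unique[rotated])
    have gx: "g x = h k x" using False g(5) by simp
    have "A x * (c' x * d x) \<le> 1 * (2 / l * (2 * B))"
      using A_pos[of x] A_le[of x] c_bd[of x] d_bd[of x] l(1) by (intro mult_mono) auto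
    then have err: "A x * (c' x * d x) \<le> \<epsilon>" using l(2) by simp
    \<comment> \<open>Up to the error this is a convex combination of the left-hand sides for
      \<open>h k\<close> and \<open>h (Suc k)\<close>. Both are at least
      \<open>\<mu> + N x (h k x)\<close>, which dominates \<open>\<mu> + N x (G x)\<close>.\<close>
    have "A x * G' x + L * G x = (1 - c x) * (A x * h' k x + L * h k x)
        + c x * (A x * h' (Suc k) x + L * h (Suc k) x) - A x * (c' x * d x)"
      by (simp only: G_def G'_def g' gx d_def d'_def) (simp add: algebra_simps del: relax_iter.simps h'.simps)
    moreover have "(1 - c x) * (A x * h' k x + L * h k x) \<ge> (1 - c x) * (\<mu> + N x (h k x))"
      using c_bd[of x] h_supersolution[of x k] by (intro mult_left_mono) auto
    moreover have "N x (G x) \<le> N x (h k x)"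
      using c_bd[of x] d_bd[of x] by (intro N_mono) (simp add: G_def gx)
    ultimately show ?thesis
      using err unfolding h'_Suc_eq by (simp add: algebra_simps del: relax_iter.simps h'.simps)
  qed
  moreover have "G x \<le> f x" for x
    using g(3)[of x] mult_nonneg_nonneg[OF c_bd(1)[of x] d_bd(1)[of x]] unfolding G_def by linarith
  moreover have "G x = f x" if "x \<le> min x\<^sub>1 z" for x
    using that g(4)[of x] c_z[of x] by (simp add: G_def)
  moreover have "G x = h (Suc k) x" if "x \<ge> x\<^sub>0" for x
    using that g(5)[of x] c_x0[of x] l by (simp add: G_def d_def z_def del: relax_iter.simps)
  ultimately show ?case using G by blast
qed

section \<open>The limit of the iterates\<close>

definition "F x = lim (\<lambda>k. h k x)"

lemma h_tendsto: "(\<lambda>k. h k x) \<longlonglongrightarrow> F x"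
proof -
  have "decseq (\<lambda>k. h k x)" by (intro decseq_SucI h_decreasing)
  moreover have "- max R ((\<bar>\<mu>\<bar> + M) / L) \<le> h k x" for k using h_bound[of k x] by linarith
  ultimately have "convergent (\<lambda>k. h k x)" unfolding convergent_def by (blast elim: decseq_convergent)
  then show ?thesis unfolding F_def by (simp add: convergent_LIMSEQ_iff)
qed

lemma F_le: "F x \<le> h k x"
proof (rule decseq_ge[OF _ h_tendsto])
  show "decseq (\<lambda>k. h k x)" by (intro decseq_SucI h_decreasing)
qed

lemma F_less: "F x < f x"
proof -
  have "(lam - \<mu>) / L > 0" using mu_less L_pos by simp
  with h_one_le[of x] F_le[of x "Suc 0"] show ?thesis by linarith
qed

lemma F_less_imp_iterate: "F x < c \<Longrightarrow> \<exists>k. h k x < c"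
  using order_tendstoD(2)[OF h_tendsto] eventually_happens'[OF sequentially_bot] by blast

text \<open>\<open>A\<close> may come arbitrarily close to 0, so the iterates need not share a
  Lipschitz constant in \<open>x\<close>. In the variable \<open>E\<close> they do: both terms of
  \<open>A h'\<close> are bounded by \<open>\<bar>\<mu>\<bar> + M\<close>, hence
  \<open>\<bar>h'\<bar> \<le> C * E'\<close>, and the estimate passes to the limit.\<close>

lemma F_isCont: "isCont F x"
proof -
  define C where "C = 2 * (\<bar>\<mu>\<bar> + M)"
  have C: "\<bar>h (Suc k) x - h (Suc k) y\<bar> \<le> C * \<bar>E x - E y\<bar>" if "x \<le> y" for k x y
  proof -
    have bd: "\<bar>h' (Suc k) z\<bar> \<le> C / A z" for z
    proof -
      have "\<bar>L * h (Suc k) z\<bar> \<le> \<bar>\<mu>\<bar> + M"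
        using h_Suc_bound[of k z] L_pos by (simp add: abs_mult field_simps del: relax_iter.simps)
      with \<psi>_bound[of k z] abs_triangle_ineq4[of "\<psi> k z" "L * h (Suc k) z"]
      have "\<bar>\<psi> k z - L * h (Suc k) z\<bar> \<le> C"
        unfolding C_def by (simp only: mult_2)
      then show ?thesis using A_pos[of z] by (simp add: divide_right_mono del: relax_iter.simps)
    qed
    have "C * E x - s * h (Suc k) x \<le> C * E y - s * h (Suc k) y" if "s \<in> {-1, 1}" for s
      using \<open>x \<le> y\<close>
    proof (rule DERIV_nonneg_imp_nondecreasing)
      fix z
      have "((\<lambda>z. C * E z - s * h (Suc k) z) has_real_derivative C * (1 / A z) - s * h' (Suc k) z) (at z)"
        by (intro DERIV_diff DERIV_cmult E h_deriv)
      moreover have "0 \<le> C * (1 / A z) - s * h' (Suc k) z"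
        using bd[of z] that by (auto simp del: h'.simps)
      ultimately show "\<exists>c. ((\<lambda>z. C * E z - s * h (Suc k) z) has_real_derivative c) (at z) \<and> 0 \<le> c"
        by blast
    qed
    from this[of 1] this[of "-1"] have "\<bar>h (Suc k) x - h (Suc k) y\<bar> \<le> C * (E y - E x)"
      by (simp add: algebra_simps abs_le_iff del: relax_iter.simps)
    moreover have "E y - E x \<ge> 0" using E_growth[OF \<open>x \<le> y\<close>] that by linarith
    ultimately show ?thesis by simp
  qed
  have C': "\<bar>F y - F x\<bar> \<le> C * \<bar>E y - E x\<bar>" for y
  proof (rule LIMSEQ_le_const2)
    show "(\<lambda>k. \<bar>h (Suc k) y - h (Suc k) x\<bar>) \<longlonglongrightarrow> \<bar>F y - F x\<bar>"
      by (intro tendsto_intros LIMSEQ_Suc h_tendsto)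
    show "\<exists>n. \<forall>k\<ge>n. \<bar>h (Suc k) y - h (Suc k) x\<bar> \<le> C * \<bar>E y - E x\<bar>"
      using C[of x y] C[of y x] by (cases "x \<le> y") (auto simp: abs_minus_commute simp del: relax_iter.simps)
  qed
  have "((\<lambda>y. C * \<bar>E y - E x\<bar>) \<longlongrightarrow> C * \<bar>E x - E x\<bar>) (at x)"
    using E_isCont[of x] by (intro tendsto_intros) (simp add: isCont_def)
  then have "((\<lambda>y. C * \<bar>E y - E x\<bar>) \<longlongrightarrow> 0) (at x)" by simp
  then have "((\<lambda>y. F y - F x) \<longlongrightarrow> 0) (at x)"
    by (rule Lim_null_comparison[rotated]) (simp add: C')
  then show ?thesis unfolding isCont_def by (simp add: LIM_zero_iff)
qed

text \<open>The limit is taken in the integral form, where dominated convergence suffices;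
  differentiability of \<open>F\<close> is then recovered from its continuity through
  \<open>relax_deriv\<close>, with no convergence of derivatives.\<close>

lemma F_fixed_point: "F = relax A L (\<lambda>x. \<mu> + N x (F x))"
proof
  fix x
  have "(\<lambda>k. \<psi> k y) \<longlonglongrightarrow> \<mu> + N y (F y)" for y
  proof -
    have "isCont (\<lambda>p. N y p) (F y)"
      using continuous_on_compose2[OF N_cont, of UNIV "\<lambda>p. (y, p)"]
      by (auto simp: continuous_on_eq_continuous_at intro!: continuous_intros)
    from isCont_tendsto_compose[OF this h_tendsto] show ?thesis
      unfolding \<psi>_def by (intro tendsto_intros)
  qed
  then have "(\<lambda>k. relax A L (\<psi> k) x) \<longlonglongrightarrow> relax A L (\<lambda>x. \<mu> + N x (F x)) x"
    by (rule relax_tendsto[OF \<psi>_measurable \<psi>_bound])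
  moreover have "(\<lambda>k. relax A L (\<psi> k) x) \<longlonglongrightarrow> F x"
    using LIMSEQ_Suc[OF h_tendsto[of x]] unfolding h_Suc .
  ultimately show "F x = relax A L (\<lambda>x. \<mu> + N x (F x)) x" by (rule LIMSEQ_unique[rotated])
qed

lemma F_deriv: "(F has_real_derivative (\<mu> + N x (F x) - L * F x) / A x) (at x)"
proof -
  have "continuous_on UNIV (\<lambda>x. \<mu> + N x (F x))"
    by (intro continuous_intros N_comp_cont) (simp add: continuous_on_eq_continuous_at F_isCont)
  moreover have "\<bar>\<mu> + N x (F x)\<bar> \<le> \<bar>\<mu>\<bar> + M" for x using N_bound[of x "F x"] by linarith
  ultimately show ?thesis
    using relax_deriv[of "\<lambda>x. \<mu> + N x (F x)" "\<bar>\<mu>\<bar> + M" x] F_fixed_point by simp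
qed

end


section \<open>Connecting subsolutions\<close>

lemma eventually_above_line:
  fixes p :: "real \<Rightarrow> real"
  assumes "(p has_real_derivative p') (at x)" "m < p'"
  shows "\<forall>\<^sub>F y in nhds x. 0 \<le> (p y - p x - m * (y - x)) * (y - x)"
proof -
  define k where "k y = p y - p x - m * (y - x)" for y
  have k: "(k has_real_derivative p' - m) (at x)"
    unfolding k_def[abs_def] by (auto intro!: derivative_eq_intros assms)
  have "p' - m > 0" using assms by simp
  obtain d where d: "d > 0" "\<And>h. 0 < h \<Longrightarrow> h < d \<Longrightarrow> k x < k (x + h)"
    using DERIV_pos_inc_right[OF k \<open>p' - m > 0\<close>] by blast
  obtain e where e: "e > 0" "\<And>h. 0 < h \<Longrightarrow> h < e \<Longrightarrow> k (x - h) < k x"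
    using DERIV_pos_inc_left[OF k \<open>p' - m > 0\<close>] by blast
  have kx: "k x = 0" by (simp add: k_def)
  have "0 \<le> k y * (y - x)" if "dist y x < min d e" for y
  proof -
    consider "y = x" | "y > x" | "y < x" by linarith
    then show ?thesis
    proof cases
      case 2
      then have "k y > 0" using d(2)[of "y - x"] that kx by (simp add: dist_real_def)
      then show ?thesis using 2 by simp
    next
      case 3
      then have "k y < 0" using e(2)[of "x - y"] that kx by (simp add: dist_real_def)
      then show ?thesis using 3 by (simp add: mult_nonpos_nonpos)
    qed simp
  qed
  then show ?thesis
    unfolding k_def eventually_nhds_metric using d(1) e(1) by (intro exI[of _ "min d e"]) auto
qed

text \<open>A slope at a kink must stay below both one-sided derivatives. The smaller of
  \<open>p'\<close> and \<open>q'\<close> still satisfies the inequality, and lowering it by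
  \<epsilon> makes room on both sides at a cost of at most \<epsilon>, since
  \<open>A x \<le> 1\<close>.\<close>

lemma slope_at_kink:
  fixes A :: "real \<Rightarrow> real"
  assumes p: "(p has_real_derivative p') (at x)" "p x = g x" "\<mu> \<le> A x * p' + G x (g x)"
    and q: "(q has_real_derivative q') (at x)" "q x = g x" "\<mu> \<le> A x * q' + G x (g x)"
    and ev: "\<forall>\<^sub>F y in nhds x. g y = p y \<or> g y = q y"
    and A: "0 \<le> A x" "A x \<le> 1" and "\<epsilon> > 0"
  shows "\<exists>m. \<mu> - \<epsilon> \<le> A x * m + G x (g x) \<and>
      (\<forall>\<^sub>F y in nhds x. 0 \<le> (g y - g x - m * (y - x)) * (y - x))"
proof (intro exI conjI)
  let ?m = "min p' q' - \<epsilon>"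
  have "A x * \<epsilon> \<le> \<epsilon>" using A \<open>\<epsilon> > 0\<close> by (simp add: mult_left_le_one_le)
  then show "\<mu> - \<epsilon> \<le> A x * ?m + G x (g x)"
    using p(3) q(3) by (simp add: min_def right_diff_distrib)
  have "\<forall>\<^sub>F y in nhds x. 0 \<le> (p y - p x - ?m * (y - x)) * (y - x)"
    "\<forall>\<^sub>F y in nhds x. 0 \<le> (q y - q x - ?m * (y - x)) * (y - x)"
    using \<open>\<epsilon> > 0\<close> by (intro eventually_above_line[OF p(1)] eventually_above_line[OF q(1)]; simp)+
  with ev show "\<forall>\<^sub>F y in nhds x. 0 \<le> (g y - g x - ?m * (y - x)) * (y - x)"
    by eventually_elim (auto simp: p(2) q(2))
qed

context corrector_iteration
begin

text \<open>The connection is the maximum of \<open>f\<^sub>1\<close> and the slow descent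
  \<open>g\<close>, cut to \<open>f\<^sub>1\<close> beyond \<open>x\<^sub>0\<close>; the two
  formulas agree near \<open>x\<^sub>0\<close> because \<open>g\<close> is below
  \<open>f\<^sub>1\<close> there. Where \<open>g\<close> is selected it lies between
  \<open>f\<^sub>1\<close> and \<open>f\<close>, hence within \<open>R\<close>, and the truncated
  equation is the original one.\<close>

lemma connecting_subsolution:
  assumes f1_deriv: "\<And>x. (f\<^sub>1 has_real_derivative f\<^sub>1' x) (at x)"
    and f1_eq: "\<And>x. A x * f\<^sub>1' x + G x (f\<^sub>1 x) = lam"
    and f1_bound: "\<And>x. \<bar>f\<^sub>1 x\<bar> \<le> R"
    and less: "\<And>x. f\<^sub>1 x < f x"
    and GN: "\<And>x p. \<bar>p\<bar> \<le> R \<Longrightarrow> G x p = L * p - N x p"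
    and below: "F x\<^sub>0 < f\<^sub>1 x\<^sub>0" and "\<epsilon> > 0"
  shows "\<exists>g x\<^sub>1 x\<^sub>2. slope_subsolution A G (\<mu> - \<epsilon>) g \<and> (\<forall>x. \<bar>g x\<bar> \<le> R) \<and> continuous_on UNIV g \<and>
      (\<forall>x\<le>x\<^sub>1. g x = f x) \<and> (\<forall>x\<ge>x\<^sub>2. g x = f\<^sub>1 x)"
proof -
  \<comment> \<open>One half is lost in the slow descent, the other at the kinks.\<close>
  define \<delta> where "\<delta> = \<epsilon> / 2"
  have "\<delta> > 0" using \<open>\<epsilon> > 0\<close> by (simp add: \<delta>_def)
  obtain k where k: "h k x\<^sub>0 < f\<^sub>1 x\<^sub>0" using F_less_imp_iterate[OF below] by blast
  obtain g g' x\<^sub>1 where g: "\<And>x. (g has_real_derivative g' x) (at x)"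
    "\<And>x. \<mu> - \<delta> + N x (g x) \<le> A x * g' x + L * g x" "\<And>x. g x \<le> f x"
    "\<And>x. x \<le> x\<^sub>1 \<Longrightarrow> g x = f x" "g x\<^sub>0 < f\<^sub>1 x\<^sub>0"
    using slow_descent[OF \<open>\<delta> > 0\<close>, of x\<^sub>0 k] k by (metis order_refl)
  define p where "p x = (if x \<le> x\<^sub>0 then max (f\<^sub>1 x) (g x) else f\<^sub>1 x)" for x
  have p_eq: "p x = f\<^sub>1 x \<or> (g x \<ge> f\<^sub>1 x \<and> p x = g x)" for x
    by (auto simp: p_def)
  have p_bd: "\<bar>p x\<bar> \<le> R" for x
    using p_eq[of x] f1_bound[of x] f_bound[of x] g(3)[of x] by auto
  have cont1: "isCont f\<^sub>1 x" and contg: "isCont g x" for x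
    using f1_deriv g(1) by (blast intro: DERIV_isCont)+
  have ev_less: "\<forall>\<^sub>F y in nhds x. g y < f\<^sub>1 y" if "g x < f\<^sub>1 x" for x
  proof -
    have "((\<lambda>y. f\<^sub>1 y - g y) \<longlongrightarrow> f\<^sub>1 x - g x) (nhds x)"
      by (intro tendsto_diff) (use cont1 contg in \<open>auto simp: isCont_def tendsto_at_iff_tendsto_nhds\<close>)
    from order_tendstoD(1)[OF this, of 0] that show ?thesis by simp
  qed
  have ev_greater: "\<forall>\<^sub>F y in nhds x. f\<^sub>1 y < g y" if "f\<^sub>1 x < g x" for x
  proof -
    have "((\<lambda>y. g y - f\<^sub>1 y) \<longlongrightarrow> g x - f\<^sub>1 x) (nhds x)"
      by (intro tendsto_diff) (use cont1 contg in \<open>auto simp: isCont_def tendsto_at_iff_tendsto_nhds\<close>)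
    from order_tendstoD(1)[OF this, of 0] that show ?thesis by simp
  qed
  have ev1: "\<forall>\<^sub>F y in nhds x. p y = f\<^sub>1 y" if "x \<ge> x\<^sub>0 \<or> g x < f\<^sub>1 x" for x
  proof (cases "g x < f\<^sub>1 x")
    case True
    from ev_less[OF this] show ?thesis by eventually_elim (auto simp: p_def)
  next
    case False
    then have "x > x\<^sub>0" using that g(5) by (cases "x = x\<^sub>0") auto
    then have "\<forall>\<^sub>F y in nhds x. y > x\<^sub>0" by (rule order_tendstoD(1)[OF filterlim_ident])
    then show ?thesis by eventually_elim (auto simp: p_def)
  qed
  have ev2: "\<forall>\<^sub>F y in nhds x. y \<le> x\<^sub>0" if "x < x\<^sub>0" for x
    using order_tendstoD(2)[OF filterlim_ident that] by eventually_elim simp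
  have f1_sub: "\<mu> - \<delta> \<le> A x * f\<^sub>1' x + G x (f\<^sub>1 x)" for x
    using f1_eq[of x] mu_less \<open>\<delta> > 0\<close> by simp
  have g_sub: "\<mu> - \<delta> \<le> A x * g' x + G x (g x)" if "g x = p x" for x
    using g(2)[of x] GN[of "g x" x] p_bd[of x] that by simp
  have "\<exists>m. \<mu> - \<delta> - \<delta> \<le> A x * m + G x (p x) \<and>
      (\<forall>\<^sub>F y in nhds x. 0 \<le> (p y - p x - m * (y - x)) * (y - x))" for x
  proof -
    note A = less_imp_le[OF A_pos[of x]] A_le[of x]
    consider "x \<ge> x\<^sub>0 \<or> g x < f\<^sub>1 x" | "x < x\<^sub>0" "g x = f\<^sub>1 x" | "x < x\<^sub>0" "g x > f\<^sub>1 x" by linarith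
    then show ?thesis
    proof cases
      case 1
      have "p x = f\<^sub>1 x" using eventually_nhds_x_imp_x[OF ev1[OF 1]] .
      then show ?thesis
        using f1_sub[of x] ev1[OF 1]
        by (intro slope_at_kink[OF f1_deriv[of x] _ _ f1_deriv[of x] _ _ _ _ _ \<open>\<delta> > 0\<close>] A) auto
    next
      case 2
      then have px: "p x = f\<^sub>1 x" by (simp add: p_def)
      show ?thesis
        using f1_sub[of x] g_sub[of x] px 2 p_eq
        by (intro slope_at_kink[OF f1_deriv[of x] _ _ g(1)[of x] _ _ _ _ _ \<open>\<delta> > 0\<close>] A)
           (auto intro: always_eventually)
    next
      case 3
      then have px: "p x = g x" by (simp add: p_def)
      have "\<forall>\<^sub>F y in nhds x. p y = g y"
        using ev2[OF 3(1)] ev_greater[OF 3(2)] by eventually_elim (auto simp: p_def)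
      then show ?thesis
        using g_sub[of x] px
        by (intro slope_at_kink[OF g(1)[of x] _ _ g(1)[of x] _ _ _ _ _ \<open>\<delta> > 0\<close>] A) auto
    qed
  qed
  then have "slope_subsolution A G (\<mu> - \<epsilon>) p"
    unfolding slope_subsolution_def by (simp add: \<delta>_def)
  moreover have "continuous_on UNIV p"
  proof (clarsimp simp: continuous_on_eq_continuous_at)
    fix x
    show "isCont p x"
    proof (cases "x \<ge> x\<^sub>0")
      case True
      then show ?thesis using isCont_cong[OF ev1[of x]] cont1 by blast
    next
      case False
      then have "\<forall>\<^sub>F y in nhds x. p y = max (f\<^sub>1 y) (g y)"
        using ev2[of x] by (auto elim!: eventually_mono simp: p_def)
      from isCont_cong[OF this] show ?thesis using cont1 contg by (simp add: continuous_max)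
    qed
  qed
  moreover have "p x = f x" if "x \<le> min x\<^sub>1 x\<^sub>0" for x
    using that g(4)[of x] less[of x] by (simp add: p_def)
  moreover have "p x = f\<^sub>1 x" if "x \<ge> x\<^sub>0" for x
    using eventually_nhds_x_imp_x[OF ev1[of x]] that by simp
  ultimately show ?thesis using p_bd by blast
qed

end

lemma same_derivative_imp_constant_difference:
  fixes v V :: "real \<Rightarrow> real"
  assumes "\<And>x. (v has_real_derivative g x) (at x)" "\<And>x. (V has_real_derivative f x) (at x)"
    and S: "\<And>x. x \<in> S \<Longrightarrow> g x = f x" "convex S"
  shows "\<exists>c. \<forall>x\<in>S. v x = V x + c"
proof (cases "S = {}")
  case False
  then obtain s where s: "s \<in> S" by blast
  have "\<exists>c. \<forall>x\<in>S. v x - V x = c"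
  proof (rule has_field_derivative_zero_constant[OF S(2)])
    fix x assume "x \<in> S"
    have "((\<lambda>x. v x - V x) has_real_derivative g x - f x) (at x within S)"
      by (intro DERIV_diff DERIV_subset[OF assms(1)] DERIV_subset[OF assms(2)]) auto
    then show "((\<lambda>x. v x - V x) has_real_derivative 0) (at x within S)"
      using S(1)[OF \<open>x \<in> S\<close>] by simp
  qed
  then show ?thesis by (auto simp: algebra_simps)
qed auto

text \<open>An antiderivative \<open>v\<close> of \<open>g\<close> differs by constants from
  \<open>V\<^sub>1\<close> far to the right and from \<open>V\<^sub>2\<close> far to the left, and
  the part between is compact; so \<open>v x \<le> \<theta> * x + C\<close>, the initial ordering
  required for comparison.\<close>

lemma lower_bound_of_slope_subsolution:
  fixes u :: "real \<Rightarrow> real \<Rightarrow> real" and A g f\<^sub>1 f\<^sub>2 :: "real \<Rightarrow> real"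
  assumes uc: "uniformly_continuous_on ({0..} \<times> UNIV) (\<lambda>(t, x). u t x)"
    and super: "viscosity_supersolution A G u"
    and init: "\<And>x. u 0 x = \<theta> * x"
    and A: "\<And>x. 0 \<le> A x" "\<And>x. A x \<le> 1"
    and G: "\<And>x p q. \<bar>p\<bar> \<le> R + 1 \<Longrightarrow> \<bar>q\<bar> \<le> R + 1 \<Longrightarrow> \<bar>G x p - G x q\<bar> \<le> K * \<bar>p - q\<bar>"
    and g: "slope_subsolution A G \<mu> g" "\<And>x. \<bar>g x\<bar> \<le> R" "continuous_on UNIV g"
      "\<And>x. x \<le> x\<^sub>1 \<Longrightarrow> g x = f\<^sub>2 x" "\<And>x. x \<ge> x\<^sub>2 \<Longrightarrow> g x = f\<^sub>1 x"
    and V1: "\<And>x. (V\<^sub>1 has_real_derivative f\<^sub>1 x) (at x)" "\<And>x. x \<ge> 0 \<Longrightarrow> V\<^sub>1 x \<le> \<theta> * x + C\<^sub>1"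
    and V2: "\<And>x. (V\<^sub>2 has_real_derivative f\<^sub>2 x) (at x)" "\<And>x. x \<le> 0 \<Longrightarrow> V\<^sub>2 x \<le> \<theta> * x + C\<^sub>2"
    and "\<mu>' < \<mu>"
  shows "ereal \<mu>' \<le> Liminf at_top (\<lambda>t. ereal (u t 0 / t))"
proof -
  obtain v where v: "\<And>x. (v has_real_derivative g x) (at x)"
    using antiderivative_exists[OF g(3)] by blast
  obtain c\<^sub>1 where c1: "\<And>x. x \<ge> x\<^sub>2 \<Longrightarrow> v x = V\<^sub>1 x + c\<^sub>1"
    using same_derivative_imp_constant_difference[OF v V1(1), of "{x\<^sub>2..}"] g(5) by auto
  obtain c\<^sub>2 where c2: "\<And>x. x \<le> x\<^sub>1 \<Longrightarrow> v x = V\<^sub>2 x + c\<^sub>2"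
    using same_derivative_imp_constant_difference[OF v V2(1), of "{..x\<^sub>1}"] g(4) by auto
  define y\<^sub>1 where "y\<^sub>1 = min x\<^sub>1 0"
  define y\<^sub>2 where "y\<^sub>2 = max x\<^sub>2 0"
  have "continuous_on {y\<^sub>1..y\<^sub>2} (\<lambda>x. v x - \<theta> * x)"
    by (intro continuous_intros continuous_at_imp_continuous_on ballI DERIV_isCont[OF v])
  from compact_continuous_image[OF this compact_Icc]
  have "bounded ((\<lambda>x. v x - \<theta> * x) ` {y\<^sub>1..y\<^sub>2})" by (rule compact_imp_bounded)
  then obtain c\<^sub>3 where c3: "\<And>x. x \<in> {y\<^sub>1..y\<^sub>2} \<Longrightarrow> \<bar>v x - \<theta> * x\<bar> \<le> c\<^sub>3"
    unfolding bounded_iff by (metis imageI real_norm_def)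
  define C where "C = max (C\<^sub>1 + c\<^sub>1) (max (C\<^sub>2 + c\<^sub>2) c\<^sub>3)"
  have below: "v x \<le> \<theta> * x + C" for x
  proof -
    consider "x \<ge> y\<^sub>2" | "x \<le> y\<^sub>1" | "x \<in> {y\<^sub>1..y\<^sub>2}" by fastforce
    then show ?thesis
    proof cases
      case 1
      then have "v x = V\<^sub>1 x + c\<^sub>1" "V\<^sub>1 x \<le> \<theta> * x + C\<^sub>1" by (auto simp: y\<^sub>2_def intro: c1 V1(2))
      then show ?thesis unfolding C_def by linarith
    next
      case 2
      then have "v x = V\<^sub>2 x + c\<^sub>2" "V\<^sub>2 x \<le> \<theta> * x + C\<^sub>2" by (auto simp: y\<^sub>1_def intro: c2 V2(2))
      then show ?thesis unfolding C_def by linarith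
    next
      case 3
      from c3[OF this] show ?thesis unfolding C_def by linarith
    qed
  qed
  \<comment> \<open>An intermediate speed: the surplus \<open>(\<nu> - \<mu>') * t\<close> absorbs
    the constant \<open>C - v 0\<close> for large \<open>t\<close>.\<close>
  obtain \<nu> where \<nu>: "\<mu>' < \<nu>" "\<nu> < \<mu>" using dense[OF \<open>\<mu>' < \<mu>\<close>] by blast
  have low: "v 0 - C + \<nu> * t \<le> u t 0" if "t \<ge> 0" for t
    by (rule supersolution_above_travelling_subsolution[OF uc super init A G v g(2,1) below \<nu>(2) that])
  define T where "T = max 1 (\<bar>C - v 0\<bar> / (\<nu> - \<mu>'))"
  show ?thesis
  proof (rule Liminf_bounded)
    show "\<forall>\<^sub>F t in at_top. ereal \<mu>' \<le> ereal (u t 0 / t)"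
    proof (rule eventually_at_top_linorderI[of T])
      fix t assume "T \<le> t"
      then have t: "t \<ge> 1" "\<bar>C - v 0\<bar> / (\<nu> - \<mu>') \<le> t" by (auto simp: T_def)
      then have "\<bar>C - v 0\<bar> \<le> t * (\<nu> - \<mu>')" using \<nu> by (simp add: field_simps)
      then have "\<mu>' * t \<le> u t 0" using low[of t] t by (simp add: algebra_simps)
      then show "ereal \<mu>' \<le> ereal (u t 0 / t)" using t by (simp add: field_simps)
    qed
  qed
qed


section \<open>A one-sided ergodic theorem\<close>

context ergodic_flow
begin

lemma space_P [simp]: "space P = UNIV"
  using completed_borel by (auto simp: sets_eq_imp_space_eq[of _ borel])

lemma UNIV_sets_P [simp]: "UNIV \<in> sets P"
  using sets.top[of P] by simp

lemma prob_space_P: "prob_space P"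
proof -
  obtain P0 where "prob_space P0" "P = completion P0" using completed_borel by blast
  then show ?thesis by (auto intro!: prob_spaceI dest!: prob_space.emeasure_space_1)
qed

sublocale P: prob_space P by (rule prob_space_P)

lemma flow_inverse [simp]: "\<tau> (- x) (\<tau> x \<omega>) = \<omega>" "\<tau> x (\<tau> (- x) \<omega>) = \<omega>"
  using flow_add[of "- x" x] flow_add[of x "- x"] flow_zero by (simp_all add: fun_eq_iff)

lemma flow_vimage: "\<tau> x -` S = \<tau> (- x) ` S"
  by (auto simp: image_iff intro!: bexI[of _ "\<tau> x _"])

lemma flow_to_borel: "\<tau> x \<in> P \<rightarrow>\<^sub>M borel"
  using measurable_compose[OF measurable_Pair1'[of x borel P] flow_measurable] by simp

text \<open>The flow is given as measurable into the Borel sets only. A completed set is a Borel set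
  together with a subset of a Borel null set, and the preimage of the latter is null by
  invariance.\<close>

lemma flow_measurable_self [measurable]: "\<tau> x \<in> P \<rightarrow>\<^sub>M P"
proof (rule measurableI)
  fix S assume "S \<in> sets P"
  obtain P0 where P0: "sets P0 = sets borel" "P = completion P0" using completed_borel by blast
  obtain B N N' where BN: "S = B \<union> N" "B \<in> sets P0" "N \<subseteq> N'" "N' \<in> null_sets P0"
    using \<open>S \<in> sets P\<close> unfolding P0(2) sets_completion by blast
  have "\<tau> x -` N' \<in> sets P"
    using measurable_sets[OF flow_to_borel, of N' x] BN(4) P0(1) by auto
  moreover have "emeasure P (\<tau> x -` N') = 0"
    using flow_preserving[of N' "- x"] null_sets_completionI[OF BN(4)] unfolding P0(2)[symmetric] flow_vimage
    by (simp add: null_sets_def)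
  ultimately have "\<tau> x -` N' \<in> null_sets P" by auto
  then have "\<tau> x -` N \<in> sets P"
    using null_sets_completion_subset[of "\<tau> x -` N" "\<tau> x -` N'" P0] BN(3) P0(2) by auto
  moreover have "\<tau> x -` B \<in> sets P"
    using measurable_sets[OF flow_to_borel, of B x] BN(2) P0(1) by simp
  ultimately show "\<tau> x -` S \<inter> space P \<in> sets P" by (simp add: BN(1))
qed simp

lemma distr_flow: "distr P P (\<tau> x) = P"
  by (rule measure_eqI) (auto simp: emeasure_distr flow_vimage flow_preserving)

lemma expectation_flow:
  fixes g :: "'w \<Rightarrow> real"
  assumes [measurable]: "g \<in> borel_measurable P"
  shows "(\<integral>\<omega>. g (\<tau> x \<omega>) \<partial>P) = (\<integral>\<omega>. g \<omega> \<partial>P)"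
proof -
  show ?thesis using integral_distr[of "\<tau> x" P P g] by (simp add: distr_flow)
qed

lemma AE_flow:
  assumes "AE \<omega> in P. Q \<omega>"
  shows "AE \<omega> in P. Q (\<tau> x \<omega>)"
  using AE_distrD[OF flow_measurable_self[of x], of Q] assms unfolding distr_flow by blast

lemma reversed_flow: "ergodic_flow P (\<lambda>x. \<tau> (- x))"
proof
  show "\<exists>P0. prob_space P0 \<and> sets P0 = sets borel \<and> P = completion P0" by (rule completed_borel)
  show "\<tau> (- 0) = id" by (simp add: flow_zero)
  show "\<tau> (- (x + y)) = \<tau> (- x) \<circ> \<tau> (- y)" for x y by (simp add: flow_add[symmetric])
  have "(\<lambda>p. (- fst p :: real, snd p)) \<in> borel \<Otimes>\<^sub>M P \<rightarrow>\<^sub>M borel \<Otimes>\<^sub>M P" by measurable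
  from measurable_compose[OF this flow_measurable]
  show "(\<lambda>(x, \<omega>). \<tau> (- x) \<omega>) \<in> borel \<Otimes>\<^sub>M P \<rightarrow>\<^sub>M borel" by (simp add: case_prod_beta)
  show "emeasure P (\<tau> (- x) ` S) = emeasure P S" if "S \<in> sets P" for x S
    using that by (rule flow_preserving)
  show "\<exists>c. AE \<omega> in P. \<phi> \<omega> = c"
    if "\<phi> \<in> borel_measurable P" "\<And>x. AE \<omega> in P. \<phi> (\<tau> (- x) \<omega>) = \<phi> \<omega>" for \<phi> :: "'w \<Rightarrow> real"
    using flow_ergodic[OF that(1)] that(2)[of "- x" for x] by simp
qed

lemma zero_one_law:
  assumes "{\<omega>. Q \<omega>} \<in> sets P" "\<And>x. AE \<omega> in P. Q (\<tau> x \<omega>) \<longleftrightarrow> Q \<omega>"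
  shows "(AE \<omega> in P. Q \<omega>) \<or> (AE \<omega> in P. \<not> Q \<omega>)"
proof -
  have "\<exists>c. AE \<omega> in P. indicator {\<omega>. Q \<omega>} \<omega> = (c::real)"
  proof (rule flow_ergodic)
    show "AE \<omega> in P. indicator {\<omega>. Q \<omega>} (\<tau> x \<omega>) = (indicator {\<omega>. Q \<omega>} \<omega> :: real)" for x
      using assms(2)[of x] by eventually_elim (simp add: indicator_def)
  qed (use assms(1) in measurable)
  then obtain c :: real where c: "AE \<omega> in P. indicator {\<omega>. Q \<omega>} \<omega> = c" by blast
  show ?thesis
  proof (cases "c = 1")
    case True
    from c have "AE \<omega> in P. Q \<omega>" by eventually_elim (auto simp: True indicator_def split: if_splits)
    then show ?thesis ..
  next
    case False
    from c have "AE \<omega> in P. \<not> Q \<omega>" by eventually_elim (use False in \<open>auto simp: indicator_def\<close>)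
    then show ?thesis ..
  qed
qed

end

locale bounded_stationary = ergodic_flow P \<tau> for P :: "'w::polish_space measure" and \<tau> +
  fixes g :: "real \<Rightarrow> 'w \<Rightarrow> real" and R :: real
  assumes g_measurable: "(\<lambda>(x, \<omega>). g x \<omega>) \<in> borel_measurable (borel \<Otimes>\<^sub>M P)"
    and g_shift: "g (x + y) \<omega> = g x (\<tau> y \<omega>)"
    and g_bound: "\<bar>g x \<omega>\<bar> \<le> R"
begin

lemma R_nonneg: "R \<ge> 0"
  using g_bound[of undefined undefined] by linarith

lemma g_section [measurable]: "(\<lambda>x. g x \<omega>) \<in> borel_measurable borel" "g x \<in> borel_measurable P"
  using measurable_compose[OF measurable_Pair2'[of \<omega> P borel] g_measurable]
    measurable_compose[OF measurable_Pair1'[of x borel P] g_measurable] by simp_all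

definition "I x \<omega> = (LBINT y. g y \<omega> * indicator {0..x} y)"

lemma g_indicator_integrable: "integrable lborel (\<lambda>y. g y \<omega> * indicator {a..b} y)"
proof (rule Bochner_Integration.integrable_bound)
  show "integrable lborel (\<lambda>y. R * indicator {a..b} y)"
    by (intro integrable_mult_right integrable_real_indicator) (auto simp: emeasure_lborel_Icc_eq)
  show "AE y in lborel. norm (g y \<omega> * indicator {a..b} y) \<le> norm (R * indicator {a..b} y)"
    using g_bound R_nonneg by (intro AE_I2) (auto simp: indicator_def)
qed measurable

lemma I_measurable [measurable]: "I x \<in> borel_measurable P"
proof -
  have "(\<lambda>(\<omega>, y). g y \<omega>) \<in> borel_measurable (P \<Otimes>\<^sub>M borel)"
    using measurable_compose[OF measurable_pair_swap'[of P borel] g_measurable]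
    by (simp add: case_prod_beta)
  then have [measurable]: "(\<lambda>(\<omega>, y). g y \<omega>) \<in> borel_measurable (P \<Otimes>\<^sub>M lborel)"
    by (simp only: measurable_cong_sets[OF sets_pair_measure_cong[OF refl sets_lborel] refl])
  show ?thesis
    unfolding I_def[abs_def]
    by (intro lborel.borel_measurable_lebesgue_integral) measurable
qed

text \<open>The symmetric difference of two intervals has at most two pieces, covered by
  \<open>{r..s}\<close> and \<open>{r'..s'}\<close>. Stating this through indicators admits
  degenerate and empty intervals, so one bound serves for shifts, for rounding down and for
  \<open>I 1\<close> itself.\<close>

lemma interval_change_bound:
  assumes "\<And>z. \<bar>indicator {a..b} z - indicator {c..d} z\<bar>
      \<le> (indicator {r..s} z + indicator {r'..s'} z :: real)" "r \<le> s" "r' \<le> s'"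
  shows "\<bar>(LBINT y. g y \<omega> * indicator {a..b} y) - (LBINT y. g y \<omega> * indicator {c..d} y)\<bar>
      \<le> R * ((s - r) + (s' - r'))"
proof -
  have int: "integrable lborel (indicator {r..s} :: real \<Rightarrow> real)" for r s :: real
    by (intro integrable_real_indicator) (auto simp: emeasure_lborel_Icc_eq)
  have "\<bar>(LBINT y. g y \<omega> * indicator {a..b} y) - (LBINT y. g y \<omega> * indicator {c..d} y)\<bar>
      = \<bar>LBINT y. g y \<omega> * indicator {a..b} y - g y \<omega> * indicator {c..d} y\<bar>"
    by (subst Bochner_Integration.integral_diff) (auto intro: g_indicator_integrable)
  also have "\<dots> \<le> (LBINT y. \<bar>g y \<omega> * indicator {a..b} y - g y \<omega> * indicator {c..d} y\<bar>)"
    by (rule integral_abs_bound)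
  also have "\<dots> \<le> (LBINT y. R * (indicator {r..s} y + indicator {r'..s'} y))"
  proof (rule integral_mono)
    show "integrable lborel (\<lambda>y. \<bar>g y \<omega> * indicator {a..b} y - g y \<omega> * indicator {c..d} y\<bar>)"
      by (intro integrable_abs Bochner_Integration.integrable_diff g_indicator_integrable)
    show "integrable lborel (\<lambda>y. R * (indicator {r..s} y + indicator {r'..s'} y))"
      by (intro integrable_mult_right Bochner_Integration.integrable_add int)
    fix y
    have "\<bar>g y \<omega> * indicator {a..b} y - g y \<omega> * indicator {c..d} y\<bar>
        = \<bar>g y \<omega>\<bar> * \<bar>indicator {a..b} y - indicator {c..d} y\<bar>"
      by (simp only: right_diff_distrib[symmetric] abs_mult)
    also have "\<dots> \<le> R * (indicator {r..s} y + indicator {r'..s'} y)"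
      by (intro mult_mono g_bound assms(1) R_nonneg) auto
    finally show "\<bar>g y \<omega> * indicator {a..b} y - g y \<omega> * indicator {c..d} y\<bar>
        \<le> R * (indicator {r..s} y + indicator {r'..s'} y)" .
  qed
  also have "\<dots> = R * ((s - r) + (s' - r'))"
    using assms(2,3) by (simp add: Bochner_Integration.integral_add[OF int int])
  finally show ?thesis .
qed

lemma I_shift: "I x (\<tau> y \<omega>) = (LBINT z. g z \<omega> * indicator {y..x + y} z)"
  unfolding I_def g_shift[symmetric]
  by (subst (2) lborel_integral_real_affine[where c = 1 and t = y])
     (auto intro!: Bochner_Integration.integral_cong simp: indicator_def add.commute)

lemma I_flow_bound:
  assumes "x \<ge> 0"
  shows "\<bar>I x (\<tau> y \<omega>) - I x \<omega>\<bar> \<le> 4 * R * \<bar>y\<bar>"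
proof -
  have "\<bar>I x (\<tau> y \<omega>) - I x \<omega>\<bar> \<le> R * ((\<bar>y\<bar> - - \<bar>y\<bar>) + ((x + \<bar>y\<bar>) - (x - \<bar>y\<bar>)))"
    unfolding I_shift unfolding I_def
    by (rule interval_change_bound) (use assms in \<open>auto simp: indicator_def\<close>)
  then show ?thesis by simp
qed

lemma I_floor_bound:
  assumes "x \<ge> 0"
  shows "I x \<omega> \<le> I (real (nat \<lfloor>x\<rfloor>)) \<omega> + R"
proof -
  have n: "real (nat \<lfloor>x\<rfloor>) \<le> x" "x \<le> real (nat \<lfloor>x\<rfloor>) + 1" using assms by linarith+
  have "\<bar>I x \<omega> - I (real (nat \<lfloor>x\<rfloor>)) \<omega>\<bar> \<le> R * ((x - real (nat \<lfloor>x\<rfloor>)) + (0 - 0))"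
    unfolding I_def
    by (rule interval_change_bound) (use assms n in \<open>auto simp: indicator_def\<close>)
  also have "\<dots> \<le> R * 1" using n R_nonneg by (intro mult_left_mono) linarith+
  finally show ?thesis by linarith
qed

lemma I_Suc: "I (real (Suc k)) \<omega> = I 1 \<omega> + I (real k) (\<tau> 1 \<omega>)"
proof -
  have "I 1 \<omega> + I (real k) (\<tau> 1 \<omega>) =
      (LBINT z. g z \<omega> * indicator {0..1} z + g z \<omega> * indicator {1..real k + 1} z)"
    unfolding I_shift unfolding I_def
    by (intro Bochner_Integration.integral_add[symmetric] g_indicator_integrable)
  also have "\<dots> = I (real (Suc k)) \<omega>"
    unfolding I_def
  proof (rule integral_cong_AE)
    show "AE z in lborel. g z \<omega> * indicator {0..1} z + g z \<omega> * indicator {1..real k + 1} z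
        = g z \<omega> * indicator {0..real (Suc k)} z"
      using AE_lborel_singleton[of 1] by eventually_elim (auto simp: indicator_def)
  qed measurable
  finally show ?thesis by simp
qed

lemma I_one_bound: "\<bar>I 1 \<omega>\<bar> \<le> R"
proof -
  have "\<bar>I 1 \<omega> - (LBINT y. g y \<omega> * indicator {1..0} y)\<bar> \<le> R * ((1 - 0) + (0 - 0))"
    unfolding I_def by (rule interval_change_bound) (auto simp: indicator_def)
  then show ?thesis by simp
qed

lemma expectation_I_one: "P.expectation (I 1) = P.expectation (g 0)"
proof -
  interpret lborel_P: pair_sigma_finite lborel P ..
  have [measurable]: "(\<lambda>(x, \<omega>). g x \<omega>) \<in> borel_measurable (lborel \<Otimes>\<^sub>M P)"
    using g_measurable by simp
  have "integrable (lborel \<Otimes>\<^sub>M P) (\<lambda>(y, \<omega>). g y \<omega> * indicator {0..1} y)"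
  proof (rule Bochner_Integration.integrable_bound)
    have "emeasure (lborel \<Otimes>\<^sub>M P) ({0..1::real} \<times> space P) = emeasure lborel {0..1::real} * emeasure P (space P)"
      by (rule P.emeasure_pair_measure_Times) auto
    then show "integrable (lborel \<Otimes>\<^sub>M P) (\<lambda>p. R * indicator ({0..1::real} \<times> space P) p)"
      by (intro integrable_mult_right integrable_real_indicator pair_measureI)
         (simp_all only: P.emeasure_space_1 sets.top, simp_all)
    show "AE p in lborel \<Otimes>\<^sub>M P. norm (case p of (y, \<omega>) \<Rightarrow> g y \<omega> * indicator {0..1} y)
        \<le> norm (R * indicator ({0..1::real} \<times> space P) p)"
      using g_bound R_nonneg by (intro AE_I2) (auto simp: indicator_def)
  qed measurable
  then have "P.expectation (I 1) = (LBINT y. \<integral>\<omega>. g y \<omega> * indicator {0..1} y \<partial>P)"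
    unfolding I_def by (rule lborel_P.Fubini_integral)
  also have "\<dots> = (LBINT y. P.expectation (g 0) * indicator {0..1::real} y)"
  proof (rule Bochner_Integration.integral_cong[OF refl])
    fix y
    have "(\<integral>\<omega>. g y \<omega> \<partial>P) = P.expectation (g 0)"
      using expectation_flow[of "g 0" y] g_shift[of 0 y] by simp
    then show "(\<integral>\<omega>. g y \<omega> * indicator {0..1} y \<partial>P) = P.expectation (g 0) * indicator {0..1} y"
      by simp
  qed
  finally show ?thesis by simp
qed

text \<open>The maximum of \<open>I (real k)\<close> over \<open>k \<le> n\<close>, in the recursive
  form used for the maximal ergodic theorem.\<close>

primrec running_max :: "nat \<Rightarrow> 'w \<Rightarrow> real" where
  "running_max 0 \<omega> = 0"
| "running_max (Suc n) \<omega> = max 0 (I 1 \<omega> + running_max n (\<tau> 1 \<omega>))"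

lemma running_max_nonneg: "running_max n \<omega> \<ge> 0"
  by (cases n) auto

lemma running_max_Suc: "running_max n \<omega> \<le> running_max (Suc n) \<omega>"
proof (induction n arbitrary: \<omega>)
  case (Suc n)
  from Suc[of "\<tau> 1 \<omega>"] show ?case unfolding running_max.simps(2) by (intro max.mono add_left_mono) simp_all
qed simp

lemma running_max_ge_I: "k \<le> n \<Longrightarrow> I (real k) \<omega> \<le> running_max n \<omega>"
proof (induction n arbitrary: k \<omega>)
  case 0
  have "I 0 \<omega> - (LBINT y. g y \<omega> * indicator {1..0} y) \<le> R * ((0 - 0) + (0 - 0))"
    unfolding I_def by (rule order_trans[OF abs_ge_self interval_change_bound]) (auto simp: indicator_def)
  with 0 show ?case by simp
next
  case (Suc n)
  show ?case
  proof (cases k)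
    case 0
    then show ?thesis
      using Suc.IH[of 0 \<omega>] running_max_Suc[of n \<omega>] by simp
  next
    case (Suc j)
    then have "I (real j) (\<tau> 1 \<omega>) \<le> running_max n (\<tau> 1 \<omega>)" using Suc.IH Suc.prems by simp
    then show ?thesis unfolding Suc I_Suc by simp
  qed
qed

lemma running_max_measurable [measurable]: "running_max n \<in> borel_measurable P"
proof (induction n)
  case (Suc n)
  note [measurable] = this
  show ?case unfolding running_max.simps(2)[abs_def] by measurable
qed simp

lemma running_max_bound: "running_max n \<omega> \<le> real n * R"
proof (induction n arbitrary: \<omega>)
  case (Suc n)
  from Suc[of "\<tau> 1 \<omega>"] I_one_bound[of \<omega>] R_nonneg show ?case by (auto simp: algebra_simps)
qed simp

lemma running_max_integrable: "integrable P (running_max n)"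
  using running_max_bound[of n] running_max_nonneg[of n]
  by (intro P.integrable_const_bound[where B = "real n * R"]) (auto intro!: AE_I2)

text \<open>If \<open>running_max n\<close> diverges, then \<open>running_max (Suc n) - running_max n \<circ> \<tau> 1\<close> converges to
  \<open>I 1\<close>; it is dominated by \<open>\<bar>I 1\<bar>\<close> and has nonnegative expectation.\<close>

lemma expectation_nonneg_of_unbounded:
  assumes "AE \<omega> in P. \<not> (\<exists>C. \<forall>k. I (real k) \<omega> \<le> C)"
  shows "0 \<le> P.expectation (g 0)"
proof -
  define D where "D n \<omega> = running_max (Suc n) \<omega> - running_max n (\<tau> 1 \<omega>)" for n \<omega>
  have D: "D n \<omega> = max (- running_max n (\<tau> 1 \<omega>)) (I 1 \<omega>)" for n \<omega> by (auto simp: D_def)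
  have lim: "(\<lambda>n. \<integral>\<omega>. D n \<omega> \<partial>P) \<longlonglongrightarrow> (\<integral>\<omega>. I 1 \<omega> \<partial>P)"
  proof (rule integral_dominated_convergence[where w = "\<lambda>_. R"])
    show "AE \<omega> in P. (\<lambda>n. D n \<omega>) \<longlonglongrightarrow> I 1 \<omega>"
      using assms
    proof eventually_elim
      fix \<omega> assume *: "\<not> (\<exists>C. \<forall>k. I (real k) \<omega> \<le> C)"
      have "\<exists>k. I (real k) (\<tau> 1 \<omega>) > R"
      proof (rule ccontr)
        assume "\<not> ?thesis"
        then have le: "I (real k) (\<tau> 1 \<omega>) \<le> R" for k by (meson not_less)
        have "I (real k) \<omega> \<le> R + 4 * R" for k
          using I_flow_bound[of "real k" 1 \<omega>] le[of k] by simp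
        with * show False by blast
      qed
      then obtain k where k: "I (real k) (\<tau> 1 \<omega>) > R" ..
      \<comment> \<open>Once the running maximum at \<open>\<tau> 1 \<omega>\<close> exceeds
        \<open>R\<close>, which bounds \<open>- I 1 \<omega>\<close>, the maximum in
        \<open>D n\<close> is \<open>I 1 \<omega>\<close>.\<close>
      have "D n \<omega> = I 1 \<omega>" if "n \<ge> k" for n
        using running_max_ge_I[OF that, of "\<tau> 1 \<omega>"] k I_one_bound[of \<omega>] unfolding D by linarith
      then have "\<forall>\<^sub>F n in sequentially. D n \<omega> = I 1 \<omega>" by (auto simp: eventually_sequentially)
      then show "(\<lambda>n. D n \<omega>) \<longlonglongrightarrow> I 1 \<omega>" by (rule tendsto_eventually)
    qed
    show "AE \<omega> in P. norm (D n \<omega>) \<le> R" for n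
    proof (rule AE_I2)
      fix \<omega>
      show "norm (D n \<omega>) \<le> R"
        using I_one_bound[of \<omega>] running_max_nonneg[of n "\<tau> 1 \<omega>"] R_nonneg unfolding D by (auto simp: abs_le_iff)
    qed
    show "D n \<in> borel_measurable P" for n unfolding D_def by measurable
  qed simp_all
  have "0 \<le> (\<integral>\<omega>. D n \<omega> \<partial>P)" for n
  proof -
    have int: "integrable P (\<lambda>\<omega>. running_max n (\<tau> 1 \<omega>))"
      using running_max_bound[of n] running_max_nonneg[of n]
      by (intro P.integrable_const_bound[where B = "real n * R"]) (auto intro!: AE_I2)
    have "(\<integral>\<omega>. D n \<omega> \<partial>P) = (\<integral>\<omega>. running_max (Suc n) \<omega> \<partial>P) - (\<integral>\<omega>. running_max n (\<tau> 1 \<omega>) \<partial>P)"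
      unfolding D_def by (intro Bochner_Integration.integral_diff running_max_integrable int)
    \<comment> \<open>Invariance removes the shift; then monotonicity in \<open>n\<close> gives the
      sign.\<close>
    also have "\<dots> = (\<integral>\<omega>. running_max (Suc n) \<omega> \<partial>P) - (\<integral>\<omega>. running_max n \<omega> \<partial>P)"
      by (simp only: expectation_flow[OF running_max_measurable])
    also have "\<dots> \<ge> 0"
      using integral_mono[OF running_max_integrable running_max_integrable running_max_Suc, of n] by (simp del: running_max.simps)
    finally show ?thesis .
  qed
  then have "0 \<le> P.expectation (I 1)" by (intro LIMSEQ_le_const[OF lim]) auto
  then show ?thesis by (simp only: expectation_I_one)
qed

text \<open>Boundedness of the integrals is an invariant event, as the flow by \<open>x\<close>
  changes \<open>I\<close> by at most \<open>4 * R * \<bar>x\<bar>\<close>. Ergodicity gives it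
  probability 0 or 1, and probability 0 would make the mean nonnegative.\<close>

lemma integral_bounded_above:
  assumes "P.expectation (g 0) < 0"
  shows "AE \<omega> in P. \<exists>C. \<forall>x\<ge>0. I x \<omega> \<le> C"
proof -
  define Q where "Q \<omega> \<longleftrightarrow> (\<exists>C. \<forall>k. I (real k) \<omega> \<le> C)" for \<omega>
  \<comment> \<open>Natural bounds turn the event into a countable union of countable
    intersections.\<close>
  have Q_nat: "Q \<omega> \<longleftrightarrow> (\<exists>n::nat. \<forall>k. I (real k) \<omega> \<le> real n)" for \<omega>
    unfolding Q_def by (meson order_trans real_arch_simple)
  have "{\<omega>. Q \<omega>} = {\<omega> \<in> space P. \<exists>n::nat. \<forall>k. I (real k) \<omega> \<le> real n}" by (simp add: Q_nat)
  also have "\<dots> \<in> sets P" by measurable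
  finally have meas: "{\<omega>. Q \<omega>} \<in> sets P" .
  have "Q (\<tau> x \<omega>) \<longleftrightarrow> Q \<omega>" for x \<omega>
  proof
    assume "Q (\<tau> x \<omega>)"
    then obtain C where "\<And>k. I (real k) (\<tau> x \<omega>) \<le> C" unfolding Q_def by blast
    then have "I (real k) \<omega> \<le> C + 4 * R * \<bar>x\<bar>" for k
      using I_flow_bound[of "real k" x \<omega>] by (smt (verit) of_nat_0_le_iff)
    then show "Q \<omega>" unfolding Q_def by blast
  next
    assume "Q \<omega>"
    then obtain C where "\<And>k. I (real k) \<omega> \<le> C" unfolding Q_def by blast
    then have "I (real k) (\<tau> x \<omega>) \<le> C + 4 * R * \<bar>x\<bar>" for k
      using I_flow_bound[of "real k" x \<omega>] by (smt (verit) of_nat_0_le_iff)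
    then show "Q (\<tau> x \<omega>)" unfolding Q_def by blast
  qed
  then have "(AE \<omega> in P. Q \<omega>) \<or> (AE \<omega> in P. \<not> Q \<omega>)"
    by (intro zero_one_law meas) auto
  moreover have "\<not> (AE \<omega> in P. \<not> Q \<omega>)"
    using expectation_nonneg_of_unbounded assms unfolding Q_def by auto
  ultimately have "AE \<omega> in P. Q \<omega>" by blast
  then show ?thesis
  proof eventually_elim
    fix \<omega> assume "Q \<omega>"
    then obtain C where "\<And>k. I (real k) \<omega> \<le> C" unfolding Q_def by blast
    then have "I x \<omega> \<le> C + R" if "x \<ge> 0" for x
      using I_floor_bound[OF that, of \<omega>] by (smt (verit))
    then show "\<exists>C. \<forall>x\<ge>0. I x \<omega> \<le> C" by blast
  qed
qed

end


section \<open>Stationary functions and their antiderivatives\<close>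

definition clamp_real :: "real \<Rightarrow> real \<Rightarrow> real" where
  "clamp_real R p = max (- R) (min R p)"

lemma clamp_real_bound: "R \<ge> 0 \<Longrightarrow> \<bar>clamp_real R p\<bar> \<le> R"
  by (auto simp: clamp_real_def)

lemma clamp_real_eq: "\<bar>p\<bar> \<le> R \<Longrightarrow> clamp_real R p = p"
  by (auto simp: clamp_real_def)

lemma clamp_real_mono: "p \<le> q \<Longrightarrow> clamp_real R p \<le> clamp_real R q"
  by (auto simp: clamp_real_def)

lemma clamp_real_lipschitz: "\<bar>clamp_real R p - clamp_real R q\<bar> \<le> \<bar>p - q\<bar>"
  by (auto simp: clamp_real_def)

lemma clamp_real_measurable [measurable]: "clamp_real R \<in> borel_measurable borel"
  unfolding clamp_real_def[abs_def] by measurable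

lemma C1_solution_unfold:
  "C1_solution A G \<mu> g \<longleftrightarrow>
     (\<forall>x. (g has_real_derivative deriv g x) (at x)) \<and> continuous_on UNIV (deriv g) \<and>
     (\<forall>x. A x * deriv g x + G x (g x) = \<mu>)"
proof -
  have "g C1_differentiable_on UNIV \<longleftrightarrow>
      (\<forall>x. (g has_real_derivative deriv g x) (at x)) \<and> continuous_on UNIV (deriv g)"
  proof
    assume "g C1_differentiable_on UNIV"
    then obtain D where D: "\<And>x. (g has_real_derivative D x) (at x)" "continuous_on UNIV D"
      unfolding C1_differentiable_on_def has_real_derivative_iff_has_vector_derivative by blast
    then have "deriv g = D" by (auto intro: DERIV_imp_deriv)
    with D show "(\<forall>x. (g has_real_derivative deriv g x) (at x)) \<and> continuous_on UNIV (deriv g)" by simp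
  next
    assume "(\<forall>x. (g has_real_derivative deriv g x) (at x)) \<and> continuous_on UNIV (deriv g)"
    then show "g C1_differentiable_on UNIV"
      unfolding C1_differentiable_on_def has_real_derivative_iff_has_vector_derivative by blast
  qed
  then show ?thesis unfolding C1_solution_def by blast
qed

lemma C1_solutionI:
  assumes "\<And>x. (g has_real_derivative D x) (at x)" "continuous_on UNIV D" "\<And>x. A x * D x + G x (g x) = \<mu>"
  shows "C1_solution A G \<mu> g"
proof -
  have "deriv g = D" using assms(1) by (auto intro: DERIV_imp_deriv)
  then show ?thesis using assms by (simp add: C1_solution_unfold)
qed

lemma stationary_measurable:
  assumes "stationary P \<tau> f"
  shows "(\<lambda>(x, \<omega>). f x \<omega>) \<in> borel_measurable (borel \<Otimes>\<^sub>M P)" "f x \<in> borel_measurable P"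
  using assms measurable_compose[OF measurable_Pair1'[of x borel P], of "\<lambda>(x, \<omega>). f x \<omega>" borel]
  unfolding stationary_def by simp_all

lemma ex_rational_translate_in_open:
  fixes S :: "real set"
  assumes "open S" "x \<in> S"
  shows "\<exists>r\<in>\<rat>. r + y \<in> S"
proof -
  obtain e where e: "e > 0" "\<And>z. dist z x < e \<Longrightarrow> z \<in> S"
    using assms unfolding open_dist by blast
  obtain r where "r \<in> \<rat>" "x - y < r" "r < x - y + e"
    using Rats_dense_in_real[of "x - y" "x - y + e"] e(1) by auto
  then show ?thesis using e(2)[of "r + y"] by (auto simp: dist_real_def)
qed

context ergodic_flow
begin

text \<open>The ergodic bound is applied to \<open>f - \<theta>\<close>, which has negative mean.
  The path bound holds almost surely, while \<open>bounded_stationary\<close> wants it everywhere;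
  clamping supplies it without disturbing stationarity.\<close>

lemma antiderivative_bound_right:
  assumes stat: "stationary P \<tau> f"
    and path: "AE \<omega> in P. (\<forall>x. \<bar>f x \<omega>\<bar> \<le> R) \<and> continuous_on UNIV (\<lambda>x. f x \<omega>)"
    and less: "P.expectation (f 0) < \<theta>"
  shows "AE \<omega> in P. \<exists>V C. (\<forall>x. (V has_real_derivative f x \<omega>) (at x)) \<and> (\<forall>x\<ge>0. V x \<le> \<theta> * x + C)"
proof -
  have "\<exists>\<omega>. \<forall>x. \<bar>f x \<omega>\<bar> \<le> R"
  proof (rule ccontr)
    assume none: "\<not> ?thesis"
    from path have "AE \<omega> in P. False" by eventually_elim (use none in blast)
    then show False by simp
  qed
  then have R: "R \<ge> 0" by (meson abs_ge_zero order_trans)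
  have [measurable]: "(\<lambda>(x, \<omega>). f x \<omega>) \<in> borel_measurable (borel \<Otimes>\<^sub>M P)" "f 0 \<in> borel_measurable P"
    using stationary_measurable[OF stat] by auto
  define g where "g x \<omega> = clamp_real R (f x \<omega>) - \<theta>" for x \<omega>
  interpret g: bounded_stationary P \<tau> g "R + \<bar>\<theta>\<bar>"
  proof
    show "(\<lambda>(x, \<omega>). g x \<omega>) \<in> borel_measurable (borel \<Otimes>\<^sub>M P)" unfolding g_def by measurable
    show "g (x + y) \<omega> = g x (\<tau> y \<omega>)" for x y \<omega> using stat by (simp add: g_def stationary_def)
    show "\<bar>g x \<omega>\<bar> \<le> R + \<bar>\<theta>\<bar>" for x \<omega>
      using clamp_real_bound[OF R, of "f x \<omega>"] unfolding g_def by linarith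
  qed
  have "P.expectation (\<lambda>\<omega>. clamp_real R (f 0 \<omega>)) = P.expectation (f 0)"
  proof (rule integral_cong_AE)
    show "AE \<omega> in P. clamp_real R (f 0 \<omega>) = f 0 \<omega>"
      using path by eventually_elim (simp add: clamp_real_eq)
  qed measurable
  moreover have "integrable P (\<lambda>\<omega>. clamp_real R (f 0 \<omega>))"
    using clamp_real_bound[OF R] by (intro P.integrable_const_bound[where B = R]) (auto intro!: AE_I2)
  ultimately have "P.expectation (g 0) < 0"
    using less unfolding g_def[abs_def] by (simp add: P.prob_space[simplified])
  from g.integral_bounded_above[OF this] path show ?thesis
  proof eventually_elim
    fix \<omega> assume "\<exists>C. \<forall>x\<ge>0. g.I x \<omega> \<le> C"
      and f: "(\<forall>x. \<bar>f x \<omega>\<bar> \<le> R) \<and> continuous_on UNIV (\<lambda>x. f x \<omega>)"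
    then obtain C where C: "\<And>x. x \<ge> 0 \<Longrightarrow> g.I x \<omega> \<le> C" by blast
    have g_eq: "g x \<omega> = f x \<omega> - \<theta>" for x using f by (simp add: g_def clamp_real_eq)
    obtain V where V: "\<And>x. (V has_real_derivative f x \<omega>) (at x)"
      using antiderivative_exists[of "\<lambda>x. f x \<omega>"] f by blast
    have "V x \<le> \<theta> * x + (C + V 0)" if "x \<ge> 0" for x
    proof -
      have "has_bochner_integral lborel (\<lambda>y. (f y \<omega> - \<theta>) * indicator {0..x} y) ((V x - \<theta> * x) - (V 0 - \<theta> * 0))"
      proof (rule has_bochner_integral_FTC_Icc_real[OF that])
        show "((\<lambda>y. V y - \<theta> * y) has_real_derivative f y \<omega> - \<theta>) (at y)" for y
          by (auto intro!: derivative_eq_intros V)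
        show "isCont (\<lambda>y. f y \<omega> - \<theta>) y" for y
          using f by (auto intro!: continuous_intros simp: continuous_on_eq_continuous_at)
      qed
      then have "g.I x \<omega> = V x - \<theta> * x - V 0"
        unfolding g.I_def g_eq by (simp add: has_bochner_integral_iff)
      with C[OF that] show ?thesis by linarith
    qed
    with V show "\<exists>V C. (\<forall>x. (V has_real_derivative f x \<omega>) (at x)) \<and> (\<forall>x\<ge>0. V x \<le> \<theta> * x + C)" by blast
  qed
qed

text \<open>\<open>- f (- x)\<close> is stationary for the reversed flow, with mean below
  \<open>- \<theta>\<close>; if \<open>V\<close> is its antiderivative, then \<open>V (- x)\<close>
  is one of \<open>f\<close>.\<close>

lemma antiderivative_bound_left:
  assumes stat: "stationary P \<tau> f"
    and path: "AE \<omega> in P. (\<forall>x. \<bar>f x \<omega>\<bar> \<le> R) \<and> continuous_on UNIV (\<lambda>x. f x \<omega>)"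
    and less: "\<theta> < P.expectation (f 0)"
  shows "AE \<omega> in P. \<exists>V C. (\<forall>x. (V has_real_derivative f x \<omega>) (at x)) \<and> (\<forall>x\<le>0. V x \<le> \<theta> * x + C)"
proof -
  interpret rev: ergodic_flow P "\<lambda>x. \<tau> (- x)" by (rule reversed_flow)
  have "AE \<omega> in P. \<exists>V C. (\<forall>x. (V has_real_derivative - f (- x) \<omega>) (at x)) \<and> (\<forall>x\<ge>0. V x \<le> - \<theta> * x + C)"
  proof (rule rev.antiderivative_bound_right[where R = R])
    have "(\<lambda>p. (- fst p :: real, snd p)) \<in> borel \<Otimes>\<^sub>M P \<rightarrow>\<^sub>M borel \<Otimes>\<^sub>M P" by measurable
    from measurable_compose[OF this stationary_measurable(1)[OF stat]]
    have "(\<lambda>(x, \<omega>). f (- x) \<omega>) \<in> borel_measurable (borel \<Otimes>\<^sub>M P)" by (simp add: case_prod_beta)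
    moreover have "f (- (x + y)) \<omega> = f (- x) (\<tau> (- y) \<omega>)" for x y \<omega>
      using stat unfolding stationary_def by (metis minus_add_distrib)
    ultimately show "stationary P (\<lambda>x. \<tau> (- x)) (\<lambda>x \<omega>. - f (- x) \<omega>)"
      unfolding stationary_def by (auto simp: case_prod_beta)
    show "AE \<omega> in P. (\<forall>x. \<bar>- f (- x) \<omega>\<bar> \<le> R) \<and> continuous_on UNIV (\<lambda>x. - f (- x) \<omega>)"
      using path
      by eventually_elim (auto intro!: continuous_intros continuous_on_compose2[of UNIV "\<lambda>x. f x _" UNIV uminus])
    show "P.expectation (\<lambda>\<omega>. - f (- 0) \<omega>) < - \<theta>" using less by simp
  qed
  then show ?thesis
  proof eventually_elim
    fix \<omega> assume "\<exists>V C. (\<forall>x. (V has_real_derivative - f (- x) \<omega>) (at x)) \<and> (\<forall>x\<ge>0. V x \<le> - \<theta> * x + C)"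
    then obtain V C where V: "\<And>x. (V has_real_derivative - f (- x) \<omega>) (at x)" "\<And>x. x \<ge> 0 \<Longrightarrow> V x \<le> - \<theta> * x + C"
      by blast
    have "((\<lambda>x. V (- x)) has_real_derivative f x \<omega>) (at x)" for x
    proof -
      have "((\<lambda>x. - x) has_real_derivative - 1) (at x)" by (auto intro!: derivative_eq_intros)
      from DERIV_chain2[OF V(1) this] show ?thesis by simp
    qed
    moreover have "V (- x) \<le> \<theta> * x + C" if "x \<le> 0" for x using V(2)[of "- x"] that by simp
    ultimately show "\<exists>V C. (\<forall>x. (V has_real_derivative f x \<omega>) (at x)) \<and> (\<forall>x\<le>0. V x \<le> \<theta> * x + C)" by blast
  qed
qed

text \<open>Fubini yields one point \<open>x\<^sub>0\<close> with an almost sure bound, stationarity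
  carries it to every fixed point, and continuity passes from the rationals to all points at
  once.\<close>

lemma essentially_bounded_paths:
  assumes stat: "stationary P \<tau> f" and bd: "essentially_bounded P f"
    and cont: "AE \<omega> in P. continuous_on UNIV (\<lambda>x. f x \<omega>)"
  shows "\<exists>R. AE \<omega> in P. \<forall>x. \<bar>f x \<omega>\<bar> \<le> R"
proof -
  interpret lborel_P: pair_sigma_finite lborel P ..
  obtain C where "AE (x, \<omega>) in lborel \<Otimes>\<^sub>M P. \<bar>f x \<omega>\<bar> \<le> C"
    using bd unfolding essentially_bounded_def by blast
  then have AE: "AE x in lborel. AE \<omega> in P. \<bar>f x \<omega>\<bar> \<le> C"
    by (auto dest: lborel_P.AE_pair)
  have "\<exists>x. AE \<omega> in P. \<bar>f x \<omega>\<bar> \<le> C"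
  proof (rule ccontr)
    assume "\<not> ?thesis"
    with AE have "AE x in (lborel :: real measure). False" by simp
    then show False by (simp add: eventually_False ae_filter_eq_bot_iff)
  qed
  then obtain x\<^sub>0 where x0: "AE \<omega> in P. \<bar>f x\<^sub>0 \<omega>\<bar> \<le> C" by blast
  have "AE \<omega> in P. \<bar>f x \<omega>\<bar> \<le> C" for x
  proof -
    have "f x\<^sub>0 (\<tau> (x - x\<^sub>0) \<omega>) = f x \<omega>" for \<omega>
      using stat unfolding stationary_def by (metis add_diff_cancel_left' add_diff_eq)
    then show ?thesis using AE_flow[OF x0, of "x - x\<^sub>0"] by simp
  qed
  then have "AE \<omega> in P. \<forall>r\<in>\<rat>. \<bar>f r \<omega>\<bar> \<le> C"
    by (subst AE_ball_countable[OF countable_rat]) blast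
  with cont have "AE \<omega> in P. \<forall>x. \<bar>f x \<omega>\<bar> \<le> C"
  proof eventually_elim
    fix \<omega> assume c: "continuous_on UNIV (\<lambda>x. f x \<omega>)" and r: "\<forall>r\<in>\<rat>. \<bar>f r \<omega>\<bar> \<le> C"
    have "open {x. C < \<bar>f x \<omega>\<bar>}" by (intro open_Collect_less continuous_intros c)
    from ex_rational_translate_in_open[OF this, of _ 0] r show "\<forall>x. \<bar>f x \<omega>\<bar> \<le> C"
      by (force simp: not_le)
  qed
  then show ?thesis by blast
qed

end


section \<open>Stationary solutions or crossings\<close>

text \<open>No growth condition is imposed on \<open>H\<close>, so that the hypotheses are invariant under
  replacing \<open>H(x, p)\<close> by \<open>- H(x, - p)\<close>.\<close>

locale stationary_equation = ergodic_flow P \<tau>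
  for P :: "'w::polish_space measure" and \<tau> :: "real \<Rightarrow> 'w \<Rightarrow> 'w" +
  fixes a :: "real \<Rightarrow> 'w \<Rightarrow> real" and H :: "real \<Rightarrow> real \<Rightarrow> 'w \<Rightarrow> real"
  assumes a_stationary: "stationary P \<tau> a"
    and a_range: "\<And>x \<omega>. a x \<omega> \<in> {0..1}"
    and a_pos: "AE \<omega> in P. \<forall>x. a x \<omega> > 0"
    and a_cont: "\<And>\<omega>. continuous_on UNIV (\<lambda>x. a x \<omega>)"
    and H_measurable: "(\<lambda>(x, p, \<omega>). H x p \<omega>) \<in> borel_measurable (borel \<Otimes>\<^sub>M borel \<Otimes>\<^sub>M P)"
    and H_stationary: "\<And>x y p \<omega>. H (x + y) p \<omega> = H x p (\<tau> y \<omega>)"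
    and H_local: "\<And>R. \<exists>K. \<forall>x y p q \<omega>. \<bar>p\<bar> \<le> R \<longrightarrow> \<bar>q\<bar> \<le> R \<longrightarrow>
        \<bar>H x p \<omega>\<bar> \<le> K \<and> \<bar>H x p \<omega> - H x q \<omega>\<bar> \<le> K * \<bar>p - q\<bar> \<and> \<bar>H x p \<omega> - H y p \<omega>\<bar> \<le> K * \<bar>x - y\<bar>"

locale two_correctors = stationary_equation P \<tau> a H
  for P :: "'w::polish_space measure" and \<tau> a H +
  fixes f\<^sub>1 f\<^sub>2 :: "real \<Rightarrow> 'w \<Rightarrow> real" and lam \<mu> R K :: real
  assumes f_sol: "f\<^sub>1 \<in> stationary_solutions P \<tau> a H lam" "f\<^sub>2 \<in> stationary_solutions P \<tau> a H lam"
    and f_less: "AE \<omega> in P. \<forall>x. f\<^sub>1 x \<omega> < f\<^sub>2 x \<omega>"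
    and f_bound: "AE \<omega> in P. \<forall>x. \<bar>f\<^sub>1 x \<omega>\<bar> \<le> R" "AE \<omega> in P. \<forall>x. \<bar>f\<^sub>2 x \<omega>\<bar> \<le> R"
    and H_K: "\<And>x y p q \<omega>. \<bar>p\<bar> \<le> R \<Longrightarrow> \<bar>q\<bar> \<le> R \<Longrightarrow>
        \<bar>H x p \<omega>\<bar> \<le> K \<and> \<bar>H x p \<omega> - H x q \<omega>\<bar> \<le> K * \<bar>p - q\<bar> \<and> \<bar>H x p \<omega> - H y p \<omega>\<bar> \<le> K * \<bar>x - y\<bar>"
    and mu_less: "\<mu> < lam"
begin

definition "good \<omega> \<longleftrightarrow> (\<forall>x. a x \<omega> > 0) \<and> (\<forall>x. f\<^sub>1 x \<omega> < f\<^sub>2 x \<omega>) \<and>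
   (\<forall>x. \<bar>f\<^sub>1 x \<omega>\<bar> \<le> R) \<and> (\<forall>x. \<bar>f\<^sub>2 x \<omega>\<bar> \<le> R) \<and>
   C1_solution (\<lambda>x. a x \<omega>) (\<lambda>x p. H x p \<omega>) lam (\<lambda>x. f\<^sub>1 x \<omega>) \<and>
   C1_solution (\<lambda>x. a x \<omega>) (\<lambda>x p. H x p \<omega>) lam (\<lambda>x. f\<^sub>2 x \<omega>)"

lemma AE_good: "AE \<omega> in P. good \<omega>"
proof -
  have "AE \<omega> in P. C1_solution (\<lambda>x. a x \<omega>) (\<lambda>x p. H x p \<omega>) lam (\<lambda>x. f\<^sub>1 x \<omega>)"
    "AE \<omega> in P. C1_solution (\<lambda>x. a x \<omega>) (\<lambda>x p. H x p \<omega>) lam (\<lambda>x. f\<^sub>2 x \<omega>)"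
    using f_sol by (auto simp: stationary_solutions_def)
  with a_pos f_less f_bound show ?thesis
    by eventually_elim (simp add: good_def)
qed

lemma R_nonneg: "R \<ge> 0"
proof (rule ccontr)
  assume "\<not> ?thesis"
  then have "\<not> \<bar>f\<^sub>1 0 \<omega>\<bar> \<le> R" for \<omega> by linarith
  then have none: "\<not> (\<forall>x. \<bar>f\<^sub>1 x \<omega>\<bar> \<le> R)" for \<omega> by blast
  from f_bound(1) have "AE \<omega> in P. False" by eventually_elim (use none in blast)
  then show False by simp
qed

lemma K_nonneg: "K \<ge> 0"
  using H_K[of 0 0] R_nonneg by (metis abs_ge_zero abs_zero order_trans)

text \<open>\<open>K\<close> is a Lipschitz constant of \<open>H\<close> in \<open>p\<close> on
  [-R, R], so the coefficient \<open>K + 1\<close>, which plays the part of \<open>L\<close>, makes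
  \<open>N\<close> nondecreasing; the summand 1 keeps \<open>L\<close> positive when
  \<open>K = 0\<close>.\<close>

definition "N x p \<omega> = (K + 1) * clamp_real R p - H x (clamp_real R p) \<omega>"

lemma clamp_abs: "\<bar>clamp_real R p\<bar> \<le> R"
  by (rule clamp_real_bound[OF R_nonneg])

lemma N_mono:
  assumes "p \<le> q"
  shows "N x p \<omega> \<le> N x q \<omega>"
proof -
  have "H x (clamp_real R q) \<omega> - H x (clamp_real R p) \<omega> \<le> K * \<bar>clamp_real R q - clamp_real R p\<bar>"
    using H_K[OF clamp_abs clamp_abs, of x q \<omega> p] by (auto simp: abs_le_iff)
  also have "\<dots> = K * (clamp_real R q - clamp_real R p)"
    using clamp_real_mono[OF assms, of R] by simp
  also have "\<dots> \<le> (K + 1) * (clamp_real R q - clamp_real R p)"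
    using clamp_real_mono[OF assms, of R] by (intro mult_right_mono) auto
  finally show ?thesis by (simp add: N_def algebra_simps)
qed

lemma N_bound: "\<bar>N x p \<omega>\<bar> \<le> (K + 1) * R + K"
proof -
  have "\<bar>(K + 1) * clamp_real R p\<bar> \<le> (K + 1) * R"
    using clamp_abs[of p] K_nonneg by (simp add: abs_mult mult_left_mono)
  moreover have "\<bar>H x (clamp_real R p) \<omega>\<bar> \<le> K" using H_K[OF clamp_abs clamp_abs] by blast
  ultimately show ?thesis unfolding N_def by linarith
qed

lemma N_cont: "continuous_on UNIV (\<lambda>(x, p). N x p \<omega>)"
proof -
  have "(2 * K)-lipschitz_on UNIV (\<lambda>(x, p). H x (clamp_real R p) \<omega>)"
  proof (rule lipschitz_onI)
    show "0 \<le> 2 * K" using K_nonneg by simp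
    fix z w :: "real \<times> real"
    obtain x p y q where zw: "z = (x, p)" "w = (y, q)" by (cases z, cases w)
    have "\<bar>H x (clamp_real R p) \<omega> - H y (clamp_real R p) \<omega>\<bar> \<le> K * \<bar>x - y\<bar>"
      "\<bar>H y (clamp_real R p) \<omega> - H y (clamp_real R q) \<omega>\<bar> \<le> K * \<bar>clamp_real R p - clamp_real R q\<bar>"
      using H_K[OF clamp_abs clamp_abs] by blast+
    moreover have "\<bar>x - y\<bar> \<le> dist z w"
      using dist_fst_le[of z w] by (simp add: zw dist_real_def)
    moreover have "\<bar>clamp_real R p - clamp_real R q\<bar> \<le> dist z w"
      using dist_snd_le[of z w] clamp_real_lipschitz[of R p q] by (simp add: zw dist_real_def)
    ultimately have "\<bar>H x (clamp_real R p) \<omega> - H y (clamp_real R q) \<omega>\<bar> \<le> K * dist z w + K * dist z w"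
      using K_nonneg mult_left_mono[of "\<bar>x - y\<bar>" "dist z w" K]
        mult_left_mono[of "\<bar>clamp_real R p - clamp_real R q\<bar>" "dist z w" K] by linarith
    then show "dist (case z of (x, p) \<Rightarrow> H x (clamp_real R p) \<omega>) (case w of (x, p) \<Rightarrow> H x (clamp_real R p) \<omega>)
        \<le> 2 * K * dist z w"
      by (simp add: zw dist_real_def)
  qed
  from lipschitz_on_continuous_on[OF this] show ?thesis
    unfolding N_def clamp_real_def case_prod_beta by (intro continuous_intros)
qed

lemma N_unclamped: "\<bar>p\<bar> \<le> R \<Longrightarrow> H x p \<omega> = (K + 1) * p - N x p \<omega>"
  by (simp add: N_def clamp_real_eq)

definition "iterate k x \<omega> =
  relax_iter (\<lambda>x. a x \<omega>) (K + 1) (\<lambda>x p. N x p \<omega>) \<mu> (\<lambda>x. f\<^sub>2 x \<omega>) k x"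

definition "F x \<omega> = lim (\<lambda>k. iterate k x \<omega>)"

lemma f_stationary: "stationary P \<tau> f\<^sub>1" "stationary P \<tau> f\<^sub>2"
  using f_sol by (auto simp: stationary_solutions_def)

lemma iterate_measurable: "(\<lambda>(x, \<omega>). iterate k x \<omega>) \<in> borel_measurable (borel \<Otimes>\<^sub>M P)"
proof (induction k)
  case 0
  then show ?case using stationary_measurable(1)[OF f_stationary(2)] by (simp add: iterate_def)
next
  case (Suc k)
  note [measurable] = Suc
  have "(\<lambda>p. (fst p, clamp_real R (iterate k (fst p) (snd p)), snd p))
      \<in> borel \<Otimes>\<^sub>M P \<rightarrow>\<^sub>M borel \<Otimes>\<^sub>M borel \<Otimes>\<^sub>M P" by measurable
  from measurable_compose[OF this H_measurable]
  have [measurable]: "(\<lambda>(x, \<omega>). H x (clamp_real R (iterate k x \<omega>)) \<omega>) \<in> borel_measurable (borel \<Otimes>\<^sub>M P)"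
    by (simp add: case_prod_beta)
  have "(\<lambda>(x, \<omega>). \<mu> + N x (iterate k x \<omega>) \<omega>) \<in> borel_measurable (borel \<Otimes>\<^sub>M P)"
    unfolding N_def by measurable
  from relax_measurable[OF stationary_measurable(1)[OF a_stationary] this, of "K + 1"]
  show ?case by (simp add: iterate_def)
qed

lemma F_measurable: "(\<lambda>(x, \<omega>). F x \<omega>) \<in> borel_measurable (borel \<Otimes>\<^sub>M P)"
  unfolding F_def case_prod_beta
  by (rule borel_measurable_lim_metric) (use iterate_measurable in \<open>simp add: case_prod_beta\<close>)

text \<open>Every ingredient of \<open>iterate\<close> commutes with translation by a formal
  computation, so this holds for all \<omega>, including those that are not \<open>good\<close>. The
  exact identity in \<open>stationary\<close> thus needs no change of \<open>F\<close> on a null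
  set.\<close>

lemma F_shift: "F (x + y) \<omega> = F x (\<tau> y \<omega>)"
proof -
  have "iterate k (x + y) \<omega> = iterate k x (\<tau> y \<omega>)" for k
  proof -
    have "(\<lambda>x. a x (\<tau> y \<omega>)) = (\<lambda>x. a (x + y) \<omega>)" "(\<lambda>x. f\<^sub>2 x (\<tau> y \<omega>)) = (\<lambda>x. f\<^sub>2 (x + y) \<omega>)"
      using a_stationary f_stationary(2) by (auto simp: stationary_def)
    moreover have "(\<lambda>x p. N x p (\<tau> y \<omega>)) = (\<lambda>x p. N (x + y) p \<omega>)"
      by (simp add: N_def H_stationary)
    ultimately show ?thesis
      unfolding iterate_def
      using relax_iter_shift[of "\<lambda>x. a x \<omega>" y "K + 1" "\<lambda>x p. N x p \<omega>" \<mu> "\<lambda>x. f\<^sub>2 x \<omega>" k x]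
      by (simp only:)
  qed
  then show ?thesis by (simp add: F_def)
qed

lemma corrector_iteration_good:
  assumes "good \<omega>"
  shows "corrector_iteration (\<lambda>x. a x \<omega>) (K + 1) (\<lambda>x p. N x p \<omega>) ((K + 1) * R + K) \<mu> lam R
     (\<lambda>x. f\<^sub>2 x \<omega>) (deriv (\<lambda>x. f\<^sub>2 x \<omega>))"
proof
  have sol: "C1_solution (\<lambda>x. a x \<omega>) (\<lambda>x p. H x p \<omega>) lam (\<lambda>x. f\<^sub>2 x \<omega>)"
    and bd: "\<And>x. \<bar>f\<^sub>2 x \<omega>\<bar> \<le> R"
    using assms by (auto simp: good_def)
  show "continuous_on UNIV (\<lambda>x. a x \<omega>)" by (rule a_cont)
  show "0 < a x \<omega>" for x using assms by (simp add: good_def)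
  show "a x \<omega> \<le> 1" for x using a_range[of x \<omega>] by simp
  show "K + 1 > 0" using K_nonneg by simp
  show "((\<lambda>x. f\<^sub>2 x \<omega>) has_real_derivative deriv (\<lambda>x. f\<^sub>2 x \<omega>) x) (at x)" for x
    using sol by (simp add: C1_solution_unfold)
  have "a x \<omega> * deriv (\<lambda>x. f\<^sub>2 x \<omega>) x + H x (f\<^sub>2 x \<omega>) \<omega> = lam" for x
    using sol by (simp add: C1_solution_unfold)
  then show "a x \<omega> * deriv (\<lambda>x. f\<^sub>2 x \<omega>) x + (K + 1) * f\<^sub>2 x \<omega> = lam + N x (f\<^sub>2 x \<omega>) \<omega>" for x
    using N_unclamped[OF bd[of x], of x \<omega>] by (metis add.commute add_diff_eq diff_add_cancel)
  show "\<bar>f\<^sub>2 x \<omega>\<bar> \<le> R" for x by (rule bd)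
qed (use N_cont N_mono N_bound mu_less in auto)

lemma F_good:
  assumes "good \<omega>"
  shows "corrector_iteration.F (\<lambda>x. a x \<omega>) (K + 1) (\<lambda>x p. N x p \<omega>) \<mu> (\<lambda>x. f\<^sub>2 x \<omega>) = (\<lambda>x. F x \<omega>)"
  unfolding corrector_iteration.F_def[OF corrector_iteration_good[OF assms]] F_def iterate_def ..

text \<open>Rational points make the event measurable; by continuity they detect every crossing when
  \<open>good \<omega>\<close>.\<close>

definition "crosses \<omega> \<longleftrightarrow> (\<exists>r\<in>\<rat>. F r \<omega> < f\<^sub>1 r \<omega>)"

text \<open>The flow turns the rational sample points into the points \<open>r + y\<close>; as the
  crossing set is open, either sampling meets it whenever it is nonempty.\<close>

lemma crosses_iff:
  assumes "good \<omega>"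
  shows "(\<exists>r\<in>\<rat>. F (r + y) \<omega> < f\<^sub>1 (r + y) \<omega>) \<longleftrightarrow> (\<exists>x. F x \<omega> < f\<^sub>1 x \<omega>)"
proof -
  interpret c: corrector_iteration "\<lambda>x. a x \<omega>" "K + 1" "\<lambda>x p. N x p \<omega>" "(K + 1) * R + K" \<mu> lam R
    "\<lambda>x. f\<^sub>2 x \<omega>" "deriv (\<lambda>x. f\<^sub>2 x \<omega>)"
    by (rule corrector_iteration_good[OF assms])
  have "continuous_on UNIV (\<lambda>x. F x \<omega>)"
    using c.F_isCont unfolding F_good[OF assms] by (simp add: continuous_on_eq_continuous_at)
  moreover have "continuous_on UNIV (\<lambda>x. f\<^sub>1 x \<omega>)"
    using assms unfolding good_def C1_solution_unfold continuous_on_eq_continuous_at[OF open_UNIV]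
    by (blast intro: DERIV_isCont)
  ultimately have "open {x. F x \<omega> < f\<^sub>1 x \<omega>}" by (intro open_Collect_less)
  from ex_rational_translate_in_open[OF this, of _ y] show ?thesis by auto
qed

lemma crosses_zero_one: "(AE \<omega> in P. crosses \<omega>) \<or> (AE \<omega> in P. \<not> crosses \<omega>)"
proof (rule zero_one_law)
  have [measurable]: "F r \<in> borel_measurable P" "f\<^sub>1 r \<in> borel_measurable P" for r
    using stationary_measurable(2)[OF f_stationary(1)]
      measurable_compose[OF measurable_Pair1'[of r borel P] F_measurable] by simp_all
  have "{\<omega> \<in> space P. F r \<omega> < f\<^sub>1 r \<omega>} \<in> sets P" for r by measurable
  moreover have "{\<omega>. crosses \<omega>} = (\<Union>r\<in>\<rat>. {\<omega> \<in> space P. F r \<omega> < f\<^sub>1 r \<omega>})" by (auto simp: crosses_def)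
  ultimately
  show "{\<omega>. crosses \<omega>} \<in> sets P" using countable_rat by (auto intro!: sets.countable_UN')
  show "AE \<omega> in P. crosses (\<tau> y \<omega>) \<longleftrightarrow> crosses \<omega>" for y
    using AE_good
  proof eventually_elim
    fix \<omega> assume "good \<omega>"
    have "crosses (\<tau> y \<omega>) \<longleftrightarrow> (\<exists>r\<in>\<rat>. F (r + y) \<omega> < f\<^sub>1 (r + y) \<omega>)"
      using f_stationary(1) by (simp add: crosses_def F_shift stationary_def)
    also have "\<dots> \<longleftrightarrow> crosses \<omega>"
      using crosses_iff[OF \<open>good \<omega>\<close>, of y] crosses_iff[OF \<open>good \<omega>\<close>, of 0] by (simp add: crosses_def)
    finally show "crosses (\<tau> y \<omega>) \<longleftrightarrow> crosses \<omega>" .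
  qed
qed

text \<open>The truncation is only needed where \<open>\<omega>\<close> is exceptional, to make the function bounded there too.\<close>

lemma no_crossing_gives_solution:
  assumes "AE \<omega> in P. \<not> crosses \<omega>"
  shows "(\<lambda>x \<omega>. clamp_real R (F x \<omega>)) \<in> stationary_solutions_between P \<tau> a H \<mu> f\<^sub>1 f\<^sub>2"
  unfolding stationary_solutions_between_def
proof (intro CollectI conjI)
  have [measurable]: "(\<lambda>(x, \<omega>). F x \<omega>) \<in> borel_measurable (borel \<Otimes>\<^sub>M P)" by (rule F_measurable)
  show "stationary P \<tau> (\<lambda>x \<omega>. clamp_real R (F x \<omega>))"
    unfolding stationary_def by (auto simp: F_shift)
  show "bounded (range (\<lambda>(x, \<omega>). clamp_real R (F x \<omega>)))"
    unfolding bounded_iff using clamp_abs by auto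
  show "AE \<omega> in P. C1_solution (\<lambda>x. a x \<omega>) (\<lambda>x p. H x p \<omega>) \<mu> (\<lambda>x. clamp_real R (F x \<omega>)) \<and>
      (\<forall>x. f\<^sub>1 x \<omega> < clamp_real R (F x \<omega>) \<and> clamp_real R (F x \<omega>) < f\<^sub>2 x \<omega>)"
    using AE_good assms
  proof eventually_elim
    fix \<omega> assume \<omega>: "good \<omega>" "\<not> crosses \<omega>"
    interpret c: corrector_iteration "\<lambda>x. a x \<omega>" "K + 1" "\<lambda>x p. N x p \<omega>" "(K + 1) * R + K" \<mu> lam R
      "\<lambda>x. f\<^sub>2 x \<omega>" "deriv (\<lambda>x. f\<^sub>2 x \<omega>)"
      by (rule corrector_iteration_good[OF \<omega>(1)])
    note F_eq = F_good[OF \<omega>(1)]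
    have ge: "f\<^sub>1 x \<omega> \<le> F x \<omega>" for x
      using crosses_iff[OF \<omega>(1), of 0] \<omega>(2) by (force simp: crosses_def not_less)
    have lt: "F x \<omega> < f\<^sub>2 x \<omega>" for x using c.F_less[of x] by (simp add: F_eq)
    \<comment> \<open>Without crossings \<open>F\<close> stays in the range where the clamp in
      \<open>N\<close> is inactive, so the fixed point solves the original equation.\<close>
    have bd: "\<bar>F x \<omega>\<bar> \<le> R" for x
    proof -
      have "\<bar>f\<^sub>1 x \<omega>\<bar> \<le> R" "\<bar>f\<^sub>2 x \<omega>\<bar> \<le> R" using \<omega>(1) by (auto simp: good_def)
      with ge[of x] lt[of x] show ?thesis by linarith
    qed
    have cl: "clamp_real R (F x \<omega>) = F x \<omega>" for x by (rule clamp_real_eq[OF bd])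
    define D where "D x = (\<mu> - H x (F x \<omega>) \<omega>) / a x \<omega>" for x
    have D: "((\<lambda>x. F x \<omega>) has_real_derivative D x) (at x)" for x
    proof -
      have "\<mu> + N x (F x \<omega>) \<omega> - (K + 1) * F x \<omega> = \<mu> - H x (F x \<omega>) \<omega>"
        using N_unclamped[OF bd[of x], of x \<omega>] by linarith
      with c.F_deriv[of x] show ?thesis unfolding F_eq D_def by (simp only:)
    qed
    have aD: "a x \<omega> * D x + H x (F x \<omega>) \<omega> = \<mu>" for x
      using c.A_pos[of x] by (simp add: D_def)
    have "continuous_on UNIV (\<lambda>x. F x \<omega>)"
      using D by (auto simp: continuous_on_eq_continuous_at intro: DERIV_isCont)
    then have "continuous_on UNIV (\<lambda>x. (\<mu> - ((K + 1) * F x \<omega> - N x (F x \<omega>) \<omega>)) / a x \<omega>)"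
      using c.A_pos
      by (intro continuous_intros c.N_comp_cont c.A_cont) (auto simp: less_imp_neq[symmetric])
    then have "continuous_on UNIV D"
      unfolding D_def using N_unclamped[OF bd] by simp
    with D aD have "C1_solution (\<lambda>x. a x \<omega>) (\<lambda>x p. H x p \<omega>) \<mu> (\<lambda>x. F x \<omega>)"
      by (intro C1_solutionI)
    \<comment> \<open>At a contact point the values agree, so
      \<open>a F' = \<mu> - H < lam - H = a f\<^sub>1'\<close>, and \<open>F\<close> would pass
      below \<open>f\<^sub>1\<close> immediately to the right.\<close>
    moreover have "f\<^sub>1 x \<omega> < F x \<omega>" for x
    proof (rule ccontr)
      assume "\<not> ?thesis"
      with ge[of x] have eq: "F x \<omega> = f\<^sub>1 x \<omega>" by simp
      have f1: "((\<lambda>x. f\<^sub>1 x \<omega>) has_real_derivative deriv (\<lambda>x. f\<^sub>1 x \<omega>) x) (at x)"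
        "a x \<omega> * deriv (\<lambda>x. f\<^sub>1 x \<omega>) x + H x (f\<^sub>1 x \<omega>) \<omega> = lam"
        using \<omega>(1) unfolding good_def C1_solution_unfold by auto
      have "a x \<omega> * D x < a x \<omega> * deriv (\<lambda>x. f\<^sub>1 x \<omega>) x"
        using aD[of x] f1(2) mu_less unfolding eq by linarith
      then have "D x - deriv (\<lambda>x. f\<^sub>1 x \<omega>) x < 0" using c.A_pos[of x] by simp
      from DERIV_neg_dec_right[OF DERIV_diff[OF D f1(1)] this]
      obtain d where "d > 0" "\<And>h. 0 < h \<Longrightarrow> h < d \<Longrightarrow> F (x + h) \<omega> - f\<^sub>1 (x + h) \<omega> < F x \<omega> - f\<^sub>1 x \<omega>"
        by (auto simp: add.commute)
      from this(2)[of "d / 2"] \<open>d > 0\<close> ge[of "x + d / 2"] eq show False by simp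
    qed
    ultimately show "C1_solution (\<lambda>x. a x \<omega>) (\<lambda>x p. H x p \<omega>) \<mu> (\<lambda>x. clamp_real R (F x \<omega>)) \<and>
        (\<forall>x. f\<^sub>1 x \<omega> < clamp_real R (F x \<omega>) \<and> clamp_real R (F x \<omega>) < f\<^sub>2 x \<omega>)"
      using lt by (simp add: cl)
  qed
qed

lemma growth_rate_ge:
  assumes empty: "stationary_solutions_between P \<tau> a H \<mu> f\<^sub>1 f\<^sub>2 = {}"
    and \<theta>: "P.expectation (f\<^sub>1 0) < \<theta>" "\<theta> < P.expectation (f\<^sub>2 0)"
    and u: "\<And>\<omega>. uniformly_continuous_on ({0..} \<times> UNIV) (\<lambda>(t, x). u t x \<omega>)"
      "\<And>\<omega>. viscosity_supersolution (\<lambda>x. a x \<omega>) (\<lambda>x p. H x p \<omega>) (\<lambda>t x. u t x \<omega>)"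
      "\<And>x \<omega>. u 0 x \<omega> = \<theta> * x"
    and "\<mu>' < \<mu>"
  shows "AE \<omega> in P. ereal \<mu>' \<le> Liminf at_top (\<lambda>t. ereal (u t 0 \<omega> / t))"
proof -
  \<comment> \<open>The penalty perturbs the test gradient in the comparison, so the Lipschitz bound
    is taken on the larger range \<open>R + 1\<close>.\<close>
  obtain K' where K': "\<And>x p q \<omega>. \<bar>p\<bar> \<le> R + 1 \<Longrightarrow> \<bar>q\<bar> \<le> R + 1 \<Longrightarrow>
      \<bar>H x p \<omega> - H x q \<omega>\<bar> \<le> K' * \<bar>p - q\<bar>"
    using H_local[of "R + 1"] by blast
  have "AE \<omega> in P. crosses \<omega>"
    using crosses_zero_one no_crossing_gives_solution empty by blast
  moreover have "AE \<omega> in P. (\<forall>x. \<bar>f\<^sub>1 x \<omega>\<bar> \<le> R) \<and> continuous_on UNIV (\<lambda>x. f\<^sub>1 x \<omega>)"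
    "AE \<omega> in P. (\<forall>x. \<bar>f\<^sub>2 x \<omega>\<bar> \<le> R) \<and> continuous_on UNIV (\<lambda>x. f\<^sub>2 x \<omega>)"
    using AE_good unfolding good_def C1_solution_unfold continuous_on_eq_continuous_at[OF open_UNIV]
    by (eventually_elim, blast intro: DERIV_isCont)+
  note antiderivative_bound_right[OF f_stationary(1) this(1) \<theta>(1)]
    antiderivative_bound_left[OF f_stationary(2) this(2) \<theta>(2)]

  ultimately show ?thesis
    using AE_good
  proof eventually_elim
    fix \<omega> assume \<omega>: "good \<omega>" "crosses \<omega>"
      and ex: "\<exists>V C. (\<forall>x. (V has_real_derivative f\<^sub>1 x \<omega>) (at x)) \<and> (\<forall>x\<ge>0. V x \<le> \<theta> * x + C)"
        "\<exists>V C. (\<forall>x. (V has_real_derivative f\<^sub>2 x \<omega>) (at x)) \<and> (\<forall>x\<le>0. V x \<le> \<theta> * x + C)"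
    interpret c: corrector_iteration "\<lambda>x. a x \<omega>" "K + 1" "\<lambda>x p. N x p \<omega>" "(K + 1) * R + K" \<mu> lam R
      "\<lambda>x. f\<^sub>2 x \<omega>" "deriv (\<lambda>x. f\<^sub>2 x \<omega>)"
      by (rule corrector_iteration_good[OF \<omega>(1)])
    obtain V\<^sub>1 C\<^sub>1 where V1: "\<And>x. (V\<^sub>1 has_real_derivative f\<^sub>1 x \<omega>) (at x)" "\<And>x. x \<ge> 0 \<Longrightarrow> V\<^sub>1 x \<le> \<theta> * x + C\<^sub>1"
      using ex(1) by blast
    obtain V\<^sub>2 C\<^sub>2 where V2: "\<And>x. (V\<^sub>2 has_real_derivative f\<^sub>2 x \<omega>) (at x)" "\<And>x. x \<le> 0 \<Longrightarrow> V\<^sub>2 x \<le> \<theta> * x + C\<^sub>2"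
      using ex(2) by blast
    obtain x\<^sub>0 where "F x\<^sub>0 \<omega> < f\<^sub>1 x\<^sub>0 \<omega>" using \<omega>(2) by (auto simp: crosses_def)
    then have x0: "c.F x\<^sub>0 < f\<^sub>1 x\<^sub>0 \<omega>" by (simp add: F_good[OF \<omega>(1)])
    define \<epsilon> where "\<epsilon> = (\<mu> - \<mu>') / 2"
    have \<epsilon>: "\<epsilon> > 0" "\<mu>' < \<mu> - \<epsilon>" using \<open>\<mu>' < \<mu>\<close> by (auto simp: \<epsilon>_def field_simps)
    have "\<exists>g x\<^sub>1 x\<^sub>2. slope_subsolution (\<lambda>x. a x \<omega>) (\<lambda>x p. H x p \<omega>) (\<mu> - \<epsilon>) g \<and> (\<forall>x. \<bar>g x\<bar> \<le> R) \<and>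
        continuous_on UNIV g \<and> (\<forall>x\<le>x\<^sub>1. g x = f\<^sub>2 x \<omega>) \<and> (\<forall>x\<ge>x\<^sub>2. g x = f\<^sub>1 x \<omega>)"
    proof (rule c.connecting_subsolution[where f\<^sub>1 = "\<lambda>x. f\<^sub>1 x \<omega>" and f\<^sub>1' = "deriv (\<lambda>x. f\<^sub>1 x \<omega>)"])
      show "((\<lambda>x. f\<^sub>1 x \<omega>) has_real_derivative deriv (\<lambda>x. f\<^sub>1 x \<omega>) x) (at x)"
        "a x \<omega> * deriv (\<lambda>x. f\<^sub>1 x \<omega>) x + H x (f\<^sub>1 x \<omega>) \<omega> = lam"
        "\<bar>f\<^sub>1 x \<omega>\<bar> \<le> R" "f\<^sub>1 x \<omega> < f\<^sub>2 x \<omega>" for x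
        using \<omega>(1) unfolding good_def C1_solution_unfold by auto
    qed (use N_unclamped x0 \<epsilon> in auto)
    then obtain g x\<^sub>1 x\<^sub>2 where g: "slope_subsolution (\<lambda>x. a x \<omega>) (\<lambda>x p. H x p \<omega>) (\<mu> - \<epsilon>) g"
      "\<And>x. \<bar>g x\<bar> \<le> R" "continuous_on UNIV g" "\<And>x. x \<le> x\<^sub>1 \<Longrightarrow> g x = f\<^sub>2 x \<omega>" "\<And>x. x \<ge> x\<^sub>2 \<Longrightarrow> g x = f\<^sub>1 x \<omega>"
      by blast
    show "ereal \<mu>' \<le> Liminf at_top (\<lambda>t. ereal (u t 0 \<omega> / t))"
      by (rule lower_bound_of_slope_subsolution[OF u _ _ K' g V1 V2 \<epsilon>(2)]) (use a_range in auto)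
  qed
qed

end


context stationary_equation
begin

lemma continuous_path:
  assumes "f \<in> stationary_solutions P \<tau> a H lam"
  shows "AE \<omega> in P. continuous_on UNIV (\<lambda>x. f x \<omega>)"
proof -
  have "AE \<omega> in P. C1_solution (\<lambda>x. a x \<omega>) (\<lambda>x p. H x p \<omega>) lam (\<lambda>x. f x \<omega>)"
    using assms by (auto simp: stationary_solutions_def)
  then show ?thesis
    unfolding C1_solution_unfold continuous_on_eq_continuous_at[OF open_UNIV]
    by eventually_elim (blast intro: DERIV_isCont)
qed

text \<open>\<open>growth_rate_ge\<close> works strictly below \<open>lam\<close> and loses a little
  more. It is used with the levels \<open>lam - 1 / Suc n\<close> and
  \<open>lam - 2 / Suc n\<close>, which leaves countably many null sets to discard.\<close>

lemma lower_growth_ge: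
  assumes f: "f\<^sub>1 \<in> stationary_solutions P \<tau> a H lam" "f\<^sub>2 \<in> stationary_solutions P \<tau> a H lam"
    "AE \<omega> in P. \<forall>x. f\<^sub>1 x \<omega> < f\<^sub>2 x \<omega>"
    and empty: "\<And>\<mu>. \<mu> < lam \<Longrightarrow> stationary_solutions_between P \<tau> a H \<mu> f\<^sub>1 f\<^sub>2 = {}"
    and \<theta>: "P.expectation (f\<^sub>1 0) < \<theta>" "\<theta> < P.expectation (f\<^sub>2 0)"
    and u: "\<And>\<omega>. uniformly_continuous_on ({0..} \<times> UNIV) (\<lambda>(t, x). u \<theta> t x \<omega>)"
      "\<And>\<omega>. viscosity_supersolution (\<lambda>x. a x \<omega>) (\<lambda>x p. H x p \<omega>) (\<lambda>t x. u \<theta> t x \<omega>)"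
      "\<And>x \<omega>. u \<theta> 0 x \<omega> = \<theta> * x"
  shows "AE \<omega> in P. ereal lam \<le> lower_growth u \<theta> \<omega>"
proof -
  obtain R\<^sub>1 where R1: "AE \<omega> in P. \<forall>x. \<bar>f\<^sub>1 x \<omega>\<bar> \<le> R\<^sub>1"
    using essentially_bounded_paths[of f\<^sub>1] continuous_path[OF f(1)] f(1) by (auto simp: stationary_solutions_def)
  obtain R\<^sub>2 where R2: "AE \<omega> in P. \<forall>x. \<bar>f\<^sub>2 x \<omega>\<bar> \<le> R\<^sub>2"
    using essentially_bounded_paths[of f\<^sub>2] continuous_path[OF f(2)] f(2) by (auto simp: stationary_solutions_def)
  define R where "R = max R\<^sub>1 R\<^sub>2"
  obtain K where K: "\<And>x y p q \<omega>. \<bar>p\<bar> \<le> R \<Longrightarrow> \<bar>q\<bar> \<le> R \<Longrightarrow>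
        \<bar>H x p \<omega>\<bar> \<le> K \<and> \<bar>H x p \<omega> - H x q \<omega>\<bar> \<le> K * \<bar>p - q\<bar> \<and> \<bar>H x p \<omega> - H y p \<omega>\<bar> \<le> K * \<bar>x - y\<bar>"
    using H_local[of R] by blast
  have "AE \<omega> in P. ereal (lam - 2 / Suc n) \<le> lower_growth u \<theta> \<omega>" for n
  proof -
    interpret two_correctors P \<tau> a H f\<^sub>1 f\<^sub>2 lam "lam - 1 / Suc n" R K
    proof
      show "AE \<omega> in P. \<forall>x. \<bar>f\<^sub>1 x \<omega>\<bar> \<le> R" "AE \<omega> in P. \<forall>x. \<bar>f\<^sub>2 x \<omega>\<bar> \<le> R"
        using R1 R2 by (eventually_elim; force simp: R_def le_max_iff_disj)+
    qed (use f K in auto)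
    show ?thesis unfolding lower_growth_def
      by (rule growth_rate_ge[OF empty \<theta> u]) (auto simp: divide_strict_right_mono)
  qed
  then have "AE \<omega> in P. \<forall>n. ereal (lam - 2 / Suc n) \<le> lower_growth u \<theta> \<omega>"
    by (simp add: AE_all_countable)
  then show ?thesis
  proof eventually_elim
    fix \<omega> assume le: "\<forall>n. ereal (lam - 2 / Suc n) \<le> lower_growth u \<theta> \<omega>"
    have "(\<lambda>n. lam - 2 * inverse (real (Suc n))) \<longlonglongrightarrow> lam - 2 * 0"
      by (intro tendsto_intros LIMSEQ_inverse_real_of_nat)
    then have "(\<lambda>n. ereal (lam - 2 / Suc n)) \<longlonglongrightarrow> ereal lam"
      by (simp add: divide_inverse)
    then show "ereal lam \<le> lower_growth u \<theta> \<omega>"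
      by (rule LIMSEQ_le_const2) (use le in blast)
  qed
qed

section \<open>Reflection of the equation, exchanging upper and lower bounds\<close>

lemma reflected_equation: "stationary_equation P \<tau> a (\<lambda>x p \<omega>. - H x (- p) \<omega>)"
proof
  have "(\<lambda>q. (fst q, - fst (snd q) :: real, snd (snd q))) \<in> borel \<Otimes>\<^sub>M borel \<Otimes>\<^sub>M P \<rightarrow>\<^sub>M borel \<Otimes>\<^sub>M borel \<Otimes>\<^sub>M P"
    by measurable
  from measurable_compose[OF this H_measurable]
  show "(\<lambda>(x, p, \<omega>). - H x (- p) \<omega>) \<in> borel_measurable (borel \<Otimes>\<^sub>M borel \<Otimes>\<^sub>M P)"
    by (simp add: case_prod_beta)
  show "- H (x + y) (- p) \<omega> = - H x (- p) (\<tau> y \<omega>)" for x y p \<omega>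
    by (simp add: H_stationary)
  fix R
  obtain K where K: "\<And>x y p q \<omega>. \<bar>p\<bar> \<le> R \<Longrightarrow> \<bar>q\<bar> \<le> R \<Longrightarrow>
        \<bar>H x p \<omega>\<bar> \<le> K \<and> \<bar>H x p \<omega> - H x q \<omega>\<bar> \<le> K * \<bar>p - q\<bar> \<and> \<bar>H x p \<omega> - H y p \<omega>\<bar> \<le> K * \<bar>x - y\<bar>"
    using H_local[of R] by blast
  have "\<bar>- H x (- p) \<omega>\<bar> \<le> K \<and> \<bar>- H x (- p) \<omega> - - H x (- q) \<omega>\<bar> \<le> K * \<bar>p - q\<bar> \<and>
      \<bar>- H x (- p) \<omega> - - H y (- p) \<omega>\<bar> \<le> K * \<bar>x - y\<bar>" if "\<bar>p\<bar> \<le> R" "\<bar>q\<bar> \<le> R" for x y p q \<omega>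
    using K[of "- p" "- q" x \<omega> y] that by (auto simp: abs_minus_commute add.commute)
  then show "\<exists>K. \<forall>x y p q \<omega>. \<bar>p\<bar> \<le> R \<longrightarrow> \<bar>q\<bar> \<le> R \<longrightarrow> \<bar>- H x (- p) \<omega>\<bar> \<le> K \<and>
      \<bar>- H x (- p) \<omega> - - H x (- q) \<omega>\<bar> \<le> K * \<bar>p - q\<bar> \<and> \<bar>- H x (- p) \<omega> - - H y (- p) \<omega>\<bar> \<le> K * \<bar>x - y\<bar>"
    by blast
qed (use a_stationary a_range a_pos a_cont in auto)

end

lemma C1_solution_reflect:
  assumes "C1_solution A G \<mu> g"
  shows "C1_solution A (\<lambda>x p. - G x (- p)) (- \<mu>) (\<lambda>x. - g x)"
proof (rule C1_solutionI)
  show "((\<lambda>x. - g x) has_real_derivative - deriv g x) (at x)" for x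
    using assms by (auto intro!: derivative_eq_intros simp: C1_solution_unfold)
  show "continuous_on UNIV (\<lambda>x. - deriv g x)"
    using assms by (auto intro!: continuous_intros simp: C1_solution_unfold)
  show "A x * (- deriv g x) + - G x (- (- g x)) = - \<mu>" for x
    using assms by (auto simp: C1_solution_unfold)
qed

lemma stationary_uminus: "stationary P \<tau> f \<Longrightarrow> stationary P \<tau> (\<lambda>x \<omega>. - f x \<omega>)"
  by (auto simp: stationary_def case_prod_beta)

lemma stationary_solutions_reflect:
  assumes "f \<in> stationary_solutions P \<tau> a H \<mu>"
  shows "(\<lambda>x \<omega>. - f x \<omega>) \<in> stationary_solutions P \<tau> a (\<lambda>x p \<omega>. - H x (- p) \<omega>) (- \<mu>)"
proof -
  have "AE \<omega> in P. bounded (range (\<lambda>x. f x \<omega>)) \<and> C1_solution (\<lambda>x. a x \<omega>) (\<lambda>x p. H x p \<omega>) \<mu> (\<lambda>x. f x \<omega>)"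
    using assms by (simp add: stationary_solutions_def)
  then have "AE \<omega> in P. bounded (range (\<lambda>x. - f x \<omega>)) \<and>
      C1_solution (\<lambda>x. a x \<omega>) (\<lambda>x p. - H x (- p) \<omega>) (- \<mu>) (\<lambda>x. - f x \<omega>)"
    by eventually_elim (auto simp: bounded_iff intro!: C1_solution_reflect)
  with assms show ?thesis
    by (auto simp: stationary_solutions_def essentially_bounded_def intro: stationary_uminus)
qed

text \<open>The direction is from the reflected class to the original one, since that transfers
  emptiness to the reflected problem.\<close>

lemma stationary_solutions_between_reflect:
  assumes "f \<in> stationary_solutions_between P \<tau> a (\<lambda>x p \<omega>. - H x (- p) \<omega>) \<mu>
      (\<lambda>x \<omega>. - f\<^sub>2 x \<omega>) (\<lambda>x \<omega>. - f\<^sub>1 x \<omega>)"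
  shows "(\<lambda>x \<omega>. - f x \<omega>) \<in> stationary_solutions_between P \<tau> a H (- \<mu>) f\<^sub>1 f\<^sub>2"
proof -
  have "AE \<omega> in P. C1_solution (\<lambda>x. a x \<omega>) (\<lambda>x p. - H x (- p) \<omega>) \<mu> (\<lambda>x. f x \<omega>) \<and>
      (\<forall>x. - f\<^sub>2 x \<omega> < f x \<omega> \<and> f x \<omega> < - f\<^sub>1 x \<omega>)"
    using assms by (simp add: stationary_solutions_between_def)
  then have "AE \<omega> in P. C1_solution (\<lambda>x. a x \<omega>) (\<lambda>x p. H x p \<omega>) (- \<mu>) (\<lambda>x. - f x \<omega>) \<and>
      (\<forall>x. f\<^sub>1 x \<omega> < - f x \<omega> \<and> - f x \<omega> < f\<^sub>2 x \<omega>)"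
  proof eventually_elim
    fix \<omega> assume *: "C1_solution (\<lambda>x. a x \<omega>) (\<lambda>x p. - H x (- p) \<omega>) \<mu> (\<lambda>x. f x \<omega>) \<and>
      (\<forall>x. - f\<^sub>2 x \<omega> < f x \<omega> \<and> f x \<omega> < - f\<^sub>1 x \<omega>)"
    have "f\<^sub>1 x \<omega> < - f x \<omega> \<and> - f x \<omega> < f\<^sub>2 x \<omega>" for x
      using * by (metis minus_less_iff neg_less_iff_less minus_minus)
    with C1_solution_reflect[of "\<lambda>x. a x \<omega>" "\<lambda>x p. - H x (- p) \<omega>" \<mu> "\<lambda>x. f x \<omega>"] *
    show "C1_solution (\<lambda>x. a x \<omega>) (\<lambda>x p. H x p \<omega>) (- \<mu>) (\<lambda>x. - f x \<omega>) \<and>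
      (\<forall>x. f\<^sub>1 x \<omega> < - f x \<omega> \<and> - f x \<omega> < f\<^sub>2 x \<omega>)" by simp
  qed
  with assms show ?thesis
    by (auto simp: stationary_solutions_between_def bounded_iff intro: stationary_uminus)
qed

lemma viscosity_subsolution_reflect:
  assumes "viscosity_subsolution A G u"
  shows "viscosity_supersolution A (\<lambda>x p. - G x (- p)) (\<lambda>t x. - u t x)"
  unfolding viscosity_supersolution_def
proof (intro allI impI)
  fix \<phi> \<phi>t \<phi>x \<phi>xx and t x :: real
  assume test: "parabolic_test \<phi> \<phi>t \<phi>x \<phi>xx" and "t > 0"
    and ev: "\<forall>\<^sub>F (s, y) in nhds (t, x). - u s y - \<phi> s y \<ge> - u t x - \<phi> t x"
  have "parabolic_test (\<lambda>t x. - \<phi> t x) (\<lambda>t x. - \<phi>t t x) (\<lambda>t x. - \<phi>x t x) (\<lambda>t x. - \<phi>xx t x)"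
    using test unfolding parabolic_test_def case_prod_beta
    by (auto intro!: continuous_intros DERIV_minus)
  moreover have "\<forall>\<^sub>F (s, y) in nhds (t, x). u s y - (- \<phi> s y) \<le> u t x - (- \<phi> t x)"
    using ev by eventually_elim auto
  ultimately have "- \<phi>t t x \<le> A x * (- \<phi>xx t x) + G x (- \<phi>x t x)"
    using assms \<open>t > 0\<close> unfolding viscosity_subsolution_def by blast
  then show "\<phi>t t x \<ge> A x * \<phi>xx t x + - G x (- \<phi>x t x)" by simp
qed

lemma stationary_equation_of_coefficients:
  assumes "hj_coefficients P \<tau> a H \<kappa> \<alpha>\<^sub>0 \<alpha>\<^sub>1 \<gamma>"
  shows "stationary_equation P \<tau> a H"
proof -
  interpret hj_coefficients P \<tau> a H \<kappa> \<alpha>\<^sub>0 \<alpha>\<^sub>1 \<gamma> by (rule assms)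
  show ?thesis
  proof
    show "continuous_on UNIV (\<lambda>x. a x \<omega>)" for \<omega>
    proof -
      have "continuous_on UNIV (\<lambda>x. (sqrt (a x \<omega>))\<^sup>2)"
        by (intro continuous_intros lipschitz_on_continuous_on[OF A2])
      moreover have "(sqrt (a x \<omega>))\<^sup>2 = a x \<omega>" for x using a_range[of x \<omega>] by simp
      ultimately show ?thesis by simp
    qed
    fix R :: real
    define r where "r = \<bar>R\<bar>"
    define K\<^sub>1 where "K\<^sub>1 = \<alpha>\<^sub>1 * (r powr \<gamma> + 1)"
    define K\<^sub>2 where "K\<^sub>2 = \<alpha>\<^sub>1 * (2 * r + 1) powr (\<gamma> - 1)"
    \<comment> \<open>A sum, so that one constant covers the size of \<open>H\<close>, its variation
      in \<open>p\<close> (\<open>K\<^sub>2\<close>) and its variation in \<open>x\<close>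
      (\<open>K\<^sub>1\<close>).\<close>
    define K where "K = K\<^sub>1 + 1 / \<alpha>\<^sub>0 + K\<^sub>2"
    have r: "r \<ge> 0" by (simp add: r_def)
    have K0: "K\<^sub>1 \<ge> 0" "1 / \<alpha>\<^sub>0 \<ge> 0" "K\<^sub>2 \<ge> 0" using constants by (auto simp: K\<^sub>1_def K\<^sub>2_def)
    have "\<bar>H x p \<omega>\<bar> \<le> K \<and> \<bar>H x p \<omega> - H x q \<omega>\<bar> \<le> K * \<bar>p - q\<bar> \<and> \<bar>H x p \<omega> - H y p \<omega>\<bar> \<le> K * \<bar>x - y\<bar>"
      if "\<bar>p\<bar> \<le> R" "\<bar>q\<bar> \<le> R" for x y p q \<omega>
    proof (intro conjI)
      have p: "\<bar>p\<bar> \<le> r" "\<bar>q\<bar> \<le> r" using that by (auto simp: r_def)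
      have pow: "\<bar>p\<bar> powr \<gamma> \<le> r powr \<gamma>" using p constants by (intro powr_mono2) auto
      have K1: "\<alpha>\<^sub>1 * (\<bar>p\<bar> powr \<gamma> + 1) \<le> K\<^sub>1"
        unfolding K\<^sub>1_def using pow constants by (intro mult_left_mono) auto
      have "0 \<le> \<alpha>\<^sub>0 * \<bar>p\<bar> powr \<gamma>" using constants by simp
      then show "\<bar>H x p \<omega>\<bar> \<le> K"
        using H1[where x = x and p = p and \<omega> = \<omega>] K1 K0 unfolding K_def by linarith
      have "\<alpha>\<^sub>1 * (\<bar>p\<bar> + \<bar>q\<bar> + 1) powr (\<gamma> - 1) \<le> K\<^sub>2"
        unfolding K\<^sub>2_def using p constants by (intro mult_left_mono powr_mono2) auto
      then have "\<alpha>\<^sub>1 * (\<bar>p\<bar> + \<bar>q\<bar> + 1) powr (\<gamma> - 1) \<le> K" using K0 unfolding K_def by linarith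
      from order_trans[OF H2 mult_right_mono[OF this]]
      show "\<bar>H x p \<omega> - H x q \<omega>\<bar> \<le> K * \<bar>p - q\<bar>" by simp
      have "\<alpha>\<^sub>1 * (\<bar>p\<bar> powr \<gamma> + 1) \<le> K" using K1 K0 unfolding K_def by linarith
      from order_trans[OF H3 mult_right_mono[OF this]]
      show "\<bar>H x p \<omega> - H y p \<omega>\<bar> \<le> K * \<bar>x - y\<bar>" by simp
    qed
    then show "\<exists>K. \<forall>x y p q \<omega>. \<bar>p\<bar> \<le> R \<longrightarrow> \<bar>q\<bar> \<le> R \<longrightarrow> \<bar>H x p \<omega>\<bar> \<le> K \<and>
        \<bar>H x p \<omega> - H x q \<omega>\<bar> \<le> K * \<bar>p - q\<bar> \<and> \<bar>H x p \<omega> - H y p \<omega>\<bar> \<le> K * \<bar>x - y\<bar>"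
      by blast
  qed (use a_stationary a_range A1 H_measurable H_stationary in auto)
qed

theorem theorem4p2:
  fixes P :: "'w::polish_space measure"
    and \<tau> :: "real \<Rightarrow> 'w \<Rightarrow> 'w"
    and a :: "real \<Rightarrow> 'w \<Rightarrow> real"
    and H :: "real \<Rightarrow> real \<Rightarrow> 'w \<Rightarrow> real"
    and \<kappa> \<alpha>\<^sub>0 \<alpha>\<^sub>1 \<gamma> lam \<theta>\<^sub>1 \<theta>\<^sub>2 :: real
    and f\<^sub>1 f\<^sub>2 :: "real \<Rightarrow> 'w \<Rightarrow> real"
    and u :: "real \<Rightarrow> real \<Rightarrow> real \<Rightarrow> 'w \<Rightarrow> real"
  assumes "hj_coefficients P \<tau> a H \<kappa> \<alpha>\<^sub>0 \<alpha>\<^sub>1 \<gamma>"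
    and "\<And>\<theta> \<omega>. uc_viscosity_solution (\<lambda>x. a x \<omega>) (\<lambda>x p. H x p \<omega>) \<theta> (\<lambda>t x. u \<theta> t x \<omega>)"
    and "f\<^sub>1 \<in> stationary_solutions P \<tau> a H lam"
    and "f\<^sub>2 \<in> stationary_solutions P \<tau> a H lam"
    and "AE \<omega> in P. \<forall>x. f\<^sub>1 x \<omega> < f\<^sub>2 x \<omega>"
    and "\<theta>\<^sub>1 = prob_space.expectation P (\<lambda>\<omega>. f\<^sub>1 0 \<omega>)"
    and "\<theta>\<^sub>2 = prob_space.expectation P (\<lambda>\<omega>. f\<^sub>2 0 \<omega>)"
  shows "((\<forall>\<mu><lam. stationary_solutions_between P \<tau> a H \<mu> f\<^sub>1 f\<^sub>2 = {}) \<longrightarrow>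
            (\<forall>\<theta>\<in>{\<theta>\<^sub>1<..<\<theta>\<^sub>2}. AE \<omega> in P. ereal lam \<le> lower_growth u \<theta> \<omega>)) \<and>
         ((\<forall>\<mu>>lam. stationary_solutions_between P \<tau> a H \<mu> f\<^sub>1 f\<^sub>2 = {}) \<longrightarrow>
            (\<forall>\<theta>\<in>{\<theta>\<^sub>1<..<\<theta>\<^sub>2}. AE \<omega> in P. upper_growth u \<theta> \<omega> \<le> ereal lam))"
proof (intro conjI impI ballI)
  interpret stationary_equation P \<tau> a H
    by (rule stationary_equation_of_coefficients[OF assms(1)])
  interpret refl: stationary_equation P \<tau> a "\<lambda>x p \<omega>. - H x (- p) \<omega>"
    by (rule reflected_equation)
  note u = assms(2)[unfolded uc_viscosity_solution_def]
  fix \<theta> assume \<theta>: "\<theta> \<in> {\<theta>\<^sub>1<..<\<theta>\<^sub>2}"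
  show "AE \<omega> in P. ereal lam \<le> lower_growth u \<theta> \<omega>"
    if "\<forall>\<mu><lam. stationary_solutions_between P \<tau> a H \<mu> f\<^sub>1 f\<^sub>2 = {}"
    using that \<theta> u assms(6,7) by (intro lower_growth_ge[OF assms(3-5)]) auto
  show "AE \<omega> in P. upper_growth u \<theta> \<omega> \<le> ereal lam"
    if empty: "\<forall>\<mu>>lam. stationary_solutions_between P \<tau> a H \<mu> f\<^sub>1 f\<^sub>2 = {}"
  proof -
    \<comment> \<open>The family is reindexed so that its parameter is again its initial slope: at
      \<open>- \<theta>\<close> it is \<open>- u \<theta>\<close>, which starts from
      \<open>- \<theta> * x\<close>. Negation also swaps the correctors, so
      \<open>- f\<^sub>2\<close> is now the lower one.\<close>
    have "AE \<omega> in P. ereal (- lam) \<le> lower_growth (\<lambda>\<theta> t x \<omega>. - u (- \<theta>) t x \<omega>) (- \<theta>) \<omega>"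
    proof (rule refl.lower_growth_ge)
      show "(\<lambda>x \<omega>. - f\<^sub>2 x \<omega>) \<in> stationary_solutions P \<tau> a (\<lambda>x p \<omega>. - H x (- p) \<omega>) (- lam)"
        "(\<lambda>x \<omega>. - f\<^sub>1 x \<omega>) \<in> stationary_solutions P \<tau> a (\<lambda>x p \<omega>. - H x (- p) \<omega>) (- lam)"
        by (intro stationary_solutions_reflect assms(3,4))+
      show "AE \<omega> in P. \<forall>x. - f\<^sub>2 x \<omega> < - f\<^sub>1 x \<omega>" using assms(5) by simp
      show "stationary_solutions_between P \<tau> a (\<lambda>x p \<omega>. - H x (- p) \<omega>) \<mu>
          (\<lambda>x \<omega>. - f\<^sub>2 x \<omega>) (\<lambda>x \<omega>. - f\<^sub>1 x \<omega>) = {}" if "\<mu> < - lam" for \<mu>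
      proof -
        have "stationary_solutions_between P \<tau> a H (- \<mu>) f\<^sub>1 f\<^sub>2 = {}" using empty that by simp
        then show ?thesis using stationary_solutions_between_reflect by blast
      qed
      show "P.expectation (\<lambda>\<omega>. - f\<^sub>2 0 \<omega>) < - \<theta>" "- \<theta> < P.expectation (\<lambda>\<omega>. - f\<^sub>1 0 \<omega>)"
        using \<theta> assms(6,7) by auto
      show "uniformly_continuous_on ({0..} \<times> UNIV) (\<lambda>(t, x). - u (- (- \<theta>)) t x \<omega>)" for \<omega>
        using uniformly_continuous_on_minus[of "{0..} \<times> UNIV" "\<lambda>(t, x). u \<theta> t x \<omega>"] u[of \<theta> \<omega>]
        unfolding case_prod_beta by simp
      show "viscosity_supersolution (\<lambda>x. a x \<omega>) (\<lambda>x p. - H x (- p) \<omega>) (\<lambda>t x. - u (- (- \<theta>)) t x \<omega>)" for \<omega>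
        using u[of \<theta> \<omega>] viscosity_subsolution_reflect[of "\<lambda>x. a x \<omega>" "\<lambda>x p. H x p \<omega>" "\<lambda>t x. u \<theta> t x \<omega>"]
        by simp
      show "- u (- (- \<theta>)) 0 x \<omega> = - \<theta> * x" for x \<omega> using u by simp
    qed
    then show ?thesis
    proof eventually_elim
      fix \<omega> assume "ereal (- lam) \<le> lower_growth (\<lambda>\<theta> t x \<omega>. - u (- \<theta>) t x \<omega>) (- \<theta>) \<omega>"
      also have "\<dots> = - upper_growth u \<theta> \<omega>"
        unfolding lower_growth_def upper_growth_def by (simp add: ereal_Liminf_uminus flip: uminus_ereal.simps(1))
      finally show "upper_growth u \<theta> \<omega> \<le> ereal lam"
        by (simp add: ereal_uminus_le_reorder flip: uminus_ereal.simps(1))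
    qed
  qed
qed

end
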